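(* Let $(\Lambda,\le)$ be a directed poset and let $(X,\Sigma,\mu)$ be a locally measure space. For each $p\in X$ assign a quantized domain $\{\mathcal{H}_p;\ \mathcal{E}_p=\{\mathcal{H}_{\alpha,p}\}_{\alpha\in\Lambda};\ \mathcal{D}_p\}$, and let $\mathcal{D}=\int^{\oplus_{\mathrm{loc}}}_{X_{\mathrm{loc}}}\mathcal{D}_p\,\mathrm{d}\mu(p)$. Suppose that either $\Lambda$ is a countable set or $\mu$ is the counting measure on $X$. Then $$C^\ast_{\mathcal{E},\mathrm{DEC}}(\mathcal{D})=\left(C^\ast_{\mathcal{E},\mathrm{DIAG}}(\mathcal{D})\right)^\prime,$$ i.e. the set of decomposable locally bounded operators on $\mathcal{D}$ equals the commutant in $C^\ast_{\mathcal{E}}(\mathcal{D})$ of the set of diagonalizable locally bounded operators on $\mathcal{D}$.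
   Context: Throughout, $(\Lambda,\le)$ is a directed poset. Locally Hilbert space and quantized domain: a strictly inductive system of Hilbert spaces is a family $\{\mathcal{H}_\alpha\}_{\alpha\in\Lambda}$ of Hilbert spaces such that for $\alpha\le\beta$ one has $\mathcal{H}_\alpha\subseteq\mathcal{H}_\beta$ with isometric inclusion. A locally Hilbert space is the union $\mathcal{D}=\varinjlim_\alpha\mathcal{H}_\alpha=\bigcup_\alpha\mathcal{H}_\alpha$ of such a system. A quantized domain $\{\mathcal{H};\mathcal{F}=\{\mathcal{H}_\alpha\}_{\alpha\in\Lambda};\mathcal{D}\}$ consists of a strictly inductive system $\mathcal{F}$, its union $\mathcal{D}$, and the Hilbert space completion $\mathcal{H}=\overline{\mathcal{D}}$. Locally bounded operators: for a quantized domain $\{\mathcal{H};\mathcal{F}=\{\mathcal{H}_\alpha\}_{\alpha\in\Lambda};\mathcal{D}\}$, $C^\ast_{\mathcal{F}}(\mathcal{D})$ is the set of linear operators $T:\mathcal{D}\to\mathcal{D}$ such that for each $\alpha$: $T(\mathcal{H}_\alpha)\subseteq\mathcal{H}_\alpha$, $T(\mathcal{H}_\alpha^\perp\cap\mathcal{D})\subseteq\mathcal{H}_\alpha^\perp\cap\mathcal{D}$ and $T|_{\mathcal{H}_\alpha}$ is bounded. It is a unital $\ast$-algebra. For $\mathcal{M}\subseteq C^\ast_{\mathcal{F}}(\mathcal{D})$ the commutant is $\mathcal{M}^\prime:=\{T\in C^\ast_{\mathcal{F}}(\mathcal{D}): TS=ST\ \text{for all}\ S\in\mathcal{M}\}$.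 Locally measure space: let $\{(X_\alpha,\Sigma_\alpha,\mu_\alpha)\}_{\alpha\in\Lambda}$ be measure spaces such that for $\alpha\le\beta$: $X_\alpha\subseteq X_\beta$, $\Sigma_\alpha=\{E\cap X_\alpha:E\in\Sigma_\beta\}$ and $\Sigma_\alpha\subseteq\Sigma_\beta$, and $\mu_\alpha(E)=\mu_\beta(E)$ for all $E\in\Sigma_\alpha$. Put $X=\bigcup_\alpha X_\alpha$, $\Sigma=\{E\subseteq X: E\cap X_\alpha\in\Sigma_\alpha\ \forall\alpha\}$, and $\mu(E)=\lim_\alpha\mu_\alpha(E\cap X_\alpha)$ if this net converges, $\mu(E)=\infty$ otherwise. Then $(X,\Sigma,\mu)$ is a measure space, called a locally measure space. Standing assumption: each $X_\alpha$ is a $\sigma$-compact locally compact space, $\Sigma_\alpha$ is a Borel $\sigma$-algebra on $X_\alpha$, and $\mu_\alpha$ is the completion of a positive Borel measure on $X_\alpha$. Direct integral of locally Hilbert spaces: given quantized domains $\{\mathcal{H}_p;\mathcal{E}_p=\{\mathcal{H}_{\alpha,p}\}_{\alpha\in\Lambda};\mathcal{D}_p\}$, $p\in X$, the direct integral $\int^{\oplus_{\mathrm{loc}}}_{X_{\mathrm{loc}}}\mathcal{D}_p\,\mathrm{d}\mu(p)$ is a space $\mathcal{D}$ of maps $u:X\to\bigcup_{p}\mathcal{D}_p$ with $u(p)\in\mathcal{D}_p$ for all $p$ (maps agreeing $\mu$-a.e. are identified), such that: (1) for each $u\in\mathcal{D}$ there is $\alpha_u\in\Lambda$ with $u(p)\in\mathcal{H}_{\alpha_u,p}$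 for a.e. $p\in X_{\alpha_u}$ and $\mathrm{supp}(u):=\{p:u(p)\ne0\}\subseteq X_{\alpha_u}$; (2) for all $u,v\in\mathcal{D}$ the function $\zeta_{u,v}(p):=\langle u(p),v(p)\rangle_{\mathcal{D}_p}$ belongs to $L^1(X,\mu)$; (3) if $v:X\to\bigcup_p\mathcal{D}_p$ is such that there exists $\alpha\in\Lambda$ with $v(p)\in\mathcal{H}_{\alpha,p}$ for all $p\in X_\alpha$ and $v(p)=0$ for all $p\in X\setminus X_\alpha$, and if $\zeta_{u,v}\in L^1(X,\mu)$ for every $u\in\mathcal{D}$, then $v\in\mathcal{D}$. For $\alpha\in\Lambda$ put $\mathcal{H}_\alpha:=\{u\in\mathcal{D}: u(p)\in\mathcal{H}_{\alpha,p}\text{ for a.e. }p\in X_\alpha,\ \mathrm{supp}(u)\subseteq X_\alpha\}$ with $\langle u,v\rangle_{\mathcal{H}_\alpha}=\int_{X_\alpha}\langle u(p),v(p)\rangle\,\mathrm{d}\mu_\alpha$. These form a strictly inductive system of Hilbert spaces with union $\mathcal{D}$, giving the quantized domain $\{\overline{\mathcal{D}};\mathcal{E}=\{\mathcal{H}_\alpha\}_{\alpha\in\Lambda};\mathcal{D}\}$. Each $\mathcal{H}_\alpha$ is identified, by restricting maps to $X_\alpha$, with the Hilbert space direct integral $\int^\oplus_{X_\alpha}\mathcal{H}_{\alpha,p}\,\mathrm{d}\mu_\alpha(p)$ in the sense of Kadison–Ringrose (Definition 14.1.1), a notion in which the fibres $\mathcal{H}_{\alpha,p}$ and the direct integral are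 separable Hilbert spaces. Decomposable and diagonalizable operators: $T\in C^\ast_{\mathcal{E}}(\mathcal{D})$ is decomposable if there is a family $\{T_p\in C^\ast_{\mathcal{E}_p}(\mathcal{D}_p)\}_{p\in X}$ such that for every $u\in\mathcal{D}$, $(Tu)(p)=T_pu(p)$ for $\mu$-a.e. $p$. It is diagonalizable if it is decomposable and there is a measurable $f:X\to\mathbb{C}$ such that for every $u\in\mathcal{D}$, $(Tu)(p)=f(p)u(p)$ for $\mu$-a.e. $p$. The sets of all such operators are $C^\ast_{\mathcal{E},\mathrm{DEC}}(\mathcal{D})$ and $C^\ast_{\mathcal{E},\mathrm{DIAG}}(\mathcal{D})$ respectively.
   Formalization: In "decomposable", each T_p need only be locally bounded with respect to those H_{α,p} with p in X_α, not all α in Λ; with all α the equality fails, e.g. for two indices, two points, counting measure and T_p swapping coordinates at a point outside X_1. *)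

theory Defs
  imports "HOL-Analysis.Analysis"
begin

section \<open>Operators on a complex inner product space with a distinguished family of subspaces\<close>

text \<open>
  The operator algebras below are needed both for the fibres, whose vectors are points of a type,
  and for the direct integral, whose vectors are classes of maps; the latter carry no type class
  structure, hence the explicit record of operations. Inner products are linear in the first
  argument. The Hilbert completion of the space itself is not part of the data, since it is
  determined by the space and all notions involved only refer to vectors of the space.
\<close>

record 'a ip_space =
  vecs :: "'a set"
  vadd :: "'a \<Rightarrow> 'a \<Rightarrow> 'a"
  vscale :: "complex \<Rightarrow> 'a \<Rightarrow> 'a"
  vinner :: "'a \<Rightarrow> 'a \<Rightarrow> complex"

definition vnorm :: "'a ip_space \<Rightarrow> 'a \<Rightarrow> real" where
  "vnorm V x = sqrt (Re (vinner V x x))"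

text \<open>The guard makes the distance nonnegative and symmetric on the whole type, as the library
  locale \<^locale>\<open>Metric_space\<close> demands.\<close>

definition vdist :: "'a ip_space \<Rightarrow> 'a \<Rightarrow> 'a \<Rightarrow> real" where
  "vdist V x y =
     (if x \<in> vecs V \<and> y \<in> vecs V then vnorm V (vadd V x (vscale V (- 1) y)) else 0)"

definition complete_in :: "'a ip_space \<Rightarrow> 'a set \<Rightarrow> bool" where
  "complete_in V S \<longleftrightarrow> Metric_space.mcomplete S (vdist V)"

definition separable_in :: "'a ip_space \<Rightarrow> 'a set \<Rightarrow> bool" where
  "separable_in V S \<longleftrightarrow> separable_space (Metric_space.mtopology S (vdist V))"

text \<open>For a subset S of the space D this is the intersection of D with the orthogonal complement of
  S in the completion of D.\<close>

definition orth_in :: "'a ip_space \<Rightarrow> 'a set \<Rightarrow> 'a set" where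
  "orth_in V S = {x \<in> vecs V. \<forall>y\<in>S. vinner V x y = 0}"

definition linear_in :: "'a ip_space \<Rightarrow> ('a \<Rightarrow> 'a) \<Rightarrow> bool" where
  "linear_in V T \<longleftrightarrow>
     (\<forall>x\<in>vecs V. \<forall>y\<in>vecs V. T (vadd V x y) = vadd V (T x) (T y)) \<and>
     (\<forall>c. \<forall>x\<in>vecs V. T (vscale V c x) = vscale V c (T x))"

text \<open>The locally bounded operators on V for the family H of subspaces indexed by I.
  Operators are undefined outside the space, so that equality of operators is equality on the
  space.\<close>

definition loc_bounded_ops :: "'a ip_space \<Rightarrow> 'i set \<Rightarrow> ('i \<Rightarrow> 'a set) \<Rightarrow> ('a \<Rightarrow> 'a) set" where
  "loc_bounded_ops V I H =
     {T \<in> vecs V \<rightarrow>\<^sub>E vecs V. linear_in V T \<and>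
        (\<forall>\<alpha>\<in>I. T ` H \<alpha> \<subseteq> H \<alpha> \<and>
               T ` orth_in V (H \<alpha>) \<subseteq> orth_in V (H \<alpha>) \<and>
               (\<exists>B. \<forall>x\<in>H \<alpha>. vnorm V (T x) \<le> B * vnorm V x))}"

definition commutant_in ::
  "'a ip_space \<Rightarrow> 'i set \<Rightarrow> ('i \<Rightarrow> 'a set) \<Rightarrow> ('a \<Rightarrow> 'a) set \<Rightarrow> ('a \<Rightarrow> 'a) set" where
  "commutant_in V I H \<M> =
     {T \<in> loc_bounded_ops V I H. \<forall>S\<in>\<M>. \<forall>x\<in>vecs V. T (S x) = S (T x)}"

section \<open>Quantized domains\<close>

text \<open>
  A quantized domain is realised inside an ambient complex vector space 'h with scalar
  multiplication sc: the Hilbert spaces are subspaces, and since the inclusions of a strictly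
  inductive system are isometric, they share one inner product ip, defined on their union.
\<close>

definition union_space ::
  "(complex \<Rightarrow> 'h \<Rightarrow> 'h) \<Rightarrow> ('h \<Rightarrow> 'h \<Rightarrow> complex) \<Rightarrow> 'i set \<Rightarrow> ('i \<Rightarrow> 'h set)
     \<Rightarrow> ('h::ab_group_add) ip_space" where
  "union_space sc ip I H =
     \<lparr>vecs = (\<Union>\<alpha>\<in>I. H \<alpha>), vadd = (+), vscale = sc, vinner = ip\<rparr>"

definition inner_product_on ::
  "(complex \<Rightarrow> 'h \<Rightarrow> 'h) \<Rightarrow> ('h \<Rightarrow> 'h \<Rightarrow> complex) \<Rightarrow> ('h::ab_group_add) set \<Rightarrow> bool" where
  "inner_product_on sc ip D \<longleftrightarrow>
     (\<forall>x\<in>D. \<forall>y\<in>D. \<forall>z\<in>D. ip (x + y) z = ip x z + ip y z) \<and>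
     (\<forall>c. \<forall>x\<in>D. \<forall>y\<in>D. ip (sc c x) y = c * ip x y) \<and>
     (\<forall>x\<in>D. \<forall>y\<in>D. ip y x = cnj (ip x y)) \<and>
     (\<forall>x\<in>D. 0 \<le> Re (ip x x) \<and> (ip x x = 0 \<longrightarrow> x = 0))"

definition quantized_domain ::
  "(complex \<Rightarrow> 'h \<Rightarrow> 'h) \<Rightarrow> ('h \<Rightarrow> 'h \<Rightarrow> complex) \<Rightarrow> ('i::order) set
     \<Rightarrow> ('i \<Rightarrow> ('h::ab_group_add) set) \<Rightarrow> bool" where
  "quantized_domain sc ip I H \<longleftrightarrow>
     (\<forall>\<alpha>\<in>I. module.subspace sc (H \<alpha>)) \<and>
     (\<forall>\<alpha>\<in>I. \<forall>\<beta>\<in>I. \<alpha> \<le> \<beta> \<longrightarrow> H \<alpha> \<subseteq> H \<beta>) \<and>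
     inner_product_on sc ip (\<Union>\<alpha>\<in>I. H \<alpha>) \<and>
     (\<forall>\<alpha>\<in>I. complete_in (union_space sc ip I H) (H \<alpha>))"

section \<open>Locally measure spaces\<close>

definition loc_carrier :: "('i \<Rightarrow> 'x measure) \<Rightarrow> 'x set" where
  "loc_carrier M = (\<Union>\<alpha>. space (M \<alpha>))"

definition loc_sets :: "('i \<Rightarrow> 'x measure) \<Rightarrow> 'x set set" where
  "loc_sets M = {E. E \<subseteq> loc_carrier M \<and> (\<forall>\<alpha>. E \<inter> space (M \<alpha>) \<in> sets (M \<alpha>))}"

text \<open>In a directed index type, the filter \<^const>\<open>at_top\<close> is the one that defines convergence of
  nets.\<close>

definition loc_emeasure :: "('i::order \<Rightarrow> 'x measure) \<Rightarrow> 'x set \<Rightarrow> ennreal" where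
  "loc_emeasure M E =
     (let net = (\<lambda>\<alpha>. emeasure (M \<alpha>) (E \<inter> space (M \<alpha>)))
      in if \<exists>l. (net \<longlongrightarrow> l) at_top then Lim at_top net else \<infinity>)"

definition loc_measure :: "('i::order \<Rightarrow> 'x measure) \<Rightarrow> 'x measure" where
  "loc_measure M = measure_of (loc_carrier M) (loc_sets M) (loc_emeasure M)"

definition sigma_compact_space :: "'x topology \<Rightarrow> bool" where
  "sigma_compact_space T \<longleftrightarrow>
     (\<exists>K :: nat \<Rightarrow> 'x set. (\<forall>n. compactin T (K n)) \<and> topspace T = (\<Union>n. K n))"

definition completed_borel_measure :: "'x measure \<Rightarrow> bool" where
  "completed_borel_measure \<mu> \<longleftrightarrow>
     (\<exists>T N. topspace T = space \<mu> \<and> locally_compact_space T \<and> sigma_compact_space T \<and>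
        sets N = sigma_sets (topspace T) {U. openin T U} \<and> \<mu> = completion N)"

definition locally_measure_space :: "('i::order \<Rightarrow> 'x measure) \<Rightarrow> bool" where
  "locally_measure_space M \<longleftrightarrow>
     (\<forall>\<alpha>. completed_borel_measure (M \<alpha>)) \<and>
     (\<forall>\<alpha> \<beta>. \<alpha> \<le> \<beta> \<longrightarrow>
        space (M \<alpha>) \<subseteq> space (M \<beta>) \<and>
        sets (M \<alpha>) = {E \<inter> space (M \<alpha>) | E. E \<in> sets (M \<beta>)} \<and>
        sets (M \<alpha>) \<subseteq> sets (M \<beta>) \<and>
        (\<forall>E\<in>sets (M \<alpha>). emeasure (M \<alpha>) E = emeasure (M \<beta>) E))"

section \<open>Direct integrals of locally Hilbert spaces\<close>

text \<open>
  All fibres live in one ambient vector space (for instance the direct sum of the given fibres)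
  but each has its own inner product. The Hilbert space \<open>H \<alpha> p\<close> belongs to the data for p in the
  space of M \<alpha> only: neither the direct integral nor its Hilbert spaces ever refer to \<open>H \<alpha> p\<close> for
  other p. Accordingly the quantized domain at p is indexed by the following set, which is directed
  and cofinal, so that the union of the \<open>H \<alpha> p\<close> is not affected. This restriction matters for the
  locally bounded operators on the fibre: if they also had to reduce \<open>H \<alpha> p\<close> for p outside the
  space of M \<alpha>, then the equality of decomposable operators and commutant would fail already for
  two indices, two points and the counting measure.
\<close>

definition idx :: "('i \<Rightarrow> 'x measure) \<Rightarrow> 'x \<Rightarrow> 'i set" where
  "idx M p = {\<alpha>. p \<in> space (M \<alpha>)}"

definition fibre ::
  "('i \<Rightarrow> 'x measure) \<Rightarrow> (complex \<Rightarrow> 'h \<Rightarrow> 'h) \<Rightarrow> ('x \<Rightarrow> 'h \<Rightarrow> 'h \<Rightarrow> complex)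
     \<Rightarrow> ('i \<Rightarrow> 'x \<Rightarrow> 'h set) \<Rightarrow> 'x \<Rightarrow> ('h::ab_group_add) ip_space" where
  "fibre M sc ip H p = union_space sc (ip p) (idx M p) (\<lambda>\<alpha>. H \<alpha> p)"

text \<open>Maps on the carrier X are represented by functions on the whole type, whose values outside X
  are irrelevant. D is a set of actual maps; the space obtained by identifying maps that agree
  almost everywhere is \<open>integral_space\<close> below.\<close>

definition level_maps ::
  "('i::order \<Rightarrow> 'x measure) \<Rightarrow> ('i \<Rightarrow> 'x \<Rightarrow> 'h set) \<Rightarrow> ('x \<Rightarrow> 'h::ab_group_add) set
     \<Rightarrow> 'i \<Rightarrow> ('x \<Rightarrow> 'h) set" where
  "level_maps M H D \<alpha> =
     {u \<in> D. (AE p in M \<alpha>. u p \<in> H \<alpha> p) \<and> {p \<in> loc_carrier M. u p \<noteq> 0} \<subseteq> space (M \<alpha>)}"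

definition ae_class ::
  "('i::order \<Rightarrow> 'x measure) \<Rightarrow> ('x \<Rightarrow> 'h) set \<Rightarrow> ('x \<Rightarrow> 'h) \<Rightarrow> ('x \<Rightarrow> 'h) set" where
  "ae_class M D u = {v \<in> D. AE p in loc_measure M. v p = u p}"

definition repr :: "('x \<Rightarrow> 'h) set \<Rightarrow> 'x \<Rightarrow> 'h" where
  "repr A = (SOME u. u \<in> A)"

text \<open>On the classes of \<open>level_maps M H D \<alpha>\<close> the inner product equals the integral with respect to
  M \<alpha>, because such maps vanish outside the space of M \<alpha> and \<open>loc_measure M\<close> extends M \<alpha>.\<close>

definition integral_space ::
  "('i::order \<Rightarrow> 'x measure) \<Rightarrow> (complex \<Rightarrow> 'h \<Rightarrow> 'h) \<Rightarrow> ('x \<Rightarrow> 'h \<Rightarrow> 'h \<Rightarrow> complex)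
     \<Rightarrow> ('x \<Rightarrow> 'h::ab_group_add) set \<Rightarrow> ('x \<Rightarrow> 'h) set ip_space" where
  "integral_space M sc ip D =
     \<lparr>vecs = ae_class M D ` D,
      vadd = (\<lambda>A B. ae_class M D (\<lambda>p. repr A p + repr B p)),
      vscale = (\<lambda>c A. ae_class M D (\<lambda>p. sc c (repr A p))),
      vinner = (\<lambda>A B. LINT p|loc_measure M. ip p (repr A p) (repr B p))\<rparr>"

definition level ::
  "('i::order \<Rightarrow> 'x measure) \<Rightarrow> ('i \<Rightarrow> 'x \<Rightarrow> 'h set) \<Rightarrow> ('x \<Rightarrow> 'h::ab_group_add) set
     \<Rightarrow> 'i \<Rightarrow> ('x \<Rightarrow> 'h) set set" where
  "level M H D \<alpha> = ae_class M D ` level_maps M H D \<alpha>"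

text \<open>The Hilbert space at \<alpha> is the Kadison-Ringrose direct integral over M \<alpha> of the spaces
  \<open>H \<alpha> p\<close>. The last clause is their maximality condition. It tests v only against maps of the
  Hilbert space at \<alpha> and does not follow from the corresponding clause of \<open>loc_direct_integral\<close>,
  which tests against all of D.\<close>

definition level_is_direct_integral ::
  "('i::order \<Rightarrow> 'x measure) \<Rightarrow> (complex \<Rightarrow> 'h \<Rightarrow> 'h) \<Rightarrow> ('x \<Rightarrow> 'h \<Rightarrow> 'h \<Rightarrow> complex)
     \<Rightarrow> ('i \<Rightarrow> 'x \<Rightarrow> 'h set) \<Rightarrow> ('x \<Rightarrow> 'h::ab_group_add) set \<Rightarrow> 'i \<Rightarrow> bool" where
  "level_is_direct_integral M sc ip H D \<alpha> \<longleftrightarrow>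
     (\<forall>p\<in>space (M \<alpha>). separable_in (fibre M sc ip H p) (H \<alpha> p)) \<and>
     complete_in (integral_space M sc ip D) (level M H D \<alpha>) \<and>
     separable_in (integral_space M sc ip D) (level M H D \<alpha>) \<and>
     (\<forall>u\<in>level_maps M H D \<alpha>. \<forall>v\<in>level_maps M H D \<alpha>.
        integrable (M \<alpha>) (\<lambda>p. ip p (u p) (v p)) \<and>
        vinner (integral_space M sc ip D) (ae_class M D u) (ae_class M D v) =
          (LINT p|M \<alpha>. ip p (u p) (v p))) \<and>
     (\<forall>v. (\<forall>p\<in>space (M \<alpha>). v p \<in> H \<alpha> p) \<and>
          (\<forall>u\<in>level_maps M H D \<alpha>. integrable (M \<alpha>) (\<lambda>p. ip p (u p) (v p)))
          \<longrightarrow> (\<exists>w\<in>level_maps M H D \<alpha>. AE p in M \<alpha>. w p = v p))"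

definition loc_direct_integral ::
  "('i::order \<Rightarrow> 'x measure) \<Rightarrow> (complex \<Rightarrow> 'h \<Rightarrow> 'h) \<Rightarrow> ('x \<Rightarrow> 'h \<Rightarrow> 'h \<Rightarrow> complex)
     \<Rightarrow> ('i \<Rightarrow> 'x \<Rightarrow> 'h set) \<Rightarrow> ('x \<Rightarrow> 'h::ab_group_add) set \<Rightarrow> bool" where
  "loc_direct_integral M sc ip H D \<longleftrightarrow>
     (\<forall>u\<in>D. \<forall>p\<in>loc_carrier M. u p \<in> vecs (fibre M sc ip H p)) \<and>
     (\<lambda>p. 0) \<in> D \<and>
     (\<forall>u\<in>D. \<forall>v\<in>D. (\<lambda>p. u p + v p) \<in> D) \<and>
     (\<forall>c. \<forall>u\<in>D. (\<lambda>p. sc c (u p)) \<in> D) \<and>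
     (\<forall>u\<in>D. \<exists>\<alpha>. u \<in> level_maps M H D \<alpha>) \<and>
     (\<forall>u\<in>D. \<forall>v\<in>D. integrable (loc_measure M) (\<lambda>p. ip p (u p) (v p))) \<and>
     (\<forall>v. (\<exists>\<alpha>. (\<forall>p\<in>space (M \<alpha>). v p \<in> H \<alpha> p) \<and>
               (\<forall>p\<in>loc_carrier M - space (M \<alpha>). v p = 0)) \<and>
          (\<forall>u\<in>D. integrable (loc_measure M) (\<lambda>p. ip p (u p) (v p)))
          \<longrightarrow> v \<in> D) \<and>
     (\<forall>\<alpha>. level_is_direct_integral M sc ip H D \<alpha>)"

definition decomposable_ops ::
  "('i::order \<Rightarrow> 'x measure) \<Rightarrow> (complex \<Rightarrow> 'h \<Rightarrow> 'h) \<Rightarrow> ('x \<Rightarrow> 'h \<Rightarrow> 'h \<Rightarrow> complex)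
     \<Rightarrow> ('i \<Rightarrow> 'x \<Rightarrow> 'h set) \<Rightarrow> ('x \<Rightarrow> 'h::ab_group_add) set
     \<Rightarrow> (('x \<Rightarrow> 'h) set \<Rightarrow> ('x \<Rightarrow> 'h) set) set" where
  "decomposable_ops M sc ip H D =
     {T \<in> loc_bounded_ops (integral_space M sc ip D) UNIV (level M H D).
        \<exists>S. (\<forall>p\<in>loc_carrier M.
               S p \<in> loc_bounded_ops (fibre M sc ip H p) (idx M p) (\<lambda>\<alpha>. H \<alpha> p)) \<and>
            (\<forall>u\<in>D. \<forall>w\<in>T (ae_class M D u). AE p in loc_measure M. w p = S p (u p))}"

definition diagonalizable_ops ::
  "('i::order \<Rightarrow> 'x measure) \<Rightarrow> (complex \<Rightarrow> 'h \<Rightarrow> 'h) \<Rightarrow> ('x \<Rightarrow> 'h \<Rightarrow> 'h \<Rightarrow> complex)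
     \<Rightarrow> ('i \<Rightarrow> 'x \<Rightarrow> 'h set) \<Rightarrow> ('x \<Rightarrow> 'h::ab_group_add) set
     \<Rightarrow> (('x \<Rightarrow> 'h) set \<Rightarrow> ('x \<Rightarrow> 'h) set) set" where
  "diagonalizable_ops M sc ip H D =
     {T \<in> decomposable_ops M sc ip H D.
        \<exists>f \<in> borel_measurable (loc_measure M).
          \<forall>u\<in>D. \<forall>w\<in>T (ae_class M D u). AE p in loc_measure M. w p = sc (f p) (u p)}"

end

theory Submission
  imports Defs "HOL-Library.Function_Algebras"
begin

text \<open>
  All levels are restrictions of the one complete measure \<open>loc_measure M\<close>. Multiplication by the
  indicator of a measurable set is diagonalizable, so an operator T of the commutant satisfies, at
  each level, the norm bound of T pointwise almost everywhere. A countable family that is dense in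
  the level and closed under Gaussian rational combinations is fibrewise dense almost everywhere, by
  the maximality of the direct integral; hence T is given there by bounded operators on the fibres.
  Countably many null sets (or none, for the counting measure) have to be removed to make these
  operators compatible with the inclusions and the orthogonal complements of all levels
  simultaneously, and on the exceptional set the fibre operators are put to 0.
\<close>

section \<open>Semi-inner product spaces\<close>

text \<open>No measurable structure on the fibres is given: a map enters the direct integral only
  through its pairings with other elements. Since \<open>T\<close> acts on classes, every identity
  between chosen representatives holds off a null set that depends on the maps involved. This is why
  relations are first collected on a countable family: Gaussian rational coefficients keep it
  countable, and its values at one point still allow projection and bounded extension. Orthogonal
  complements are the delicate condition. A member of the dense family has no reason to take values
  orthogonal to a smaller level, so each member is corrected by its fibrewise projection
  (\<open>orthogonal_split\<close>), and orthogonality of the image is localised with indicators.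
  The inclusion of the decomposable operators in the commutant is elementary: a linear operator on a
  fibre commutes with the scalar \<open>f p\<close>.\<close>

definition nrm :: "('v \<Rightarrow> 'v \<Rightarrow> complex) \<Rightarrow> 'v \<Rightarrow> real" where
  "nrm b x = sqrt (Re (b x x))"

definition gauss_rat :: "complex set" where
  "gauss_rat = range (\<lambda>(r, s). Complex (real_of_rat r) (real_of_rat s))"

lemma countable_gauss_rat: "countable gauss_rat"
  unfolding gauss_rat_def by simp

lemma gauss_rat_mult:
  assumes "a \<in> gauss_rat" "b \<in> gauss_rat"
  shows "a * b \<in> gauss_rat"
proof -
  obtain r s r' s' where "a = Complex (real_of_rat r) (real_of_rat s)"
      "b = Complex (real_of_rat r') (real_of_rat s')"
    using assms unfolding gauss_rat_def by auto
  then have "a * b = (\<lambda>(r, s). Complex (real_of_rat r) (real_of_rat s)) (r * r' - s * s', r * s' + s * r')"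
    by (simp add: complex_eq_iff of_rat_mult of_rat_add of_rat_diff)
  then show ?thesis unfolding gauss_rat_def by blast
qed

lemma gauss_rat_members:
  "1 \<in> gauss_rat" "- 1 \<in> gauss_rat" "\<i> \<in> gauss_rat" "1 / of_nat (Suc n) \<in> gauss_rat"
proof -
  let ?f = "\<lambda>(r, s). Complex (real_of_rat r) (real_of_rat s)"
  have "?f (1, 0) = 1" "?f (-1, 0) = -1" "?f (0, 1) = \<i>" "?f (1 / of_nat (Suc n), 0) = 1 / of_nat (Suc n)"
    by (simp_all add: complex_eq_iff of_rat_divide of_rat_add Re_divide Im_divide power2_eq_square)
  then show "1 \<in> gauss_rat" "- 1 \<in> gauss_rat" "\<i> \<in> gauss_rat" "1 / of_nat (Suc n) \<in> gauss_rat"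
    unfolding gauss_rat_def by (metis rangeI)+
qed

lemma gauss_rat_dense:
  assumes "0 < e"
  shows "\<exists>k\<in>gauss_rat. cmod (k - c) < e"
proof -
  obtain r where r: "\<bar>real_of_rat r - Re c\<bar> < e / 2"
    using of_rat_dense[of "Re c - e/2" "Re c + e/2"] assms unfolding abs_diff_less_iff by auto
  obtain s where s: "\<bar>real_of_rat s - Im c\<bar> < e / 2"
    using of_rat_dense[of "Im c - e/2" "Im c + e/2"] assms unfolding abs_diff_less_iff by auto
  have "cmod (Complex (real_of_rat r) (real_of_rat s) - c) < e"
    using r s cmod_le[of "Complex (real_of_rat r) (real_of_rat s) - c"] by simp
  moreover have "Complex (real_of_rat r) (real_of_rat s) \<in> gauss_rat"
    unfolding gauss_rat_def by auto
  ultimately show ?thesis by blast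
qed

text \<open>The values at one point of a countable family of maps form no complex subspace unless
  they all vanish. Projection and extension are therefore based on this weaker closure property,
  which complex subspaces satisfy as well.\<close>

definition gauss_closed :: "(complex \<Rightarrow> 'v \<Rightarrow> 'v) \<Rightarrow> 'v::ab_group_add set \<Rightarrow> bool" where
  "gauss_closed sc A \<longleftrightarrow> 0 \<in> A \<and> (\<forall>x\<in>A. \<forall>y\<in>A. x + y \<in> A) \<and> (\<forall>k\<in>gauss_rat. \<forall>x\<in>A. sc k x \<in> A)"

definition seq_complete :: "('v \<Rightarrow> 'v \<Rightarrow> complex) \<Rightarrow> 'v::ab_group_add set \<Rightarrow> bool" where
  "seq_complete b S \<longleftrightarrow> (\<forall>\<sigma> :: nat \<Rightarrow> 'v. range \<sigma> \<subseteq> S \<and>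
     (\<forall>e>0. \<exists>N. \<forall>m\<ge>N. \<forall>n\<ge>N. nrm b (\<sigma> m - \<sigma> n) < e) \<longrightarrow>
     (\<exists>x\<in>S. (\<lambda>n. nrm b (\<sigma> n - x)) \<longlonglongrightarrow> 0))"

text \<open>Definiteness is left out because the locale serves twice: for the fibres, and for the
  maps in \<open>D\<close> with the integrated pairing, where a map vanishing almost everywhere has
  norm 0.\<close>

locale semi_ip = vector_space sc for sc :: "complex \<Rightarrow> 'v::ab_group_add \<Rightarrow> 'v" +
  fixes V :: "'v set" and b :: "'v \<Rightarrow> 'v \<Rightarrow> complex"
  assumes V_subspace: "subspace V"
    and add_left: "\<lbrakk>x \<in> V; y \<in> V; z \<in> V\<rbrakk> \<Longrightarrow> b (x + y) z = b x z + b y z"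
    and scale_left: "\<lbrakk>x \<in> V; y \<in> V\<rbrakk> \<Longrightarrow> b (sc c x) y = c * b x y"
    and herm: "\<lbrakk>x \<in> V; y \<in> V\<rbrakk> \<Longrightarrow> b y x = cnj (b x y)"
    and nonneg: "x \<in> V \<Longrightarrow> 0 \<le> Re (b x x)"
begin

lemma V_closed [simp]:
  "0 \<in> V" "\<lbrakk>x \<in> V; y \<in> V\<rbrakk> \<Longrightarrow> x + y \<in> V" "\<lbrakk>x \<in> V; y \<in> V\<rbrakk> \<Longrightarrow> x - y \<in> V" "x \<in> V \<Longrightarrow> - x \<in> V"
  "x \<in> V \<Longrightarrow> sc c x \<in> V"
  using V_subspace by (auto simp: subspace_0 subspace_add subspace_diff subspace_neg subspace_scale)

lemma minus_left: "\<lbrakk>x \<in> V; y \<in> V\<rbrakk> \<Longrightarrow> b (- x) y = - b x y"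
  using scale_left[of x y "-1"] by simp

lemma zero_left: "y \<in> V \<Longrightarrow> b 0 y = 0"
  using scale_left[of 0 y 0] by simp

lemma diff_left: "\<lbrakk>x \<in> V; y \<in> V; z \<in> V\<rbrakk> \<Longrightarrow> b (x - y) z = b x z - b y z"
  using add_left[of x "- y" z] minus_left[of y z] by simp

lemma add_right: "\<lbrakk>x \<in> V; y \<in> V; z \<in> V\<rbrakk> \<Longrightarrow> b z (x + y) = b z x + b z y"
  using add_left[of x y z] herm[of "x + y" z] herm[of x z] herm[of y z] by simp

lemma diff_right: "\<lbrakk>x \<in> V; y \<in> V; z \<in> V\<rbrakk> \<Longrightarrow> b z (x - y) = b z x - b z y"
  using diff_left[of x y z] herm[of "x - y" z] herm[of x z] herm[of y z] by simp

lemma scale_right: "\<lbrakk>x \<in> V; y \<in> V\<rbrakk> \<Longrightarrow> b y (sc c x) = cnj c * b y x"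
  using scale_left[of x y c] herm[of "sc c x" y] herm[of x y] by simp

lemma minus_right: "\<lbrakk>x \<in> V; y \<in> V\<rbrakk> \<Longrightarrow> b y (- x) = - b y x"
  using scale_right[of x y "-1"] by simp

lemma zero_right: "y \<in> V \<Longrightarrow> b y 0 = 0"
  using zero_left[of y] herm[of 0 y] by simp

lemma Im_self: "x \<in> V \<Longrightarrow> Im (b x x) = 0"
  using herm[of x x] by (simp add: complex_eq_iff)

lemma nrm_nonneg: "x \<in> V \<Longrightarrow> 0 \<le> nrm b x"
  using nonneg[of x] by (simp add: nrm_def)

lemma nrm_sq: "x \<in> V \<Longrightarrow> (nrm b x)\<^sup>2 = Re (b x x)"
  using nonneg[of x] by (simp add: nrm_def)

lemma nrm_zero: "nrm b 0 = 0"
  by (simp add: nrm_def zero_left)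

lemma nrm_scale: "x \<in> V \<Longrightarrow> nrm b (sc c x) = cmod c * nrm b x"
proof -
  assume x: "x \<in> V"
  have "b (sc c x) (sc c x) = (c * cnj c) * b x x"
    using x by (simp add: scale_left scale_right)
  also have "\<dots> = complex_of_real ((cmod c)\<^sup>2) * b x x"
    by (metis complex_norm_square)
  finally have "Re (b (sc c x) (sc c x)) = (cmod c)\<^sup>2 * Re (b x x)"
    by simp
  then show ?thesis by (simp add: nrm_def real_sqrt_mult)
qed

lemma nrm_minus: "x \<in> V \<Longrightarrow> nrm b (- x) = nrm b x"
  using nrm_scale[of x "-1"] by simp

lemma nrm_diff_commute: "\<lbrakk>x \<in> V; y \<in> V\<rbrakk> \<Longrightarrow> nrm b (x - y) = nrm b (y - x)"
  using nrm_minus[of "x - y"] by simp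

lemma nrm_add_sq: "\<lbrakk>x \<in> V; y \<in> V\<rbrakk> \<Longrightarrow> (nrm b (x + y))\<^sup>2 = (nrm b x)\<^sup>2 + (nrm b y)\<^sup>2 + 2 * Re (b x y)"
  using herm[of x y] by (simp add: nrm_sq add_left add_right)

lemma nrm_diff_sq: "\<lbrakk>x \<in> V; y \<in> V\<rbrakk> \<Longrightarrow> (nrm b (x - y))\<^sup>2 = (nrm b x)\<^sup>2 + (nrm b y)\<^sup>2 - 2 * Re (b x y)"
  using herm[of x y] by (simp add: nrm_sq diff_left diff_right)

lemma cauchy_schwarz:
  assumes x: "x \<in> V" and y: "y \<in> V"
  shows "cmod (b x y) \<le> nrm b x * nrm b y"
proof -
  define c where "c = b x y"
  \<comment> \<open>Expansion of the squared norm of \<open>x - t c y\<close> for real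
    \<open>t\<close>; the factor \<open>c\<close> makes the mixed term real.\<close>
  have key: "0 \<le> (nrm b x)\<^sup>2 - 2 * t * (cmod c)\<^sup>2 + t\<^sup>2 * (cmod c)\<^sup>2 * (nrm b y)\<^sup>2" for t :: real
  proof -
    have "0 \<le> (nrm b (x - sc (of_real t * c) y))\<^sup>2" by simp
    also have "\<dots> = (nrm b x)\<^sup>2 + (cmod (of_real t * c) * nrm b y)\<^sup>2 - 2 * Re (cnj (of_real t * c) * c)"
      using x y by (simp add: nrm_diff_sq nrm_scale scale_right c_def)
    also have "Re (cnj (of_real t * c) * c) = t * (cmod c)\<^sup>2"
      unfolding cmod_power2 by (simp add: power2_eq_square algebra_simps)
    finally show ?thesis by (simp add: norm_mult power_mult_distrib)
  qed
  have "(cmod c)\<^sup>2 \<le> (nrm b x)\<^sup>2 * (nrm b y)\<^sup>2"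
  proof (cases "nrm b y = 0")
    case True
    have "c = 0"
    proof (rule ccontr)
      assume "c \<noteq> 0"
      then have "0 < (cmod c)\<^sup>2" by simp
      \<comment> \<open>If \<open>y\<close> has norm 0, the bound \<open>key\<close> is affine in
        \<open>t\<close>. This value of \<open>t\<close> turns its right-hand side into minus the
        squared norm of \<open>x\<close> minus 2, which is negative.\<close>
      then have "2 * (((nrm b x)\<^sup>2 + 1) / (cmod c)\<^sup>2) * (cmod c)\<^sup>2 = 2 * ((nrm b x)\<^sup>2 + 1)"
        by simp
      then show False
        using key[of "((nrm b x)\<^sup>2 + 1) / (cmod c)\<^sup>2"] True zero_le_power2[of "nrm b x"]
        by (simp only:) simp
    qed
    then show ?thesis by simp
  next
    case False
    \<comment> \<open>The quadratic polynomial in \<open>key\<close> attains its minimum at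
      \<open>t = 1 / q\<close>.\<close>
    define q where "q = (nrm b y)\<^sup>2"
    have q: "0 < q" using False by (simp add: q_def)
    then have "(1 / q)\<^sup>2 * (cmod c)\<^sup>2 * q = (cmod c)\<^sup>2 / q" by (simp add: power2_eq_square[of "1 / q"])
    then have "(cmod c)\<^sup>2 / q \<le> (nrm b x)\<^sup>2"
      using key[of "1 / q"] unfolding q_def[symmetric] by simp
    then show ?thesis using q unfolding q_def[symmetric] by (simp add: pos_divide_le_eq)
  qed
  then have "(cmod c)\<^sup>2 \<le> (nrm b x * nrm b y)\<^sup>2" by (simp add: power_mult_distrib)
  then show ?thesis
    unfolding c_def using nrm_nonneg[OF x] nrm_nonneg[OF y]
    by (meson mult_nonneg_nonneg power2_le_imp_le)
qed

lemma nrm_triangle: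
  assumes "x \<in> V" "y \<in> V"
  shows "nrm b (x + y) \<le> nrm b x + nrm b y"
proof -
  have "Re (b x y) \<le> nrm b x * nrm b y"
    using cauchy_schwarz[OF assms] complex_Re_le_cmod order_trans by blast
  then have "(nrm b (x + y))\<^sup>2 \<le> (nrm b x + nrm b y)\<^sup>2"
    using assms by (simp add: nrm_add_sq power2_sum)
  then show ?thesis
    using nrm_nonneg assms by (meson add_nonneg_nonneg power2_le_imp_le)
qed

lemma nrm_triangle_diff:
  assumes "x \<in> V" "y \<in> V" "z \<in> V"
  shows "nrm b (x - z) \<le> nrm b (x - y) + nrm b (y - z)"
  using nrm_triangle[of "x - y" "y - z"] assms by simp

lemma nrm_reverse: "\<lbrakk>x \<in> V; y \<in> V\<rbrakk> \<Longrightarrow> nrm b x \<le> nrm b y + nrm b (x - y)"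
  using nrm_triangle[of y "x - y"] by simp

lemma parallelogram:
  assumes "x \<in> V" "y \<in> V"
  shows "(nrm b (x + y))\<^sup>2 + (nrm b (x - y))\<^sup>2 = 2 * (nrm b x)\<^sup>2 + 2 * (nrm b y)\<^sup>2"
  using assms by (simp add: nrm_add_sq nrm_diff_sq)

text \<open>\<open>w\<close> is the limit of a minimising sequence for the distance of \<open>x\<close> to \<open>A\<close>.\<close>

lemma projection:
  assumes AS: "A \<subseteq> S" and SV: "S \<subseteq> V" and S: "seq_complete b S" and A: "gauss_closed sc A" and x: "x \<in> V"
  shows "\<exists>w\<in>S. (\<forall>e>0. \<exists>a\<in>A. nrm b (w - a) < e) \<and> (\<forall>a\<in>A. b (x - w) a = 0)"
proof -
  have AV: "a \<in> V" if "a \<in> A" for a using that AS SV by blast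
  have A0: "0 \<in> A" and Aadd: "\<And>a a'. a \<in> A \<Longrightarrow> a' \<in> A \<Longrightarrow> a + a' \<in> A"
    and Asc: "\<And>k a. k \<in> gauss_rat \<Longrightarrow> a \<in> A \<Longrightarrow> sc k a \<in> A"
    using A unfolding gauss_closed_def by auto
  define d where "d = (INF a\<in>A. (nrm b (x - a))\<^sup>2)"
  have bdd: "bdd_below ((\<lambda>a. (nrm b (x - a))\<^sup>2) ` A)"
    by (rule bdd_belowI[of _ 0]) auto
  have d_le: "d \<le> (nrm b (x - a))\<^sup>2" if "a \<in> A" for a
    unfolding d_def by (rule cINF_lower[OF bdd that])
  have "\<exists>a\<in>A. (nrm b (x - a))\<^sup>2 < d + 1 / real (Suc n)" for n
    using cINF_less_iff[OF _ bdd, of "d + 1 / real (Suc n)"] A0 unfolding d_def by auto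
  then obtain \<sigma> where \<sigma>: "\<And>n. \<sigma> n \<in> A" "\<And>n. (nrm b (x - \<sigma> n))\<^sup>2 < d + 1 / real (Suc n)"
    by metis
  \<comment> \<open>Parallelogram law for \<open>x - \<sigma> m\<close> and
    \<open>x - \<sigma> n\<close>. Half their sum is the vector from the midpoint to
    \<open>x\<close>; the midpoint lies in \<open>A\<close> because 1/2 is a Gaussian rational, so
    the squared norm of that vector is at least \<open>d\<close>.\<close>
  have close: "(nrm b (\<sigma> m - \<sigma> n))\<^sup>2 \<le> 2 / real (Suc m) + 2 / real (Suc n)" for m n
  proof -
    let ?h = "1 / of_nat (Suc 1) :: complex"
    have mid: "sc ?h (\<sigma> m + \<sigma> n) \<in> A"
      using \<sigma>(1) Aadd Asc gauss_rat_members(4) by blast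
    have "sc 2 (sc ?h (\<sigma> m + \<sigma> n)) = \<sigma> m + \<sigma> n" by simp
    then have "(x - \<sigma> m) + (x - \<sigma> n) = sc 2 (x - sc ?h (\<sigma> m + \<sigma> n))"
      using scale_left_distrib[of 1 1 x] by (simp add: scale_right_diff_distrib algebra_simps)
    then have "(nrm b ((x - \<sigma> m) + (x - \<sigma> n)))\<^sup>2 = 4 * (nrm b (x - sc ?h (\<sigma> m + \<sigma> n)))\<^sup>2"
      using x AV[OF mid] by (simp add: nrm_scale power_mult_distrib)
    moreover have "(nrm b ((x - \<sigma> m) + (x - \<sigma> n)))\<^sup>2 + (nrm b (\<sigma> n - \<sigma> m))\<^sup>2
        = 2 * (nrm b (x - \<sigma> m))\<^sup>2 + 2 * (nrm b (x - \<sigma> n))\<^sup>2"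
      using parallelogram[of "x - \<sigma> m" "x - \<sigma> n"] x AV[OF \<sigma>(1)] by simp
    ultimately show ?thesis
      using d_le[OF mid] \<sigma>(2)[of m] \<sigma>(2)[of n] nrm_diff_commute[of "\<sigma> m" "\<sigma> n"] AV[OF \<sigma>(1)] by simp
  qed
  have "\<exists>N. \<forall>m\<ge>N. \<forall>n\<ge>N. nrm b (\<sigma> m - \<sigma> n) < e" if e: "0 < e" for e
  proof -
    obtain N where N: "1 / real (Suc N) < e\<^sup>2 / 4"
      using nat_approx_posE[of "e\<^sup>2 / 4"] e by auto
    have "nrm b (\<sigma> m - \<sigma> n) < e" if "m \<ge> N" "n \<ge> N" for m n
    proof -
      have "1 / real (Suc m) \<le> 1 / real (Suc N)" "1 / real (Suc n) \<le> 1 / real (Suc N)"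
        using that by (simp_all add: frac_le)
      then have "(nrm b (\<sigma> m - \<sigma> n))\<^sup>2 < e\<^sup>2"
        using close[of m n] N by simp
      then show ?thesis using e by (simp add: power2_less_imp_less)
    qed
    then show ?thesis by blast
  qed
  then obtain w where w: "w \<in> S" and lim: "(\<lambda>n. nrm b (\<sigma> n - w)) \<longlonglongrightarrow> 0"
    using S \<sigma>(1) AS unfolding seq_complete_def by (metis image_subset_iff subsetD)
  have wV: "w \<in> V" using w SV by blast
  have approx: "\<exists>a\<in>A. nrm b (w - a) < e" if e: "0 < e" for e
  proof -
    obtain n where "nrm b (\<sigma> n - w) < e"
      using order_tendstoD(2)[OF lim e] by (auto simp: eventually_sequentially)
    then show ?thesis using \<sigma>(1) nrm_diff_commute wV AV[OF \<sigma>(1)] by metis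
  qed
  have lim2: "(\<lambda>n. nrm b (x - (\<sigma> n + a))) \<longlonglongrightarrow> nrm b (x - (w + a))" if a: "a \<in> A" for a
  proof (rule LIM_zero_cancel, rule Lim_null_comparison[OF _ lim])
    show "\<forall>\<^sub>F n in sequentially. norm (nrm b (x - (\<sigma> n + a)) - nrm b (x - (w + a))) \<le> nrm b (\<sigma> n - w)"
    proof (rule always_eventually, rule allI)
      fix n
      have "x - (\<sigma> n + a) - (x - (w + a)) = - (\<sigma> n - w)" "x - (w + a) - (x - (\<sigma> n + a)) = \<sigma> n - w"
        by simp_all
      then show "norm (nrm b (x - (\<sigma> n + a)) - nrm b (x - (w + a))) \<le> nrm b (\<sigma> n - w)"
        using nrm_reverse[of "x - (\<sigma> n + a)" "x - (w + a)"] nrm_reverse[of "x - (w + a)" "x - (\<sigma> n + a)"]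
          x AV[OF \<sigma>(1)[of n]] AV[OF a] wV nrm_minus[of "\<sigma> n - w"] by (simp add: abs_le_iff)
    qed
  qed
  have dist_w: "(nrm b (x - w))\<^sup>2 \<le> d"
  proof (rule LIMSEQ_le)
    show "(\<lambda>n. (nrm b (x - \<sigma> n))\<^sup>2) \<longlonglongrightarrow> (nrm b (x - w))\<^sup>2"
      using tendsto_power[OF lim2[OF A0], of 2] by simp
    show "(\<lambda>n. d + 1 / real (Suc n)) \<longlonglongrightarrow> d"
      using tendsto_add[OF tendsto_const[of d] lim_inverse_n'[THEN LIMSEQ_Suc]] by simp
  qed (use \<sigma>(2) in \<open>auto intro!: exI[of _ 0] less_imp_le\<close>)
  \<comment> \<open>The points \<open>\<sigma> n + a\<close> remain in \<open>A\<close> and tend to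
    \<open>w + a\<close>, so shifting \<open>w\<close> by an element of \<open>A\<close> cannot
    bring it closer to \<open>x\<close>, although \<open>w\<close> itself need not lie in
    \<open>A\<close>.\<close>
  have min: "(nrm b (x - w))\<^sup>2 \<le> (nrm b (x - (w + a)))\<^sup>2" if a: "a \<in> A" for a
  proof (rule LIMSEQ_le_const[OF tendsto_power[OF lim2[OF a], of 2]])
    show "\<exists>N. \<forall>n\<ge>N. (nrm b (x - w))\<^sup>2 \<le> (nrm b (x - (\<sigma> n + a)))\<^sup>2"
      using d_le[OF Aadd[OF \<sigma>(1) a]] dist_w order_trans by blast
  qed
  \<comment> \<open>First-order optimality: comparing \<open>w\<close> with \<open>w + r a\<close>
    for small positive \<open>r\<close> bounds twice the real part by \<open>r\<close> times the
    squared norm of \<open>a\<close>. The values \<open>r = 1 / (n + 1)\<close> suffice and are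
    admissible scalars for \<open>A\<close>.\<close>
  have Re_le: "Re (b (x - w) a) \<le> 0" if a: "a \<in> A" for a
  proof (rule ccontr)
    assume "\<not> Re (b (x - w) a) \<le> 0"
    then have pos: "0 < Re (b (x - w) a)" by simp
    \<comment> \<open>The \<open>+ 1\<close> in the denominator covers vectors \<open>a\<close> of
      norm 0.\<close>
    obtain n where n: "1 / real (Suc n) < Re (b (x - w) a) / ((nrm b a)\<^sup>2 + 1)"
      using nat_approx_posE[of "Re (b (x - w) a) / ((nrm b a)\<^sup>2 + 1)"] pos
      by (metis add_nonneg_pos divide_pos_pos zero_le_power2 zero_less_one)
    let ?k = "1 / of_nat (Suc n) :: complex"
    define r where "r = 1 / real (Suc n)"
    have r0: "0 < r" by (simp add: r_def)
    have kr: "?k = of_real r" by (simp add: r_def)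
    have "sc ?k a \<in> A" using a Asc gauss_rat_members(4) by blast
    then have "(nrm b (x - w))\<^sup>2 \<le> (nrm b ((x - w) - sc ?k a))\<^sup>2"
      using min by (metis diff_diff_add)
    then have "2 * (r * Re (b (x - w) a)) \<le> r * r * (nrm b a)\<^sup>2"
      unfolding kr using x wV AV[OF a] r0
      by (simp add: nrm_diff_sq[of "x - w"] nrm_scale scale_right power_mult_distrib power2_eq_square[of r])
    then have "2 * Re (b (x - w) a) \<le> r * (nrm b a)\<^sup>2"
      using r0 by (simp add: mult.assoc)
    also have "\<dots> \<le> r * ((nrm b a)\<^sup>2 + 1)" using r0 by simp
    also have "\<dots> < Re (b (x - w) a)"
      using n unfolding r_def[symmetric] by (simp add: pos_less_divide_eq add_nonneg_pos)
    finally show False using pos by simp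
  qed
  have "b (x - w) a = 0" if a: "a \<in> A" for a
  proof -
    \<comment> \<open>The directions \<open>a\<close>, \<open>- a\<close>, \<open>\<i> a\<close> and
      \<open>- \<i> a\<close> bound the real and the imaginary part from both sides.\<close>
    have "sc (-1) a \<in> A" "sc \<i> a \<in> A" "sc (-1) (sc \<i> a) \<in> A"
      using a Asc gauss_rat_members by blast+
    from this[THEN Re_le] show ?thesis
      using Re_le[OF a] x wV AV[OF a]
      by (simp add: complex_eq_iff scale_right minus_right)
  qed
  then show ?thesis using w approx by blast
qed

text \<open>The graph of the extension is the closure of \<open>G\<close>.\<close>

lemma bounded_extension:
  assumes S_sub: "subspace S" and SV: "S \<subseteq> V" and S: "seq_complete b S"
    and definite: "\<And>x. x \<in> S \<Longrightarrow> nrm b x = 0 \<Longrightarrow> x = 0"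
    and GS: "\<And>x y. (x, y) \<in> G \<Longrightarrow> x \<in> S \<and> y \<in> S"
    and Gadd: "\<And>x y x' y'. (x, y) \<in> G \<Longrightarrow> (x', y') \<in> G \<Longrightarrow> (x + x', y + y') \<in> G"
    and Gsc: "\<And>k x y. k \<in> gauss_rat \<Longrightarrow> (x, y) \<in> G \<Longrightarrow> (sc k x, sc k y) \<in> G"
    and bound: "\<And>x y. (x, y) \<in> G \<Longrightarrow> nrm b y \<le> B * nrm b x" and B: "0 \<le> B"
    and dense: "\<And>x e. x \<in> S \<Longrightarrow> 0 < e \<Longrightarrow> \<exists>(x', y') \<in> G. nrm b (x - x') < e"
  shows "\<exists>F. (\<forall>x\<in>S. F x \<in> S \<and> nrm b (F x) \<le> B * nrm b x) \<and>
    (\<forall>x\<in>S. \<forall>y\<in>S. F (x + y) = F x + F y) \<and> (\<forall>c. \<forall>x\<in>S. F (sc c x) = sc c (F x)) \<and>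
    (\<forall>(x, y)\<in>G. F x = y)"
proof -
  have inV [simp]: "x \<in> S \<Longrightarrow> x \<in> V" for x using SV by blast
  have S_closed [simp]: "x \<in> S \<Longrightarrow> y \<in> S \<Longrightarrow> x + y \<in> S" "x \<in> S \<Longrightarrow> y \<in> S \<Longrightarrow> x - y \<in> S"
      "x \<in> S \<Longrightarrow> sc c x \<in> S" for x y c
    using S_sub by (auto simp: subspace_add subspace_diff subspace_scale)
  have Gdiff: "(x - x', y - y') \<in> G" if "(x, y) \<in> G" "(x', y') \<in> G" for x y x' y'
    using Gadd[OF that(1) Gsc[OF gauss_rat_members(2) that(2)]] by simp
  define cl where "cl x y \<longleftrightarrow> x \<in> S \<and> y \<in> S \<and>
    (\<forall>e>0. \<exists>(x', y')\<in>G. nrm b (x - x') < e \<and> nrm b (y - y') < e)" for x y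
  have clE: "\<exists>x' y'. (x', y') \<in> G \<and> x' \<in> S \<and> y' \<in> S \<and> nrm b (x - x') < e \<and> nrm b (y - y') < e"
    if "cl x y" "0 < e" for x y e
    using that GS unfolding cl_def by fast
  have cl_G: "cl x y" if "(x, y) \<in> G" for x y
    using that GS[OF that] nrm_zero unfolding cl_def
    by (auto intro!: bexI[of _ "(x, y)"])
  have cl_bound: "nrm b y \<le> B * nrm b x" if "cl x y" for x y
  proof (rule field_le_epsilon)
    fix e :: real assume e: "0 < e"
    \<comment> \<open>Passing to an approximating pair costs \<open>d\<close> in the second
      component and \<open>B * d\<close> through the first, in total \<open>(B + 1) * d\<close>,
      which stays below \<open>e\<close>.\<close>
    define d where "d = e / (2 * B + 1)"
    have d: "0 < d" using e B by (simp add: d_def)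
    obtain x' y' where xy: "(x', y') \<in> G" "x' \<in> S" "y' \<in> S" "nrm b (x - x') < d" "nrm b (y - y') < d"
      using clE[OF \<open>cl x y\<close> d] by blast
    have xyS: "x \<in> S" "y \<in> S" using that unfolding cl_def by auto
    have "nrm b x' \<le> nrm b x + d"
      using nrm_reverse[of x' x] nrm_diff_commute[of x x'] xy xyS by simp
    then have "B * nrm b x' \<le> B * (nrm b x + d)" using B by (rule mult_left_mono)
    then have "nrm b y \<le> B * (nrm b x + d) + d"
      using nrm_reverse[of y y'] bound[OF xy(1)] xy xyS by simp
    also have "\<dots> = B * nrm b x + (B + 1) * d" by (simp add: algebra_simps)
    also have "(B + 1) * d \<le> (2 * B + 1) * d" using B d by simp
    also have "\<dots> = e" using B by (simp add: d_def)
    finally show "nrm b y \<le> B * nrm b x + e" by simp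
  qed
  have cl_add: "cl (x + u) (y + v)" if "cl x y" "cl u v" for x y u v
  proof -
    have "\<exists>(x', y')\<in>G. nrm b (x + u - x') < e \<and> nrm b (y + v - y') < e" if e: "0 < e" for e
    proof -
      from e have e2: "0 < e / 2" by simp
      obtain x' y' where 1: "(x', y') \<in> G" "x' \<in> S" "y' \<in> S" "nrm b (x - x') < e/2" "nrm b (y - y') < e/2"
        using clE[OF \<open>cl x y\<close> e2] by blast
      obtain u' v' where 2: "(u', v') \<in> G" "u' \<in> S" "v' \<in> S" "nrm b (u - u') < e/2" "nrm b (v - v') < e/2"
        using clE[OF \<open>cl u v\<close> e2] by blast
      have S: "x \<in> S" "y \<in> S" "u \<in> S" "v \<in> S" using \<open>cl x y\<close> \<open>cl u v\<close> unfolding cl_def by auto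
      have "nrm b (x + u - (x' + u')) \<le> nrm b (x - x') + nrm b (u - u')"
        using nrm_triangle[of "x - x'" "u - u'"] 1 2 S by (simp add: add_diff_add)
      moreover have "nrm b (y + v - (y' + v')) \<le> nrm b (y - y') + nrm b (v - v')"
        using nrm_triangle[of "y - y'" "v - v'"] 1 2 S by (simp add: add_diff_add)
      ultimately show ?thesis using Gadd[OF 1(1) 2(1)] 1 2 by force
    qed
    then show ?thesis using \<open>cl x y\<close> \<open>cl u v\<close> unfolding cl_def by auto
  qed
  \<comment> \<open>Complex homogeneity is created here: \<open>G\<close> admits only Gaussian
    rational factors, so the scalar and the vectors are approximated at the same time, each at the
    cost of \<open>e / 2\<close>.\<close>
  have cl_sc: "cl (sc c x) (sc c y)" if "cl x y" for c x y
  proof -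
    have S: "x \<in> S" "y \<in> S" using that unfolding cl_def by auto
    have est: "nrm b (sc c z - sc k z') < e"
      if "z \<in> S" "z' \<in> S" "cmod (k - c) * (nrm b x + nrm b y + 1) < e / 2" "nrm b z \<le> nrm b x + nrm b y"
        "nrm b (z - z') < e / (2 * (cmod c + 1))" "nrm b (z - z') < 1" "0 < e" for z z' k e
    proof -
      have eq: "sc c z - sc k z' = sc c (z - z') - sc (k - c) z'"
        by (simp add: scale_right_diff_distrib scale_left_diff_distrib)
      have "nrm b (sc c z - sc k z') \<le> nrm b (sc c (z - z')) + nrm b (sc (k - c) z')"
        unfolding eq using nrm_triangle[of "sc c (z - z')" "- sc (k - c) z'"] that
        by (simp add: nrm_minus)
      also have "\<dots> = cmod c * nrm b (z - z') + cmod (k - c) * nrm b z'"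
        using that by (simp add: nrm_scale)
      also have "cmod c * nrm b (z - z') \<le> (cmod c + 1) * (e / (2 * (cmod c + 1)))"
        using that nrm_nonneg[of "z - z'"] by (intro mult_mono) auto
      also have "\<dots> = e / 2" using norm_ge_zero[of c] by (simp add: field_simps add_nonneg_eq_0_iff)
      also have "nrm b z' \<le> nrm b x + nrm b y + 1"
        using nrm_reverse[of z' z] nrm_diff_commute[of z z'] that by simp
      then have "cmod (k - c) * nrm b z' \<le> cmod (k - c) * (nrm b x + nrm b y + 1)"
        by (rule mult_left_mono) simp
      finally show ?thesis using that by simp
    qed
    have "\<exists>(x', y')\<in>G. nrm b (sc c x - x') < e \<and> nrm b (sc c y - y') < e" if e: "0 < e" for e
    proof -
      \<comment> \<open>\<open>R\<close> bounds the norms of the approximants of both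
        \<open>x\<close> and \<open>y\<close>; the cap 1 in \<open>d\<close> below guarantees
        this.\<close>
      define R where "R = nrm b x + nrm b y + 1"
      have R: "0 < R" using nrm_nonneg[of x] nrm_nonneg[of y] S by (simp add: R_def)
      obtain k where k: "k \<in> gauss_rat" "cmod (k - c) < e / (2 * R)"
        using gauss_rat_dense[of "e / (2 * R)" c] e R by auto
      then have kR: "cmod (k - c) * R < e / 2" using R by (simp add: field_simps)
      define d where "d = min 1 (e / (2 * (cmod c + 1)))"
      have d: "0 < d" using e norm_ge_zero[of c] by (simp add: d_def add_nonneg_pos)
      obtain x' y' where xy: "(x', y') \<in> G" "x' \<in> S" "y' \<in> S" "nrm b (x - x') < d" "nrm b (y - y') < d"
        using clE[OF \<open>cl x y\<close> d] by blast
      have "nrm b (sc c x - sc k x') < e" "nrm b (sc c y - sc k y') < e"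
        using est[of x x' k e] est[of y y' k e] xy S kR e nrm_nonneg[of x] nrm_nonneg[of y]
        unfolding d_def R_def by auto
      then show ?thesis using Gsc[OF k(1) xy(1)] by blast
    qed
    then show ?thesis using S unfolding cl_def by auto
  qed
  \<comment> \<open>The pair of 0 and \<open>y - y'\<close> lies in the closure, so the bound forces
    \<open>y - y'\<close> to have norm 0, and definiteness on \<open>S\<close> applies.\<close>
  have cl_uniq: "y = y'" if "cl x y" "cl x y'" for x y y'
  proof -
    have "cl (x + sc (-1) x) (y + sc (-1) y')"
      using that cl_add cl_sc by blast
    then have "nrm b (y - y') \<le> B * nrm b 0" using cl_bound by force
    moreover have "y \<in> S" "y' \<in> S" using that unfolding cl_def by auto
    ultimately show ?thesis using definite[of "y - y'"] nrm_nonneg[of "y - y'"] nrm_zero by force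
  qed
  \<comment> \<open>Along pairs of \<open>G\<close> whose first components tend to \<open>x\<close>,
    the bound applied to differences makes the second components a Cauchy sequence; its limit is the
    value.\<close>
  have cl_total: "\<exists>y. cl x y" if x: "x \<in> S" for x
  proof -
    have "\<exists>z\<in>G. nrm b (x - fst z) < 1 / real (Suc n)" for n
      using dense[OF x, of "1 / real (Suc n)"] by force
    then obtain z where z: "\<And>n. z n \<in> G" "\<And>n. nrm b (x - fst (z n)) < 1 / real (Suc n)"
      by metis
    define f g where "f n = fst (z n)" and "g n = snd (z n)" for n
    have fg: "(f n, g n) \<in> G" "f n \<in> S" "g n \<in> S" for n
      using z(1)[of n] GS[of "f n" "g n"] by (auto simp: f_def g_def)
    have flim: "nrm b (x - f n) < 1 / real (Suc n)" for n using z(2) by (simp add: f_def)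
    have gdiff: "nrm b (g m - g n) \<le> B * (1 / real (Suc m) + 1 / real (Suc n))" for m n
    proof -
      have "nrm b (f m - f n) \<le> 1 / real (Suc m) + 1 / real (Suc n)"
        using nrm_triangle_diff[of "f m" x "f n"] nrm_diff_commute[of "f m" x] flim[of m] flim[of n] fg x
        by simp
      then show ?thesis
        using bound[OF Gdiff[OF fg(1)[of m] fg(1)[of n]]] B mult_left_mono order_trans by blast
    qed
    have "\<exists>N. \<forall>m\<ge>N. \<forall>n\<ge>N. nrm b (g m - g n) < e" if e: "0 < e" for e
    proof -
      obtain N where N: "1 / real (Suc N) < e / (2 * (B + 1))"
        using nat_approx_posE[of "e / (2 * (B + 1))"] e B by auto
      have "nrm b (g m - g n) < e" if "m \<ge> N" "n \<ge> N" for m n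
      proof -
        have "1 / real (Suc m) \<le> 1 / real (Suc N)" "1 / real (Suc n) \<le> 1 / real (Suc N)"
          using that by (simp_all add: frac_le)
        then have "B * (1 / real (Suc m) + 1 / real (Suc n)) \<le> (B + 1) * (1 / real (Suc N) + 1 / real (Suc N))"
          using B by (intro mult_mono) auto
        also have "\<dots> < e" using N B by (simp add: field_simps)
        finally show ?thesis using gdiff[of m n] by simp
      qed
      then show ?thesis by blast
    qed
    then obtain y where y: "y \<in> S" and lim: "(\<lambda>n. nrm b (g n - y)) \<longlonglongrightarrow> 0"
      using S fg(3) unfolding seq_complete_def by (metis image_subset_iff)
    have "\<exists>(x', y')\<in>G. nrm b (x - x') < e \<and> nrm b (y - y') < e" if e: "0 < e" for e
    proof -
      have "(\<lambda>n. 1 / real (Suc n)) \<longlonglongrightarrow> 0" using lim_inverse_n'[THEN LIMSEQ_Suc] .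
      then have "\<forall>\<^sub>F n in sequentially. nrm b (g n - y) < e \<and> 1 / real (Suc n) < e"
        using order_tendstoD(2)[OF lim e] order_tendstoD(2) e eventually_conj by blast
      then obtain n where n: "nrm b (g n - y) < e" "1 / real (Suc n) < e"
        by (auto simp: eventually_sequentially)
      then have "nrm b (x - f n) < e" "nrm b (y - g n) < e"
        using flim[of n] nrm_diff_commute[of y "g n"] y fg by auto
      then show ?thesis using fg(1)[of n] by blast
    qed
    then show ?thesis using x y unfolding cl_def by auto
  qed
  obtain F where F: "\<And>x. x \<in> S \<Longrightarrow> cl x (F x)" using cl_total by metis
  have FS: "F x \<in> S" if "x \<in> S" for x using F[OF that] unfolding cl_def by simp
  show ?thesis
  proof (intro exI[of _ F] conjI ballI allI)
    fix x assume x: "x \<in> S"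
    show "F x \<in> S" using FS[OF x] .
    show "nrm b (F x) \<le> B * nrm b x" using cl_bound[OF F[OF x]] .
    show "F (sc c x) = sc c (F x)" for c
      using cl_uniq[OF F cl_sc[OF F[OF x]]] x by simp
    show "F (x + y) = F x + F y" if "y \<in> S" for y
      using cl_uniq[OF F cl_add[OF F[OF x] F[OF that]]] x that by simp
  next
    fix z assume "z \<in> G"
    then show "case z of (x, y) \<Rightarrow> F x = y"
      using cl_uniq[OF F cl_G] GS by (cases z) auto
  qed
qed

end

section \<open>Locally measure spaces\<close>

lemma seq_complete_of_mcomplete:
  assumes M: "Metric_space S d" and complete: "Metric_space.mcomplete S d"
    and d: "\<And>x y. x \<in> S \<Longrightarrow> y \<in> S \<Longrightarrow> d x y = nrm b (x - y)"
  shows "seq_complete b S"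
  unfolding seq_complete_def
proof (intro allI impI, elim conjE)
  fix \<sigma> :: "nat \<Rightarrow> 'a"
  assume \<sigma>: "range \<sigma> \<subseteq> S" and cauchy: "\<forall>e>0. \<exists>N. \<forall>m\<ge>N. \<forall>n\<ge>N. nrm b (\<sigma> m - \<sigma> n) < e"
  interpret Metric_space S d by fact
  have \<sigma>S: "\<sigma> n \<in> S" for n using \<sigma> by blast
  have "MCauchy \<sigma>"
    unfolding MCauchy_def using \<sigma> cauchy by (simp add: d \<sigma>S)
  then obtain x where x: "limitin mtopology \<sigma> x sequentially"
    using complete unfolding mcomplete_def by blast
  then have xS: "x \<in> S" and lim: "(\<lambda>n. d (\<sigma> n) x) \<longlonglongrightarrow> 0"
    unfolding limitin_metric_dist_null by auto
  then show "\<exists>x\<in>S. (\<lambda>n. nrm b (\<sigma> n - x)) \<longlonglongrightarrow> 0"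
    by (auto simp: d \<sigma>S xS)
qed

lemma (in complete_measure) measurable_cong_AE:
  assumes f: "f \<in> M \<rightarrow>\<^sub>M N" and ae: "AE x in M. f x = g x" and g: "g \<in> space M \<rightarrow> space N"
  shows "g \<in> M \<rightarrow>\<^sub>M N"
proof (rule measurableI)
  show "g x \<in> space N" if "x \<in> space M" for x using g that by auto
  fix A assume A: "A \<in> sets N"
  show "g -` A \<inter> space M \<in> sets M"
  proof (rule in_sets_AE[OF _ measurable_sets[OF f A]])
    show "AE x in M. x \<in> f -` A \<inter> space M \<longleftrightarrow> x \<in> g -` A \<inter> space M"
      using ae by eventually_elim auto
  qed auto
qed

text \<open>In a complete measure, preimages that differ by a null set are measurable together. This
  transfers integrability to maps built by pointwise choice, about whose measurability nothing is
  known in advance.\<close>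

lemma (in complete_measure) integrable_AE:
  fixes f g :: "'a \<Rightarrow> 'b::{banach, second_countable_topology}"
  assumes f: "integrable M f" and ae: "AE x in M. f x = g x"
  shows "integrable M g"
proof -
  have "g \<in> borel_measurable M"
    by (rule measurable_cong_AE[OF borel_measurable_integrable[OF f] ae]) auto
  then show ?thesis
    using f ae integrable_cong_AE[of f M g] by auto
qed

text \<open>The set \<open>E\<close> is taken to be where the real part, the imaginary part or one
  of their negatives is positive. In this way orthogonality tested against all cut-off maps becomes
  orthogonality in almost every fibre.\<close>

lemma AE_zero_of_integral_zero:
  fixes f :: "'a \<Rightarrow> complex"
  assumes f: "integrable M f"
    and zero: "\<And>E. E \<in> sets M \<Longrightarrow> (LINT x|M. (if x \<in> E then f x else 0)) = 0"
  shows "AE x in M. f x = 0"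
proof -
  have *: "AE x in M. g x \<le> 0"
    if g: "integrable M g" and g0: "\<And>E. E \<in> sets M \<Longrightarrow> (LINT x|M. (if x \<in> E then g x else 0)) = 0"
    for g :: "'a \<Rightarrow> real"
  proof -
    have [measurable]: "g \<in> borel_measurable M" using g by simp
    define E where "E = {x\<in>space M. 0 < g x}"
    have E [measurable]: "E \<in> sets M" by (simp add: E_def)
    have "integrable M (\<lambda>x. if x \<in> E then g x else 0)"
      by (rule Bochner_Integration.integrable_bound[OF g]) auto
    then have "(LINT x|M. (if x \<in> E then g x else 0)) = 0 \<longleftrightarrow> (AE x in M. (if x \<in> E then g x else 0) = 0)"
      by (rule integral_nonneg_eq_0_iff_AE) (auto simp: E_def)
    then have "AE x in M. (if x \<in> E then g x else 0) = 0" using g0[OF E] by blast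
    moreover have "AE x in M. x \<in> space M" by simp
    ultimately show ?thesis by eventually_elim (auto simp: E_def split: if_splits)
  qed
  have int: "integrable M (\<lambda>x. if x \<in> E then f x else 0)" if [measurable]: "E \<in> sets M" for E
    using borel_measurable_integrable[OF f]
    by (intro Bochner_Integration.integrable_bound[OF f]) auto
  have Re0: "(LINT x|M. (if x \<in> E then Re (f x) else 0)) = 0" if "E \<in> sets M" for E
    using integral_Re[OF int[OF that]] zero[OF that] by (simp add: if_distrib[of Re] cong: if_cong)
  have Im0: "(LINT x|M. (if x \<in> E then Im (f x) else 0)) = 0" if "E \<in> sets M" for E
    using integral_Im[OF int[OF that]] zero[OF that] by (simp add: if_distrib[of Im] cong: if_cong)
  have neg: "(LINT x|M. (if x \<in> E then - g x else 0)) = 0"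
    if "(LINT x|M. (if x \<in> E then g x else 0)) = 0" for E and g :: "'a \<Rightarrow> real"
  proof -
    have "(\<lambda>x. if x \<in> E then - g x else 0) = (\<lambda>x. - (if x \<in> E then g x else 0))" by auto
    then show ?thesis using that by simp
  qed
  have "AE x in M. Re (f x) \<le> 0" "AE x in M. Im (f x) \<le> 0"
      "AE x in M. - Re (f x) \<le> 0" "AE x in M. - Im (f x) \<le> 0"
    using *[of "\<lambda>x. Re (f x)"] *[of "\<lambda>x. Im (f x)"] *[of "\<lambda>x. - Re (f x)"] *[of "\<lambda>x. - Im (f x)"]
      f Re0 Im0 neg[OF Re0] neg[OF Im0] by simp_all
  then show ?thesis by eventually_elim (simp add: complex_eq_iff)
qed

locale loc_ms =
  fixes M :: "'i::order \<Rightarrow> 'x measure"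
  assumes directed: "\<forall>\<alpha> \<beta> :: 'i. \<exists>\<gamma>. \<alpha> \<le> \<gamma> \<and> \<beta> \<le> \<gamma>"
    and lms: "locally_measure_space M"
begin

abbreviation L where "L \<equiv> loc_measure M"

lemma M_complete: "complete_measure (M \<alpha>)"
  using lms unfolding locally_measure_space_def completed_borel_measure_def
  by (metis completion.complete_measure_axioms)

lemma M_mono:
  assumes "\<alpha> \<le> \<beta>"
  shows "space (M \<alpha>) \<subseteq> space (M \<beta>)" "sets (M \<alpha>) = {E \<inter> space (M \<alpha>) | E. E \<in> sets (M \<beta>)}"
    "sets (M \<alpha>) \<subseteq> sets (M \<beta>)" "E \<in> sets (M \<alpha>) \<Longrightarrow> emeasure (M \<alpha>) E = emeasure (M \<beta>) E"
  using lms assms unfolding locally_measure_space_def by blast+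

text \<open>Indices that are not comparable are handled at a common upper bound: \<open>E\<close> is
  measurable there, and traces on lower spaces are measurable.\<close>

lemma sets_M_in_loc_sets: "E \<in> sets (M \<alpha>) \<Longrightarrow> E \<in> loc_sets M"
proof -
  assume E: "E \<in> sets (M \<alpha>)"
  have "E \<inter> space (M \<beta>) \<in> sets (M \<beta>)" for \<beta>
  proof -
    obtain \<gamma> where "\<alpha> \<le> \<gamma>" "\<beta> \<le> \<gamma>" using directed by blast
    then show ?thesis using E M_mono(3)[of \<alpha> \<gamma>] M_mono(2)[of \<beta> \<gamma>] by blast
  qed
  then show ?thesis
    using sets.sets_into_space[OF E] unfolding loc_sets_def loc_carrier_def by auto
qed

lemma sigma_algebra_loc_sets: "sigma_algebra (loc_carrier M) (loc_sets M)"
  unfolding sigma_algebra_iff2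
proof (intro conjI ballI allI impI)
  show "loc_sets M \<subseteq> Pow (loc_carrier M)" "{} \<in> loc_sets M" by (auto simp: loc_sets_def)
  fix E assume E: "E \<in> loc_sets M"
  have "(loc_carrier M - E) \<inter> space (M \<alpha>) = space (M \<alpha>) - E \<inter> space (M \<alpha>)" for \<alpha>
    by (auto simp: loc_carrier_def)
  then show "loc_carrier M - E \<in> loc_sets M" using E unfolding loc_sets_def by auto
next
  fix A :: "nat \<Rightarrow> 'x set" assume A: "range A \<subseteq> loc_sets M"
  have "(\<Union>n. A n) \<inter> space (M \<alpha>) \<in> sets (M \<alpha>)" for \<alpha>
  proof -
    have An: "A n \<inter> space (M \<alpha>) \<in> sets (M \<alpha>)" for n using A by (auto simp: loc_sets_def)
    have eq: "(\<Union>n. A n) \<inter> space (M \<alpha>) = (\<Union>n. A n \<inter> space (M \<alpha>))" by auto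
    show ?thesis unfolding eq using An by (intro sets.countable_UN) auto
  qed
  then show "(\<Union>n. A n) \<in> loc_sets M" using A unfolding loc_sets_def by auto
qed

text \<open>Directedness makes the principal filters of the upper sets a filter base, so
  \<open>at_top\<close> describes convergence of nets although the order need not be linear.\<close>

lemma eventually_at_top_directed: "eventually P (at_top :: 'i filter) \<longleftrightarrow> (\<exists>k. \<forall>n\<ge>k. P n)"
proof -
  have "eventually P (at_top :: 'i filter) \<longleftrightarrow> (\<exists>k\<in>UNIV. eventually P (principal {k::'i..}))"
    unfolding at_top_def
  proof (rule eventually_INF_base)
    fix a b :: 'i
    obtain c where "a \<le> c" "b \<le> c" using directed by blast
    then have "principal {c..} \<le> inf (principal {a..}) (principal {b..})"
      by (auto intro: order_trans)
    then show "\<exists>x\<in>UNIV. principal {x..} \<le> inf (principal {a..}) (principal {b..})" by blast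
  qed auto
  then show ?thesis by (simp add: eventually_principal Ball_def)
qed

text \<open>The net is increasing along a directed set, hence it always converges in
  \<open>ennreal\<close>, with the supremum as limit; the default value \<infinity> of the
  definition is never chosen for lack of convergence.\<close>

lemma loc_emeasure_eq_SUP:
  assumes E: "E \<in> loc_sets M"
  shows "loc_emeasure M E = (SUP \<alpha>. emeasure (M \<alpha>) (E \<inter> space (M \<alpha>)))"
proof -
  define f where "f \<alpha> = emeasure (M \<alpha>) (E \<inter> space (M \<alpha>))" for \<alpha>
  have mono: "f \<alpha> \<le> f \<beta>" if "\<alpha> \<le> \<beta>" for \<alpha> \<beta>
  proof -
    have "E \<inter> space (M \<alpha>) \<in> sets (M \<alpha>)" "E \<inter> space (M \<beta>) \<in> sets (M \<beta>)"
      using E by (auto simp: loc_sets_def)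
    then show ?thesis
      using M_mono(4)[OF that] M_mono(1)[OF that] unfolding f_def by (auto intro: emeasure_mono)
  qed
  have lim: "(f \<longlongrightarrow> (SUP \<alpha>. f \<alpha>)) at_top"
  proof (rule order_tendstoI)
    fix a assume "a < (SUP \<alpha>. f \<alpha>)"
    then obtain \<alpha> where "a < f \<alpha>" by (auto simp: less_SUP_iff)
    then show "\<forall>\<^sub>F \<alpha> in at_top. a < f \<alpha>"
      unfolding eventually_at_top_directed using mono less_le_trans by blast
  next
    fix a assume "(SUP \<alpha>. f \<alpha>) < a"
    then show "\<forall>\<^sub>F \<alpha> in at_top. f \<alpha> < a"
      by (intro always_eventually allI) (meson SUP_upper UNIV_I le_less_trans)
  qed
  have "(at_top :: 'i filter) \<noteq> bot"
    unfolding trivial_limit_def eventually_at_top_directed by auto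
  then show ?thesis
    using lim tendsto_Lim[OF _ lim] unfolding loc_emeasure_def f_def by (auto simp: Let_def)
qed

lemma positive_loc_emeasure: "positive (loc_sets M) (loc_emeasure M)"
proof -
  have "{} \<in> loc_sets M" by (auto simp: loc_sets_def)
  then show ?thesis unfolding positive_def by (simp add: loc_emeasure_eq_SUP)
qed

lemma countably_additive_loc_emeasure: "countably_additive (loc_sets M) (loc_emeasure M)"
proof (rule countably_additiveI)
  fix A :: "nat \<Rightarrow> 'x set"
  assume A: "range A \<subseteq> loc_sets M" and disj: "disjoint_family A" and UA: "(\<Union>n. A n) \<in> loc_sets M"
  let ?f = "\<lambda>\<alpha> n. emeasure (M \<alpha>) (A n \<inter> space (M \<alpha>))"
  have mono: "?f \<alpha> n \<le> ?f \<beta> n" if "\<alpha> \<le> \<beta>" for \<alpha> \<beta> n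
  proof -
    have "A n \<inter> space (M \<alpha>) \<in> sets (M \<alpha>)" "A n \<inter> space (M \<beta>) \<in> sets (M \<beta>)"
      using A by (auto simp: loc_sets_def)
    then show ?thesis
      using M_mono(4)[OF that] M_mono(1)[OF that] by (auto intro: emeasure_mono)
  qed
  have "(\<Sum>n. loc_emeasure M (A n)) = (\<Sum>n. SUP \<alpha>. ?f \<alpha> n)"
    using A by (auto intro!: suminf_cong loc_emeasure_eq_SUP)
  \<comment> \<open>Monotone convergence for a directed family: all terms grow with the index, so
    the supremum and the infinite sum may be exchanged.\<close>
  also have "\<dots> = (SUP \<alpha>. \<Sum>n. ?f \<alpha> n)"
  proof (rule ennreal_suminf_SUP_eq_directed)
    fix N :: "nat set" and i j :: 'i
    obtain k where "i \<le> k" "j \<le> k" using directed by blast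
    then show "\<exists>k\<in>UNIV. \<forall>n\<in>N. ?f i n \<le> ?f k n \<and> ?f j n \<le> ?f k n" using mono by blast
  qed
  also have "\<dots> = (SUP \<alpha>. emeasure (M \<alpha>) ((\<Union>n. A n) \<inter> space (M \<alpha>)))"
  proof (rule SUP_cong[OF refl])
    fix \<alpha>
    have "(\<Sum>n. ?f \<alpha> n) = emeasure (M \<alpha>) (\<Union>n. A n \<inter> space (M \<alpha>))"
    proof (rule suminf_emeasure)
      show "range (\<lambda>n. A n \<inter> space (M \<alpha>)) \<subseteq> sets (M \<alpha>)" using A by (auto simp: loc_sets_def)
      show "disjoint_family (\<lambda>n. A n \<inter> space (M \<alpha>))" using disj unfolding disjoint_family_on_def by blast
    qed
    then show "(\<Sum>n. ?f \<alpha> n) = emeasure (M \<alpha>) ((\<Union>n. A n) \<inter> space (M \<alpha>))" by simp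
  qed
  also have "\<dots> = loc_emeasure M (\<Union>n. A n)" using loc_emeasure_eq_SUP[OF UA] by simp
  finally show "(\<Sum>n. loc_emeasure M (A n)) = loc_emeasure M (\<Union>n. A n)" .
qed

lemma space_L: "space L = loc_carrier M"
  and sets_L: "sets L = loc_sets M"
proof -
  interpret sigma_algebra "loc_carrier M" "loc_sets M" by (rule sigma_algebra_loc_sets)
  show "space L = loc_carrier M" "sets L = loc_sets M"
    unfolding loc_measure_def using space_closed by (simp_all add: sigma_sets_eq)
qed

lemma emeasure_L: "E \<in> sets L \<Longrightarrow> emeasure L E = (SUP \<alpha>. emeasure (M \<alpha>) (E \<inter> space (M \<alpha>)))"
  using emeasure_measure_of_sigma[OF sigma_algebra_loc_sets positive_loc_emeasure countably_additive_loc_emeasure]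
    loc_emeasure_eq_SUP unfolding sets_L by (simp add: loc_measure_def)

lemma space_M_L: "space (M \<alpha>) \<in> sets L" "space (M \<alpha>) \<subseteq> space L"
  using sets_M_in_loc_sets[of "space (M \<alpha>)" \<alpha>] by (auto simp: sets_L space_L loc_carrier_def)

text \<open>For \<open>E\<close> measurable at level \<open>\<alpha>\<close> the net defining its
  measure is constant from \<open>\<alpha>\<close> on, so the supremum is attained there. From here
  on, integrals and null sets of all levels can be expressed through \<open>L\<close>.\<close>

lemma M_eq_restrict: "M \<alpha> = restrict_space L (space (M \<alpha>))"
proof (rule measure_eqI)
  have *: "sets (restrict_space L (space (M \<alpha>))) = (\<inter>) (space (M \<alpha>)) ` loc_sets M"
    by (simp add: sets_restrict_space sets_L)
  have sub: "E = space (M \<alpha>) \<inter> E" if "E \<in> sets (M \<alpha>)" for E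
    using sets.sets_into_space[OF that] by blast
  show eq: "sets (M \<alpha>) = sets (restrict_space L (space (M \<alpha>)))"
  proof
    show "sets (M \<alpha>) \<subseteq> sets (restrict_space L (space (M \<alpha>)))"
      unfolding * using sub sets_M_in_loc_sets by blast
    show "sets (restrict_space L (space (M \<alpha>))) \<subseteq> sets (M \<alpha>)"
      unfolding * by (auto simp: loc_sets_def Int_commute)
  qed
  fix E assume E: "E \<in> sets (M \<alpha>)"
  have "emeasure (restrict_space L (space (M \<alpha>))) E = emeasure L E"
    using sets.sets_into_space[OF E] space_M_L by (intro emeasure_restrict_space) auto
  also have "\<dots> = (SUP \<beta>. emeasure (M \<beta>) (E \<inter> space (M \<beta>)))"
    using sets_M_in_loc_sets[OF E] by (simp add: emeasure_L sets_L)
  also have "\<dots> = emeasure (M \<alpha>) E"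
  proof (rule antisym)
    show "(SUP \<beta>. emeasure (M \<beta>) (E \<inter> space (M \<beta>))) \<le> emeasure (M \<alpha>) E"
    proof (rule SUP_least)
      fix \<beta>
      obtain \<gamma> where g: "\<alpha> \<le> \<gamma>" "\<beta> \<le> \<gamma>" using directed by blast
      have "E \<inter> space (M \<beta>) \<in> sets (M \<beta>)" using sets_M_in_loc_sets[OF E] by (auto simp: loc_sets_def)
      then have "emeasure (M \<beta>) (E \<inter> space (M \<beta>)) = emeasure (M \<gamma>) (E \<inter> space (M \<beta>))"
        using M_mono(4)[OF g(2)] by simp
      also have "\<dots> \<le> emeasure (M \<gamma>) E" using E M_mono(3)[OF g(1)] by (intro emeasure_mono) auto
      also have "\<dots> = emeasure (M \<alpha>) E" using M_mono(4)[OF g(1) E] by simp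
      finally show "emeasure (M \<beta>) (E \<inter> space (M \<beta>)) \<le> emeasure (M \<alpha>) E" .
    qed
    show "emeasure (M \<alpha>) E \<le> (SUP \<beta>. emeasure (M \<beta>) (E \<inter> space (M \<beta>)))"
      using sub[OF E] by (intro SUP_upper2[of \<alpha>]) (auto simp: Int_commute)
  qed
  finally show "emeasure (M \<alpha>) E = emeasure (restrict_space L (space (M \<alpha>))) E" by simp
qed

lemma AE_M_iff: "(AE p in M \<alpha>. P p) \<longleftrightarrow> (AE p in L. p \<in> space (M \<alpha>) \<longrightarrow> P p)"
  using AE_restrict_space_iff[of "space (M \<alpha>)" L P] space_M_L[of \<alpha>]
  unfolding M_eq_restrict[of \<alpha>, symmetric] by (simp add: Int_absorb2)

text \<open>Measurability in \<open>L\<close> is tested level by level, and the trace of an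
  \<open>L\<close>-null set on each level is null in a complete measure.\<close>

lemma L_complete: "complete_measure L"
proof
  fix A B assume BA: "B \<subseteq> A" and A: "A \<in> null_sets L"
  have "B \<inter> space (M \<alpha>) \<in> sets (M \<alpha>)" for \<alpha>
  proof (rule complete_measure.complete[OF M_complete])
    have "A \<in> loc_sets M" and 0: "emeasure L A = 0" using A by (auto simp: sets_L)
    then have "A \<inter> space (M \<alpha>) \<in> sets (M \<alpha>)" by (auto simp: loc_sets_def)
    moreover have "emeasure (M \<alpha>) (A \<inter> space (M \<alpha>)) \<le> emeasure L A"
      unfolding emeasure_L[OF null_setsD2[OF A]] by (rule SUP_upper) simp
    ultimately show "A \<inter> space (M \<alpha>) \<in> null_sets (M \<alpha>)" using 0 by (auto simp: null_sets_def)
  qed (use BA in auto)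
  moreover have "B \<subseteq> loc_carrier M" using BA sets.sets_into_space[OF null_setsD2[OF A]] by (auto simp: space_L)
  ultimately show "B \<in> sets L" by (auto simp: sets_L loc_sets_def)
qed

text \<open>The alternative on the index set and the measure enters the proof here: either countably
  many null sets are united, or the measure is counting and null sets are empty. For uncountably
  many indices and a general measure the exceptional sets could add up.\<close>

lemma AE_all_indices:
  assumes cc: "countable (UNIV :: 'i set) \<or>
       (\<forall>E\<in>sets L. emeasure L E = emeasure (count_space (loc_carrier M)) E)"
    and P: "\<And>\<alpha>::'i. AE p in L. P \<alpha> p"
  shows "AE p in L. \<forall>\<alpha>. P \<alpha> p"
  using cc
proof
  assume "countable (UNIV :: 'i set)"
  then show ?thesis using AE_ball_countable[of UNIV "\<lambda>p \<alpha>. P \<alpha> p" L] P by auto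
next
  assume count: "\<forall>E\<in>sets L. emeasure L E = emeasure (count_space (loc_carrier M)) E"
  interpret complete_measure L by (rule L_complete)
  have "P \<alpha> p" if p: "p \<in> space L" for \<alpha> p
  proof -
    have N: "{p \<in> space L. \<not> P \<alpha> p} \<in> null_sets L" using P[of \<alpha>] unfolding AE_iff_null_sets .
    then have "emeasure (count_space (loc_carrier M)) {p \<in> space L. \<not> P \<alpha> p} = 0"
      using count null_setsD1[OF N] null_setsD2[OF N] by auto
    then have "{p \<in> space L. \<not> P \<alpha> p} = {}"
      by (subst (asm) emeasure_count_space_eq_0) (auto simp: space_L)
    then show ?thesis using p by blast
  qed
  then show ?thesis by (intro AE_I2) auto
qed

end

section \<open>The space of classes and multiplication by indicators\<close>

definition cut_to :: "'x set \<Rightarrow> ('x \<Rightarrow> 'h::zero) \<Rightarrow> 'x \<Rightarrow> 'h" where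
  "cut_to E u p = (if p \<in> E then u p else 0)"

locale loc_int = loc_ms M for M :: "'i::order \<Rightarrow> 'x measure" +
  fixes sc :: "complex \<Rightarrow> 'h::ab_group_add \<Rightarrow> 'h"
    and ip :: "'x \<Rightarrow> 'h \<Rightarrow> 'h \<Rightarrow> complex"
    and H :: "'i \<Rightarrow> 'x \<Rightarrow> 'h set"
    and D :: "('x \<Rightarrow> 'h) set"
  assumes ambient: "vector_space sc"
    and fibres: "\<forall>p\<in>loc_carrier M. quantized_domain sc (ip p) (idx M p) (\<lambda>\<alpha>. H \<alpha> p)"
    and integral: "loc_direct_integral M sc ip H D"
begin

abbreviation X where "X \<alpha> \<equiv> space (M \<alpha>)"
abbreviation FS where "FS \<equiv> fibre M sc ip H"
abbreviation IS where "IS \<equiv> integral_space M sc ip D"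
abbreviation cls where "cls \<equiv> ae_class M D"
abbreviation scf where "scf c u \<equiv> (\<lambda>p. sc c (u p))"
abbreviation bL where "bL u v \<equiv> (LINT p|L. ip p (u p) (v p))"

section \<open>The fibres as inner product spaces with complete subspaces\<close>

definition Dp :: "'x \<Rightarrow> 'h set" where "Dp p = (\<Union>\<alpha>\<in>idx M p. H \<alpha> p)"

sublocale amb: vector_space sc by (rule ambient)

lemma idx_mono: "\<lbrakk>\<alpha> \<in> idx M p; \<alpha> \<le> \<beta>\<rbrakk> \<Longrightarrow> \<beta> \<in> idx M p"
  using M_mono(1) by (auto simp: idx_def)

lemma idx_directed: "\<alpha> \<in> idx M p \<Longrightarrow> \<exists>\<gamma>\<in>idx M p. \<alpha> \<le> \<gamma> \<and> \<beta> \<le> \<gamma>"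
  using directed idx_mono by meson

lemma in_carrier: "p \<in> X \<alpha> \<Longrightarrow> p \<in> loc_carrier M"
  by (auto simp: loc_carrier_def)

lemma H_subspace: "p \<in> X \<alpha> \<Longrightarrow> amb.subspace (H \<alpha> p)"
  using fibres in_carrier[of p \<alpha>] by (simp add: quantized_domain_def idx_def)

lemma H_mono: "\<lbrakk>p \<in> X \<alpha>; \<alpha> \<le> \<beta>\<rbrakk> \<Longrightarrow> H \<alpha> p \<subseteq> H \<beta> p"
  using fibres in_carrier[of p \<alpha>] M_mono(1)[of \<alpha> \<beta>] unfolding quantized_domain_def idx_def by blast

lemma H_subset_Dp: "p \<in> X \<alpha> \<Longrightarrow> H \<alpha> p \<subseteq> Dp p"
  by (auto simp: idx_def Dp_def)

lemma Dp_common: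
  assumes "x \<in> Dp p" "y \<in> Dp p"
  shows "\<exists>\<gamma>\<in>idx M p. x \<in> H \<gamma> p \<and> y \<in> H \<gamma> p"
proof -
  obtain \<alpha> \<beta> where 1: "\<alpha> \<in> idx M p" "x \<in> H \<alpha> p" "\<beta> \<in> idx M p" "y \<in> H \<beta> p" using assms unfolding Dp_def by blast
  obtain \<gamma> where 2: "\<gamma> \<in> idx M p" "\<alpha> \<le> \<gamma>" "\<beta> \<le> \<gamma>" using idx_directed[OF 1(1)] by blast
  then show ?thesis using 1 H_mono[of p \<alpha> \<gamma>] H_mono[of p \<beta> \<gamma>] by (auto simp: idx_def)
qed

lemma Dp_subspace:
  assumes "p \<in> loc_carrier M"
  shows "amb.subspace (Dp p)"
proof (rule amb.subspaceI)
  obtain \<alpha> where a: "p \<in> X \<alpha>" using assms by (auto simp: loc_carrier_def)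
  show "0 \<in> Dp p" using amb.subspace_0[OF H_subspace[OF a]] a by (auto simp: idx_def Dp_def)
  show "x + y \<in> Dp p" if xy: "x \<in> Dp p" "y \<in> Dp p" for x y
    using Dp_common[OF xy] H_subspace amb.subspace_add by (fastforce simp: idx_def Dp_def)
  show "sc c x \<in> Dp p" if "x \<in> Dp p" for c x
    using that H_subspace amb.subspace_scale by (fastforce simp: idx_def Dp_def)
qed

lemma fibre_inner_product: "p \<in> loc_carrier M \<Longrightarrow> inner_product_on sc (ip p) (Dp p)"
  using fibres by (simp add: quantized_domain_def Dp_def)

lemma fibre_semi_ip: "p \<in> loc_carrier M \<Longrightarrow> semi_ip sc (Dp p) (ip p)"
proof -
  assume p: "p \<in> loc_carrier M"
  note ips = fibre_inner_product[OF p, unfolded inner_product_on_def]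
  show ?thesis
  proof (rule semi_ip.intro[OF ambient], rule semi_ip_axioms.intro)
    show "amb.subspace (Dp p)" using Dp_subspace[OF p] .
    show "ip p (x + y) z = ip p x z + ip p y z" if "x \<in> Dp p" "y \<in> Dp p" "z \<in> Dp p" for x y z
      using ips[THEN conjunct1] that by blast
    show "ip p (sc c x) y = c * ip p x y" if "x \<in> Dp p" "y \<in> Dp p" for x y c
      using ips[THEN conjunct2, THEN conjunct1] that by blast
    show "ip p y x = cnj (ip p x y)" if "x \<in> Dp p" "y \<in> Dp p" for x y
      using ips[THEN conjunct2, THEN conjunct2, THEN conjunct1] that by blast
    show "0 \<le> Re (ip p x x)" if "x \<in> Dp p" for x
      using ips[THEN conjunct2, THEN conjunct2, THEN conjunct2] that by blast
  qed
qed

lemmas fib_add_left = semi_ip.add_left[OF fibre_semi_ip]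
  and fib_scale_left = semi_ip.scale_left[OF fibre_semi_ip]
  and fib_herm = semi_ip.herm[OF fibre_semi_ip]
  and fib_nonneg = semi_ip.nonneg[OF fibre_semi_ip]
  and fib_zero_left = semi_ip.zero_left[OF fibre_semi_ip]
  and fib_zero_right = semi_ip.zero_right[OF fibre_semi_ip]
  and fib_nrm_zero = semi_ip.nrm_zero[OF fibre_semi_ip]

lemma fibre_definite:
  assumes p: "p \<in> loc_carrier M" and x: "x \<in> Dp p" and 0: "nrm (ip p) x = 0"
  shows "x = 0"
proof -
  interpret semi_ip sc "Dp p" "ip p" using fibre_semi_ip[OF p] .
  have "ip p x x = 0" using 0 Im_self[OF x] by (simp add: nrm_def complex_eq_iff)
  then show ?thesis using x fibre_inner_product[OF p] unfolding inner_product_on_def by blast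
qed

lemma vecs_FS [simp]: "vecs (FS p) = Dp p" and vadd_FS [simp]: "vadd (FS p) = (+)"
  and vscale_FS [simp]: "vscale (FS p) = sc" and vinner_FS [simp]: "vinner (FS p) = ip p"
  by (simp_all add: fibre_def union_space_def Dp_def)

lemma vnorm_FS: "vnorm (FS p) x = nrm (ip p) x"
  by (simp add: vnorm_def nrm_def)

lemma H_seq_complete:
  assumes p: "p \<in> X \<alpha>"
  shows "seq_complete (ip p) (H \<alpha> p)"
proof -
  interpret semi_ip sc "Dp p" "ip p" using fibre_semi_ip[OF in_carrier[OF p]] .
  have sub: "x \<in> Dp p" if "x \<in> H \<alpha> p" for x using that H_subset_Dp[OF p] by blast
  let ?d = "vdist (FS p)"
  have d: "?d x y = (if x \<in> Dp p \<and> y \<in> Dp p then nrm (ip p) (x - y) else 0)" for x y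
    by (simp add: vdist_def vnorm_FS)
  show ?thesis
  proof (rule seq_complete_of_mcomplete)
    show "Metric_space (H \<alpha> p) ?d"
    proof
      show "0 \<le> ?d x y" "?d x y = ?d y x" for x y
        unfolding d using nrm_nonneg[of "x - y"] nrm_diff_commute[of x y] by auto
      show "?d x y = 0 \<longleftrightarrow> x = y" if "x \<in> H \<alpha> p" "y \<in> H \<alpha> p" for x y
        using fibre_definite[OF in_carrier[OF p], of "x - y"] that sub nrm_zero unfolding d by auto
      show "?d x z \<le> ?d x y + ?d y z" if "x \<in> H \<alpha> p" "y \<in> H \<alpha> p" "z \<in> H \<alpha> p" for x y z
        using nrm_triangle_diff[of x y z] that sub unfolding d by auto
    qed
    show "Metric_space.mcomplete (H \<alpha> p) ?d"
    proof -
      have "complete_in (union_space sc (ip p) (idx M p) (\<lambda>\<alpha>. H \<alpha> p)) (H \<alpha> p)"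
        using bspec[OF fibres in_carrier[OF p]] p unfolding quantized_domain_def by (simp add: idx_def)
      then show ?thesis by (simp only: complete_in_def fibre_def)
    qed
    show "?d x y = nrm (ip p) (x - y)" if "x \<in> H \<alpha> p" "y \<in> H \<alpha> p" for x y
      using that sub unfolding d by auto
  qed
qed

section \<open>The direct integral as a space of maps\<close>

lemmas D_props =
  integral[unfolded loc_direct_integral_def, THEN conjunct1]
  integral[unfolded loc_direct_integral_def, THEN conjunct2, THEN conjunct1]
  integral[unfolded loc_direct_integral_def, THEN conjunct2, THEN conjunct2, THEN conjunct1]
  integral[unfolded loc_direct_integral_def, THEN conjunct2, THEN conjunct2, THEN conjunct2, THEN conjunct1]
  integral[unfolded loc_direct_integral_def, THEN conjunct2, THEN conjunct2, THEN conjunct2, THEN conjunct2,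
    THEN conjunct1]
  integral[unfolded loc_direct_integral_def, THEN conjunct2, THEN conjunct2, THEN conjunct2, THEN conjunct2,
    THEN conjunct2, THEN conjunct1]
  integral[unfolded loc_direct_integral_def, THEN conjunct2, THEN conjunct2, THEN conjunct2, THEN conjunct2,
    THEN conjunct2, THEN conjunct2, THEN conjunct1]
  integral[unfolded loc_direct_integral_def, THEN conjunct2, THEN conjunct2, THEN conjunct2, THEN conjunct2,
    THEN conjunct2, THEN conjunct2, THEN conjunct2]

lemma D_fibre: "\<lbrakk>u \<in> D; p \<in> loc_carrier M\<rbrakk> \<Longrightarrow> u p \<in> Dp p"
  using D_props(1) by simp

lemma D_zero: "0 \<in> D"
  using D_props(2) by (simp add: zero_fun_def)

lemma D_add: "\<lbrakk>u \<in> D; v \<in> D\<rbrakk> \<Longrightarrow> u + v \<in> D"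
  using D_props(3) by (simp add: plus_fun_def)

lemma D_scale: "u \<in> D \<Longrightarrow> scf c u \<in> D"
  using D_props(4) by simp

lemma D_level: "u \<in> D \<Longrightarrow> \<exists>\<alpha>. u \<in> level_maps M H D \<alpha>"
  using D_props(5) by simp

lemma D_integrable: "\<lbrakk>u \<in> D; v \<in> D\<rbrakk> \<Longrightarrow> integrable L (\<lambda>p. ip p (u p) (v p))"
  using D_props(6) by simp

lemma D_maximal:
  assumes "\<And>p. p \<in> X \<alpha> \<Longrightarrow> v p \<in> H \<alpha> p" "\<And>p. p \<notin> X \<alpha> \<Longrightarrow> v p = 0"
    and "\<And>u. u \<in> D \<Longrightarrow> integrable L (\<lambda>p. ip p (u p) (v p))"
  shows "v \<in> D"
proof -
  have "\<forall>v. (\<exists>\<alpha>. (\<forall>p\<in>X \<alpha>. v p \<in> H \<alpha> p) \<and> (\<forall>p\<in>loc_carrier M - X \<alpha>. v p = 0)) \<and>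
    (\<forall>u\<in>D. integrable L (\<lambda>p. ip p (u p) (v p))) \<longrightarrow> v \<in> D"
    by (rule D_props(7))
  moreover have "\<exists>\<alpha>. (\<forall>p\<in>X \<alpha>. v p \<in> H \<alpha> p) \<and> (\<forall>p\<in>loc_carrier M - X \<alpha>. v p = 0)"
    using assms(1,2) by (intro exI[of _ \<alpha>]) auto
  ultimately show ?thesis using assms(3) by simp
qed

lemma level_direct_integral: "level_is_direct_integral M sc ip H D \<alpha>"
  using D_props(8) by simp

lemma scf_vector_space: "vector_space scf"
  by unfold_locales
    (simp_all add: fun_eq_iff amb.scale_right_distrib amb.scale_left_distrib)

sublocale DL: semi_ip scf D bL
proof -
  interpret f: vector_space scf by (rule scf_vector_space)
  show "semi_ip scf D bL"
  proof
    show "f.subspace D" unfolding f.subspace_def using D_zero D_add D_scale by blast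
    fix u v assume uv: "u \<in> D" "v \<in> D"
    note fib = D_fibre[OF uv(1)] D_fibre[OF uv(2)]
    show "bL (u + w) v = bL u v + bL w v" if w: "w \<in> D" for w
    proof -
      have "bL (u + w) v = (LINT p|L. ip p (u p) (v p) + ip p (w p) (v p))"
        using fib D_fibre[OF w] by (intro Bochner_Integration.integral_cong)
          (auto simp: space_L fib_add_left)
      then show ?thesis using D_integrable uv w by simp
    qed
    show "bL (scf c u) v = c * bL u v" for c
    proof -
      have "bL (scf c u) v = (LINT p|L. c * ip p (u p) (v p))"
        using fib by (intro Bochner_Integration.integral_cong) (auto simp: space_L fib_scale_left)
      then show ?thesis by simp
    qed
    show "bL v u = cnj (bL u v)"
    proof -
      have "bL v u = (LINT p|L. cnj (ip p (u p) (v p)))"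
        using fib by (intro Bochner_Integration.integral_cong) (auto simp: space_L intro: fib_herm)
      then show ?thesis by simp
    qed
    show "0 \<le> Re (bL u u)"
    proof -
      have "Re (bL u u) = (LINT p|L. Re (ip p (u p) (u p)))" using D_integrable[OF uv(1) uv(1)] by simp
      then show ?thesis using fib by (auto simp: space_L intro!: integral_nonneg_AE AE_I2 fib_nonneg)
    qed
  qed
qed

text \<open>Strict representatives: the conditions of \<open>level_maps\<close> are imposed at every
  point instead of almost everywhere, and the value is 0 off the level, even outside the carrier.
  Fibrewise arguments can then start from any point of the level.\<close>

definition nlev :: "'i \<Rightarrow> ('x \<Rightarrow> 'h) set" where
  "nlev \<alpha> = {u \<in> D. (\<forall>p\<in>X \<alpha>. u p \<in> H \<alpha> p) \<and> (\<forall>p. p \<notin> X \<alpha> \<longrightarrow> u p = 0)}"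

lemma nlevD:
  assumes "u \<in> nlev \<alpha>"
  shows "u \<in> D" "p \<in> X \<alpha> \<Longrightarrow> u p \<in> H \<alpha> p" "p \<notin> X \<alpha> \<Longrightarrow> u p = 0"
  using assms by (auto simp: nlev_def)

lemma nlev_subset_level_maps: "nlev \<alpha> \<subseteq> level_maps M H D \<alpha>"
  unfolding nlev_def level_maps_def by (auto intro!: AE_I2)

lemma nlev_zero: "0 \<in> nlev \<alpha>"
  using H_subspace amb.subspace_0 D_zero by (auto simp: nlev_def)

lemma nlev_add: "\<lbrakk>u \<in> nlev \<alpha>; v \<in> nlev \<alpha>\<rbrakk> \<Longrightarrow> u + v \<in> nlev \<alpha>"
  using H_subspace amb.subspace_add D_add by (auto simp: nlev_def)

lemma nlev_scale: "u \<in> nlev \<alpha> \<Longrightarrow> scf c u \<in> nlev \<alpha>"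
  using H_subspace amb.subspace_scale D_scale by (auto simp: nlev_def)

lemma nlev_diff: "\<lbrakk>u \<in> nlev \<alpha>; v \<in> nlev \<alpha>\<rbrakk> \<Longrightarrow> u - v \<in> nlev \<alpha>"
  using H_subspace amb.subspace_diff DL.V_closed(3)[of u v] by (auto simp: nlev_def)

lemma nlev_mono: "\<alpha> \<le> \<beta> \<Longrightarrow> nlev \<alpha> \<subseteq> nlev \<beta>"
proof
  fix u assume le: "\<alpha> \<le> \<beta>" and u: "u \<in> nlev \<alpha>"
  have "u p \<in> H \<beta> p" if "p \<in> X \<beta>" for p
    using u H_mono[OF _ le] amb.subspace_0[OF H_subspace[OF that]] by (cases "p \<in> X \<alpha>") (auto simp: nlev_def)
  then show "u \<in> nlev \<beta>" using u M_mono(1)[OF le] by (auto simp: nlev_def)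
qed

lemma nlev_maximal:
  assumes "\<And>p. p \<in> X \<alpha> \<Longrightarrow> v p \<in> H \<alpha> p" "\<And>p. p \<notin> X \<alpha> \<Longrightarrow> v p = 0"
    and "\<And>u. u \<in> D \<Longrightarrow> integrable L (\<lambda>p. ip p (u p) (v p))"
  shows "v \<in> nlev \<alpha>"
  using D_maximal[of \<alpha> v] assms by (auto simp: nlev_def)

text \<open>The map is set to 0 wherever membership in the fibre of the level fails. Completeness
  keeps its pairings integrable, and maximality puts the altered map back into
  \<open>D\<close>.\<close>

lemma nlev_representative:
  assumes u: "u \<in> level_maps M H D \<alpha>"
  shows "\<exists>v\<in>nlev \<alpha>. AE p in L. v p = u p"
proof -
  define v where "v p = (if p \<in> X \<alpha> \<and> u p \<in> H \<alpha> p then u p else 0)" for p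
  have uD: "u \<in> D" using u by (simp add: level_maps_def)
  have "AE p in L. p \<in> X \<alpha> \<longrightarrow> u p \<in> H \<alpha> p" using u AE_M_iff by (auto simp: level_maps_def)
  moreover have "AE p in L. p \<in> space L" by simp
  ultimately have ae: "AE p in L. v p = u p"
    by eventually_elim (use u in \<open>auto simp: v_def level_maps_def space_L\<close>)
  have "v \<in> nlev \<alpha>"
  proof (rule nlev_maximal)
    show "v p \<in> H \<alpha> p" if "p \<in> X \<alpha>" for p
      using amb.subspace_0[OF H_subspace[OF that]] by (simp add: v_def)
    show "v p = 0" if "p \<notin> X \<alpha>" for p using that by (simp add: v_def)
    show "integrable L (\<lambda>p. ip p (w p) (v p))" if "w \<in> D" for w
      by (rule complete_measure.integrable_AE[OF L_complete D_integrable[OF that uD]])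
        (use ae in \<open>auto elim: eventually_mono\<close>)
  qed
  then show ?thesis using ae by blast
qed

lemma D_representative: "u \<in> D \<Longrightarrow> \<exists>\<alpha>. \<exists>v\<in>nlev \<alpha>. AE p in L. v p = u p"
  using D_level nlev_representative by blast

text \<open>In contrast to \<open>D_maximal\<close>, the pairings are tested against the level only,
  which is all that can be checked for vectors chosen fibre by fibre below. The price is that the
  result agrees with \<open>v\<close> only almost everywhere.\<close>

lemma level_maximal:
  assumes v: "\<And>p. p \<in> X \<alpha> \<Longrightarrow> v p \<in> H \<alpha> p" "\<And>p. p \<notin> X \<alpha> \<Longrightarrow> v p = 0"
    and int: "\<And>u. u \<in> nlev \<alpha> \<Longrightarrow> integrable L (\<lambda>p. ip p (u p) (v p))"
  shows "\<exists>w\<in>nlev \<alpha>. AE p in L. w p = v p"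
proof -
  have "integrable (M \<alpha>) (\<lambda>p. ip p (u p) (v p))" if u: "u \<in> level_maps M H D \<alpha>" for u
  proof -
    obtain u' where u': "u' \<in> nlev \<alpha>" "AE p in L. u' p = u p" using nlev_representative[OF u] by blast
    have "integrable L (\<lambda>p. ip p (u p) (v p))"
      by (rule complete_measure.integrable_AE[OF L_complete int[OF u'(1)]])
        (use u'(2) in \<open>auto elim: eventually_mono\<close>)
    then have "integrable L (\<lambda>p. indicator (X \<alpha>) p *\<^sub>R ip p (u p) (v p))"
      using space_M_L by (intro integrable_mult_indicator) auto
    then show ?thesis
      using integrable_restrict_space[of "X \<alpha>" L "\<lambda>p. ip p (u p) (v p)"] space_M_L[of \<alpha>]
      unfolding M_eq_restrict[of \<alpha>, symmetric] by (simp add: Int_absorb2)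
  qed
  then obtain w where w: "w \<in> level_maps M H D \<alpha>" "AE p in M \<alpha>. w p = v p"
    using v(1) level_direct_integral[of \<alpha>] unfolding level_is_direct_integral_def by blast
  obtain w' where w': "w' \<in> nlev \<alpha>" "AE p in L. w' p = w p" using nlev_representative[OF w(1)] by blast
  have "AE p in L. p \<in> X \<alpha> \<longrightarrow> w p = v p" using w(2) unfolding AE_M_iff .
  then have "AE p in L. w' p = v p"
    using w'(2) by eventually_elim (use nlevD(3)[OF w'(1)] v(2) in metis)
  then show ?thesis using w'(1) by blast
qed

text \<open>Cutting down to a measurable set keeps all pairings integrable, so maximality returns
  the cut map to the level.\<close>

lemma cut_nlev:
  assumes E: "E \<in> sets L" and u: "u \<in> nlev \<alpha>"
  shows "cut_to E u \<in> nlev \<alpha>"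
proof (rule nlev_maximal)
  show "cut_to E u p \<in> H \<alpha> p" if "p \<in> X \<alpha>" for p
    using amb.subspace_0[OF H_subspace[OF that]] nlevD(2)[OF u that] by (simp add: cut_to_def)
  show "cut_to E u p = 0" if "p \<notin> X \<alpha>" for p using that nlevD(3)[OF u] by (simp add: cut_to_def)
  fix w assume w: "w \<in> D"
  have "integrable L (\<lambda>p. indicator E p *\<^sub>R ip p (w p) (u p))"
    using E D_integrable[OF w nlevD(1)[OF u]] by (rule integrable_mult_indicator)
  moreover have "indicator E p *\<^sub>R ip p (w p) (u p) = ip p (w p) (cut_to E u p)" if "p \<in> space L" for p
    using fib_zero_right[OF _ D_fibre[OF w]] that
    by (auto simp: cut_to_def space_L indicator_def)
  ultimately show "integrable L (\<lambda>p. ip p (w p) (cut_to E u p))"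
    by (simp cong: Bochner_Integration.integrable_cong)
qed

section \<open>Classes of maps modulo equality almost everywhere\<close>

lemma mem_cls: "v \<in> cls u \<longleftrightarrow> v \<in> D \<and> (AE p in L. v p = u p)"
  by (simp add: ae_class_def)

lemma cls_self: "u \<in> D \<Longrightarrow> u \<in> cls u"
  by (simp add: mem_cls)

lemma cls_cong:
  assumes "AE p in L. u p = v p"
  shows "cls u = cls v"
proof -
  have "(AE p in L. w p = u p) \<longleftrightarrow> (AE p in L. w p = v p)" for w
    using assms by (intro iffI; elim eventually_elim2) auto
  then show ?thesis by (auto simp: ae_class_def)
qed

lemma cls_eqD: "\<lbrakk>u \<in> D; cls u = cls v\<rbrakk> \<Longrightarrow> AE p in L. u p = v p"
  using cls_self[of u] by (simp add: mem_cls)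

lemma repr_cls:
  assumes "u \<in> D"
  shows "repr (cls u) \<in> D" "AE p in L. repr (cls u) p = u p"
proof -
  have "repr (cls u) \<in> cls u" unfolding repr_def by (rule someI[of "\<lambda>v. v \<in> cls u", OF cls_self[OF assms]])
  then show "repr (cls u) \<in> D" "AE p in L. repr (cls u) p = u p" by (simp_all add: mem_cls)
qed

lemma vecs_IS: "vecs IS = cls ` D"
  by (simp add: integral_space_def)

lemma vadd_cls: "\<lbrakk>u \<in> D; v \<in> D\<rbrakk> \<Longrightarrow> vadd IS (cls u) (cls v) = cls (u + v)"
  using repr_cls(2)[of u] repr_cls(2)[of v]
  by (auto simp: integral_space_def intro!: cls_cong elim: eventually_elim2)

lemma vscale_cls: "u \<in> D \<Longrightarrow> vscale IS c (cls u) = cls (scf c u)"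
  using repr_cls(2)[of u]
  by (auto simp: integral_space_def intro!: cls_cong elim: eventually_mono)

lemma vinner_cls:
  assumes "u \<in> D" "v \<in> D"
  shows "vinner IS (cls u) (cls v) = bL u v"
proof -
  have "AE p in L. ip p (repr (cls u) p) (repr (cls v) p) = ip p (u p) (v p)"
    using repr_cls(2)[OF assms(1)] repr_cls(2)[OF assms(2)] by eventually_elim simp
  then show ?thesis
    using D_integrable repr_cls(1) assms by (auto simp: integral_space_def intro!: integral_cong_AE)
qed

lemma vnorm_cls: "u \<in> D \<Longrightarrow> vnorm IS (cls u) = nrm bL u"
  by (simp add: vnorm_def nrm_def vinner_cls)

lemma level_eq: "level M H D \<alpha> = cls ` nlev \<alpha>"
proof
  show "level M H D \<alpha> \<subseteq> cls ` nlev \<alpha>"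
  proof
    fix A assume "A \<in> level M H D \<alpha>"
    then obtain u where u: "u \<in> level_maps M H D \<alpha>" "A = cls u" unfolding level_def by blast
    obtain v where v: "v \<in> nlev \<alpha>" "AE p in L. v p = u p" using nlev_representative[OF u(1)] by blast
    then show "A \<in> cls ` nlev \<alpha>" using cls_cong[OF v(2)] u by blast
  qed
  show "cls ` nlev \<alpha> \<subseteq> level M H D \<alpha>"
    unfolding level_def using nlev_subset_level_maps by blast
qed

lemma vecs_IS_nlev: "vecs IS = (\<Union>\<alpha>. cls ` nlev \<alpha>)"
proof
  show "vecs IS \<subseteq> (\<Union>\<alpha>. cls ` nlev \<alpha>)"
  proof
    fix A assume "A \<in> vecs IS"
    then obtain u where u: "u \<in> D" "A = cls u" unfolding vecs_IS by blast
    obtain \<alpha> v where v: "v \<in> nlev \<alpha>" "AE p in L. v p = u p" using D_representative[OF u(1)] by blast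
    then show "A \<in> (\<Union>\<alpha>. cls ` nlev \<alpha>)" using cls_cong[OF v(2)] u by blast
  qed
  show "(\<Union>\<alpha>. cls ` nlev \<alpha>) \<subseteq> vecs IS" unfolding vecs_IS using nlevD(1) by blast
qed

lemma bL_zero_iff: "u \<in> D \<Longrightarrow> nrm bL u = 0 \<longleftrightarrow> (AE p in L. u p = 0)"
proof -
  assume u: "u \<in> D"
  note fib = D_fibre[OF u]
  have "nrm bL u = 0 \<longleftrightarrow> (LINT p|L. Re (ip p (u p) (u p))) = 0"
    using D_integrable[OF u u] by (simp add: nrm_def)
  also have "\<dots> \<longleftrightarrow> (AE p in L. Re (ip p (u p) (u p)) = 0)"
    using fib D_integrable[OF u u] by (intro integral_nonneg_eq_0_iff_AE) (auto simp: space_L intro!: AE_I2 fib_nonneg)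
  also have "\<dots> \<longleftrightarrow> (AE p in L. u p = 0)"
  proof (rule AE_cong)
    fix p assume "p \<in> space L"
    then have p: "p \<in> loc_carrier M" by (simp add: space_L)
    show "Re (ip p (u p) (u p)) = 0 \<longleftrightarrow> u p = 0"
      using fibre_definite[OF p fib[OF p]] fib_nrm_zero[OF p]
      by (auto simp: nrm_def)
  qed
  finally show ?thesis .
qed

text \<open>Separability is given for the metric space of classes. The seminorm distance of two maps
  is the distance of their classes, so one strict representative for each class of a countable dense
  set suffices.\<close>

lemma level_dense_countable:
  "\<exists>C. countable C \<and> C \<subseteq> nlev \<alpha> \<and> (\<forall>u\<in>nlev \<alpha>. \<forall>e>0. \<exists>v\<in>C. nrm bL (u - v) < e)"
proof -
  let ?d = "vdist IS" and ?S = "cls ` nlev \<alpha>"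
  have d: "?d (cls u) (cls v) = nrm bL (u - v)" if "u \<in> D" "v \<in> D" for u v
  proof -
    have "vadd IS (cls u) (vscale IS (-1) (cls v)) = cls (u - v)"
      using that D_scale[of v "-1"] by (simp add: vscale_cls vadd_cls fun_diff_def plus_fun_def)
    then show ?thesis using that vnorm_cls[of "u - v"] DL.V_closed(3) by (auto simp: vdist_def vecs_IS)
  qed
  have d0: "?d A B = 0" if "A \<notin> cls ` D \<or> B \<notin> cls ` D" for A B
    using that by (auto simp: vdist_def vecs_IS)
  interpret Metric_space ?S ?d
  proof
    show "0 \<le> ?d A B" for A B
    proof (cases "A \<in> cls ` D \<and> B \<in> cls ` D")
      case True
      then show ?thesis using d DL.nrm_nonneg by auto
    qed (use d0 in auto)
    show "?d A B = ?d B A" for A B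
    proof (cases "A \<in> cls ` D \<and> B \<in> cls ` D")
      case True
      then show ?thesis using d DL.nrm_diff_commute by auto
    qed (use d0 in auto)
    show "?d A B = 0 \<longleftrightarrow> A = B" if "A \<in> ?S" "B \<in> ?S" for A B
    proof -
      obtain u v where uv: "u \<in> D" "v \<in> D" "A = cls u" "B = cls v" using \<open>A \<in> ?S\<close> \<open>B \<in> ?S\<close> nlevD(1) by blast
      have "?d A B = 0 \<longleftrightarrow> (AE p in L. u p = v p)" using d uv bL_zero_iff[of "u - v"] DL.V_closed(3) by simp
      then show ?thesis using uv cls_cong cls_eqD by blast
    qed
    show "?d A C \<le> ?d A B + ?d B C" if ABC: "A \<in> ?S" "B \<in> ?S" "C \<in> ?S" for A B C
    proof -
      obtain u v w where "u \<in> D" "v \<in> D" "w \<in> D" "A = cls u" "B = cls v" "C = cls w"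
        using ABC nlevD(1) by blast
      then show ?thesis using d DL.nrm_triangle_diff by simp
    qed
  qed
  have "separable_space mtopology"
    using level_direct_integral[of \<alpha>] unfolding level_is_direct_integral_def separable_in_def level_eq by blast
  then obtain K where K: "countable K" "K \<subseteq> ?S" "mtopology closure_of K = ?S"
    unfolding separable_space_def by auto
  define C where "C = (\<lambda>A. SOME u. u \<in> nlev \<alpha> \<and> cls u = A) ` K"
  have pick: "(SOME u. u \<in> nlev \<alpha> \<and> cls u = A) \<in> nlev \<alpha> \<and> cls (SOME u. u \<in> nlev \<alpha> \<and> cls u = A) = A"
    if "A \<in> K" for A using that K(2) by (intro someI_ex[of "\<lambda>u. u \<in> nlev \<alpha> \<and> cls u = A"]) auto
  show ?thesis
  proof (intro exI[of _ C] conjI ballI allI impI)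
    show "countable C" using K(1) by (simp add: C_def)
    show sub: "C \<subseteq> nlev \<alpha>" using pick by (auto simp: C_def)
    fix u e assume u: "u \<in> nlev \<alpha>" and e: "0 < (e :: real)"
    have "cls u \<in> mtopology closure_of K" using u K(3) by blast
    then obtain A where A: "A \<in> K" "?d (cls u) A < e"
      using e unfolding metric_closure_of by auto
    define v where "v = (SOME u. u \<in> nlev \<alpha> \<and> cls u = A)"
    have "v \<in> C" "cls v = A" "v \<in> nlev \<alpha>" using A(1) pick unfolding v_def C_def by auto
    then show "\<exists>v\<in>C. nrm bL (u - v) < e" using A(2) d nlevD(1)[OF u] nlevD(1) by (intro bexI[of _ v]) auto
  qed
qed

lemma ops_cls:
  assumes T: "T \<in> loc_bounded_ops IS UNIV (level M H D)" and u: "u \<in> D"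
  shows "\<exists>w\<in>D. T (cls u) = cls w"
proof -
  have "T \<in> cls ` D \<rightarrow>\<^sub>E cls ` D" using T unfolding loc_bounded_ops_def vecs_IS by simp
  then have "T (cls u) \<in> cls ` D" by (rule PiE_mem) (use u in blast)
  then show ?thesis by blast
qed

text \<open>At almost every point both products send \<open>u p\<close> to \<open>f p\<close> times
  \<open>S p (u p)\<close>, by linearity of the fibre operator \<open>S p\<close>.\<close>

lemma decomposable_commutes:
  assumes T: "T \<in> decomposable_ops M sc ip H D" and G: "G \<in> diagonalizable_ops M sc ip H D"
    and A: "A \<in> vecs IS"
  shows "T (G A) = G (T A)"
proof -
  obtain S where S: "\<And>p. p \<in> loc_carrier M \<Longrightarrow> S p \<in> loc_bounded_ops (FS p) (idx M p) (\<lambda>\<alpha>. H \<alpha> p)"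
      "\<And>u w. u \<in> D \<Longrightarrow> w \<in> T (cls u) \<Longrightarrow> AE p in L. w p = S p (u p)"
      and T': "T \<in> loc_bounded_ops IS UNIV (level M H D)"
    using T unfolding decomposable_ops_def by blast
  obtain f where f: "\<And>u w. u \<in> D \<Longrightarrow> w \<in> G (cls u) \<Longrightarrow> AE p in L. w p = sc (f p) (u p)"
      and G': "G \<in> loc_bounded_ops IS UNIV (level M H D)"
    using G unfolding diagonalizable_ops_def decomposable_ops_def by blast
  obtain u where u: "u \<in> D" "A = cls u" using A vecs_IS by blast
  obtain w where w: "w \<in> D" "T (cls u) = cls w" using ops_cls[OF T' u(1)] by blast
  obtain g where g: "g \<in> D" "G (cls u) = cls g" using ops_cls[OF G' u(1)] by blast
  obtain h where h: "h \<in> D" "T (cls g) = cls h" using ops_cls[OF T' g(1)] by blast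
  obtain k where k: "k \<in> D" "G (cls w) = cls k" using ops_cls[OF G' w(1)] by blast
  have "AE p in L. p \<in> space L" by simp
  moreover have "AE p in L. w p = S p (u p)" using S(2)[OF u(1)] cls_self w by simp
  moreover have "AE p in L. g p = sc (f p) (u p)" using f[OF u(1)] cls_self g by simp
  moreover have "AE p in L. h p = S p (g p)" using S(2)[OF g(1)] cls_self h by simp
  moreover have "AE p in L. k p = sc (f p) (w p)" using f[OF w(1)] cls_self k by simp
  ultimately have "AE p in L. h p = k p"
  proof eventually_elim
    case (elim p)
    then have p: "p \<in> loc_carrier M" by (simp add: space_L)
    have "S p (sc (f p) (u p)) = sc (f p) (S p (u p))"
      using S(1)[OF p] D_fibre[OF u(1) p] unfolding loc_bounded_ops_def linear_in_def by simp
    then show ?case using elim by simp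
  qed
  then show ?thesis using u g h w k cls_cong by metis
qed

section \<open>Multiplication by indicators as diagonalizable operators\<close>

definition mulop :: "'x set \<Rightarrow> ('x \<Rightarrow> 'h) set \<Rightarrow> ('x \<Rightarrow> 'h) set" where
  "mulop E = (\<lambda>A\<in>vecs IS. cls (cut_to E (repr A)))"

lemma mulop_cls: "u \<in> D \<Longrightarrow> mulop E (cls u) = cls (cut_to E u)"
  using repr_cls(2)[of u] by (auto simp: mulop_def vecs_IS cut_to_def intro!: cls_cong elim: eventually_mono)

text \<open>The multiplication preserves each level by \<open>cut_nlev\<close> and is a contraction.
  It is also symmetric for the integrated pairing, so it preserves the orthogonal complement of
  every level it preserves.\<close>

lemma mulop_loc_bounded:
  assumes E: "E \<in> sets L"
  shows "mulop E \<in> loc_bounded_ops IS UNIV (level M H D)"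
proof -
  have rep: "\<exists>\<alpha>. \<exists>u\<in>nlev \<alpha>. A = cls u" if "A \<in> vecs IS" for A using that vecs_IS_nlev by blast
  have nD: "u \<in> nlev \<alpha> \<Longrightarrow> cut_to E u \<in> D" for u \<alpha> using cut_nlev[OF E] nlevD(1) by blast
  have inner: "bL (cut_to E u) v = bL u (cut_to E v)" if "u \<in> D" "v \<in> D" for u v
    using D_fibre that by (intro Bochner_Integration.integral_cong)
      (auto simp: cut_to_def space_L fib_zero_left fib_zero_right)
  have bound: "nrm bL (cut_to E u) \<le> nrm bL u" if u: "u \<in> nlev \<alpha>" for u \<alpha>
  proof -
    have uD: "u \<in> D" using nlevD(1)[OF u] .
    have "Re (ip p (cut_to E u p) (cut_to E u p)) \<le> Re (ip p (u p) (u p))" if "p \<in> space L" for p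
      using fib_nonneg[of p "u p"] fib_zero_left[of p 0] D_fibre[OF uD] D_fibre[OF D_zero] that
      by (auto simp: cut_to_def space_L)
    then have "(LINT p|L. Re (ip p (cut_to E u p) (cut_to E u p))) \<le> (LINT p|L. Re (ip p (u p) (u p)))"
      using D_integrable uD nD[OF u] by (intro integral_mono) auto
    then show ?thesis using D_integrable uD nD[OF u] by (simp add: nrm_def)
  qed
  show ?thesis
    unfolding loc_bounded_ops_def linear_in_def
  proof (intro CollectI conjI ballI allI subsetI)
    show "mulop E \<in> vecs IS \<rightarrow>\<^sub>E vecs IS"
    proof (rule PiE_I)
      fix A assume "A \<in> vecs IS"
      then obtain \<alpha> u where "u \<in> nlev \<alpha>" "A = cls u" using rep by blast
      then show "mulop E A \<in> vecs IS" using mulop_cls nlevD(1) nD by (auto simp: vecs_IS)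
    qed (simp add: mulop_def)
    fix A assume "A \<in> vecs IS"
    then obtain \<alpha> u where u: "u \<in> nlev \<alpha>" "A = cls u" using rep by blast
    have uD: "u \<in> D" using nlevD(1)[OF u(1)] .
    show "mulop E (vscale IS c A) = vscale IS c (mulop E A)" for c
    proof -
      have "cut_to E (scf c u) = scf c (cut_to E u)" by (auto simp: cut_to_def)
      then show ?thesis using u uD nD D_scale by (simp add: vscale_cls mulop_cls)
    qed
    fix B assume "B \<in> vecs IS"
    then obtain \<beta> v where v: "v \<in> nlev \<beta>" "B = cls v" using rep by blast
    have vD: "v \<in> D" using nlevD(1)[OF v(1)] .
    have "cut_to E (u + v) = cut_to E u + cut_to E v" by (auto simp: cut_to_def)
    then show "mulop E (vadd IS A B) = vadd IS (mulop E A) (mulop E B)"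
      using u v uD vD nD D_add by (simp add: vadd_cls mulop_cls)
  next
    fix \<alpha> B assume "B \<in> mulop E ` level M H D \<alpha>"
    then obtain u where u: "u \<in> nlev \<alpha>" "B = mulop E (cls u)" unfolding level_eq by blast
    then show "B \<in> level M H D \<alpha>" unfolding level_eq using mulop_cls nlevD(1) cut_nlev[OF E] by auto
  next
    fix \<alpha> B assume "B \<in> mulop E ` orth_in IS (level M H D \<alpha>)"
    then obtain A where A: "A \<in> vecs IS" "\<forall>C\<in>level M H D \<alpha>. vinner IS A C = 0" "B = mulop E A"
      unfolding orth_in_def by blast
    obtain \<beta> u where u: "u \<in> nlev \<beta>" "A = cls u" using rep[OF A(1)] by blast
    have uD: "u \<in> D" using nlevD(1)[OF u(1)] .
    have "vinner IS B (cls v) = 0" if v: "v \<in> nlev \<alpha>" for v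
    proof -
      have vD: "v \<in> D" "cut_to E v \<in> D" using nlevD(1)[OF v] nD[OF v] by auto
      have "vinner IS B (cls v) = bL u (cut_to E v)"
        using u uD A(3) nD[OF u(1)] vD inner by (simp add: mulop_cls vinner_cls)
      also have "\<dots> = vinner IS A (cls (cut_to E v))" using u uD vD by (simp add: vinner_cls)
      also have "\<dots> = 0" using A(2) cut_nlev[OF E v] unfolding level_eq by blast
      finally show ?thesis .
    qed
    moreover have "B \<in> vecs IS" using A(3) u uD nD by (auto simp: mulop_cls vecs_IS)
    ultimately show "B \<in> orth_in IS (level M H D \<alpha>)" unfolding orth_in_def level_eq by auto
  next
    fix \<alpha>
    show "\<exists>B. \<forall>A\<in>level M H D \<alpha>. vnorm IS (mulop E A) \<le> B * vnorm IS A"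
      using bound nlevD(1) nD unfolding level_eq
      by (intro exI[of _ 1]) (auto simp: mulop_cls vnorm_cls)
  qed
qed

lemma mulop_decomposable:
  assumes E: "E \<in> sets L"
  shows "mulop E \<in> decomposable_ops M sc ip H D"
proof -
  define S where "S p = (\<lambda>x\<in>Dp p. if p \<in> E then x else 0)" for p
  have "S p \<in> loc_bounded_ops (FS p) (idx M p) (\<lambda>\<alpha>. H \<alpha> p)" if p: "p \<in> loc_carrier M" for p
  proof -
    interpret semi_ip sc "Dp p" "ip p" using fibre_semi_ip[OF p] .
    have 0: "0 \<in> H \<alpha> p" if "\<alpha> \<in> idx M p" for \<alpha>
      using that H_subspace[of p \<alpha>] amb.subspace_0 by (simp add: idx_def)
    have n: "nrm (ip p) (S p x) \<le> 1 * nrm (ip p) x" if "x \<in> Dp p" for x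
      using nrm_nonneg[OF that] that by (simp add: S_def nrm_zero)
    show ?thesis
      unfolding loc_bounded_ops_def linear_in_def
    proof (intro CollectI conjI ballI allI)
      show "S p \<in> vecs (FS p) \<rightarrow>\<^sub>E vecs (FS p)"
        using V_closed(1) unfolding vecs_FS S_def by (auto)
      show "S p (vadd (FS p) x y) = vadd (FS p) (S p x) (S p y)" if "x \<in> vecs (FS p)" "y \<in> vecs (FS p)" for x y
        using that V_closed(2) unfolding vecs_FS S_def by (simp)
      show "S p (vscale (FS p) c x) = vscale (FS p) c (S p x)" if "x \<in> vecs (FS p)" for c x
        using that V_closed(5) unfolding vecs_FS S_def by (simp)
      fix \<alpha> assume a: "\<alpha> \<in> idx M p"
      then have sub: "x \<in> Dp p" if "x \<in> H \<alpha> p" for x using that H_subset_Dp[of p \<alpha>] by (auto simp: idx_def)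
      show "S p ` H \<alpha> p \<subseteq> H \<alpha> p" using 0[OF a] sub by (auto simp: S_def)
      show "S p ` orth_in (FS p) (H \<alpha> p) \<subseteq> orth_in (FS p) (H \<alpha> p)"
        using V_closed(1) zero_left sub by (auto simp: S_def orth_in_def)
      show "\<exists>B. \<forall>x\<in>H \<alpha> p. vnorm (FS p) (S p x) \<le> B * vnorm (FS p) x"
        using n sub unfolding vnorm_FS by blast
    qed
  qed
  moreover have "AE p in L. w p = S p (u p)" if u: "u \<in> D" and w: "w \<in> mulop E (cls u)" for u w
  proof -
    have "AE p in L. w p = cut_to E u p" using w unfolding mulop_cls[OF u] mem_cls by blast
    moreover have "AE p in L. p \<in> space L" by simp
    ultimately show ?thesis
      by eventually_elim (use D_fibre[OF u] in \<open>simp add: S_def cut_to_def space_L\<close>)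
  qed
  ultimately show ?thesis using mulop_loc_bounded[OF E] unfolding decomposable_ops_def by blast
qed

lemma mulop_diagonalizable:
  assumes E: "E \<in> sets L"
  shows "mulop E \<in> diagonalizable_ops M sc ip H D"
proof -
  have "AE p in L. w p = sc (indicator E p) (u p)" if u: "u \<in> D" and w: "w \<in> mulop E (cls u)" for u w
  proof -
    have "AE p in L. w p = cut_to E u p" using w unfolding mulop_cls[OF u] mem_cls by blast
    then show ?thesis by eventually_elim (simp add: cut_to_def indicator_def)
  qed
  moreover have "(indicator E :: 'x \<Rightarrow> complex) \<in> borel_measurable L" using E by simp
  ultimately show ?thesis using mulop_decomposable[OF E] unfolding diagonalizable_ops_def by blast
qed

end

section \<open>Decomposition of operators in the commutant\<close>

lemma (in vector_space) scale_sum_list: "scale k (sum_list xs) = sum_list (map (scale k) xs)"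
  by (induction xs) (simp_all add: scale_right_distrib)

text \<open>The hull consists of the finite Gaussian rational combinations, encoded by lists of
  pairs: appending lists gives sums, multiplying the coefficients gives scalar multiples, and there
  are only countably many lists.\<close>

lemma countable_gauss_hull:
  assumes vs: "vector_space sc" and C: "countable C" and S: "module.subspace sc S" and CS: "C \<subseteq> S"
  shows "\<exists>A. countable A \<and> C \<subseteq> A \<and> A \<subseteq> S \<and> gauss_closed sc A"
proof -
  interpret vector_space sc by fact
  define f where "f l = sum_list (map (\<lambda>(k, x). sc k x) l)" for l
  let ?W = "lists (gauss_rat \<times> C)"
  define A where "A = f ` ?W"
  have "countable A" using C countable_gauss_rat by (auto simp: A_def)
  moreover have "C \<subseteq> A"
  proof
    fix x assume "x \<in> C"
    then have "[(1, x)] \<in> ?W" "f [(1, x)] = x" using gauss_rat_members(1) by (auto simp: f_def)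
    then show "x \<in> A" unfolding A_def by (metis image_eqI)
  qed
  moreover have "f l \<in> S" if "l \<in> ?W" for l
    using that
  proof (induction l)
    case Nil
    then show ?case using subspace_0[OF S] by (simp add: f_def)
  next
    case (Cons a l)
    then show ?case using CS subspace_add[OF S] subspace_scale[OF S] by (cases a) (auto simp: f_def)
  qed
  then have "A \<subseteq> S" by (auto simp: A_def)
  moreover have "gauss_closed sc A"
    unfolding gauss_closed_def
  proof (intro conjI ballI)
    show "0 \<in> A" unfolding A_def by (intro image_eqI[of _ _ "[]"]) (auto simp: f_def)
    fix x assume "x \<in> A"
    then obtain l where l: "l \<in> ?W" "x = f l" unfolding A_def by blast
    show "x + y \<in> A" if "y \<in> A" for y
    proof -
      obtain m where m: "m \<in> ?W" "y = f m" using \<open>y \<in> A\<close> unfolding A_def by blast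
      have "x + y = f (l @ m)" using l m by (simp add: f_def)
      then show ?thesis using l(1) m(1) unfolding A_def by (intro image_eqI[of _ _ "l @ m"]) auto
    qed
    show "sc k x \<in> A" if k: "k \<in> gauss_rat" for k
    proof -
      let ?m = "map (\<lambda>(j, z). (k * j, z)) l"
      have "sc k x = f ?m"
        unfolding l(2) f_def scale_sum_list by (simp add: o_def case_prod_unfold)
      moreover have "?m \<in> ?W" using l(1) gauss_rat_mult[OF k] by (auto simp: in_lists_conv_set)
      ultimately show ?thesis unfolding A_def by blast
    qed
  qed
  ultimately show ?thesis by blast
qed

text \<open>The common ending of the density arguments: \<open>a\<close> is the quantity to be shown
  0, \<open>d\<close> the distance to an approximant and \<open>c\<close> a constant independent of
  it.\<close>

lemma zero_of_small:
  fixes a c :: real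
  assumes a: "0 \<le> a" and c: "0 \<le> c" and small: "\<And>e. 0 < e \<Longrightarrow> \<exists>d<e. a \<le> c * d"
  shows "a = 0"
proof (rule ccontr)
  assume "a \<noteq> 0"
  \<comment> \<open>The tolerance \<open>a / (c + 1)\<close> makes \<open>c * d\<close> smaller than
    \<open>a\<close>, also when \<open>c\<close> is 0.\<close>
  then have "0 < a / (c + 1)" using a c by simp
  then obtain d where d: "d < a / (c + 1)" "a \<le> c * d" using small by blast
  have "c * d \<le> c * (a / (c + 1))" using d(1) c by (intro mult_left_mono) auto
  also have "\<dots> < a" using \<open>a \<noteq> 0\<close> a c by (simp add: field_simps)
  finally show False using d(2) by simp
qed

text \<open>Only commutation with multiplications by indicators is assumed. This is enough to
  localise norm bounds and orthogonality to arbitrary measurable sets.\<close>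

locale commuting_op = loc_int +
  fixes T :: "('b \<Rightarrow> 'c) set \<Rightarrow> ('b \<Rightarrow> 'c) set"
  assumes T: "T \<in> loc_bounded_ops IS UNIV (level M H D)"
    and comm: "\<And>E A. E \<in> sets L \<Longrightarrow> A \<in> vecs IS \<Longrightarrow> T (mulop E A) = mulop E (T A)"
begin

text \<open>A map representing the image class. The choice is not linear, so sums, multiples and
  cut-offs are respected only off a null set that depends on the arguments.\<close>

definition t where "t u = (SOME w. w \<in> D \<and> T (cls u) = cls w)"

lemma t_props:
  assumes "u \<in> D"
  shows "t u \<in> D" "T (cls u) = cls (t u)"
proof -
  have "\<exists>w. w \<in> D \<and> T (cls u) = cls w" using ops_cls[OF T assms] by blast
  then have "t u \<in> D \<and> T (cls u) = cls (t u)" unfolding t_def by (rule someI_ex)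
  then show "t u \<in> D" "T (cls u) = cls (t u)" by auto
qed

lemmas T_level = T[unfolded loc_bounded_ops_def mem_Collect_eq, THEN conjunct2, THEN conjunct2, THEN bspec, OF UNIV_I]

lemma T_linear: "linear_in IS T"
  using T[unfolded loc_bounded_ops_def mem_Collect_eq, THEN conjunct2] by (rule conjunct1)

lemma t_cong:
  assumes "u \<in> D" "v \<in> D" "AE p in L. u p = v p"
  shows "AE p in L. t u p = t v p"
  using cls_eqD[of "t u" "t v"] t_props assms(1,2) cls_cong[OF assms(3)] by metis

lemma t_add:
  assumes "u \<in> D" "v \<in> D"
  shows "AE p in L. t (u + v) p = t u p + t v p"
proof -
  have "cls u \<in> vecs IS" "cls v \<in> vecs IS" using assms by (auto simp: vecs_IS)
  then have "T (vadd IS (cls u) (cls v)) = vadd IS (T (cls u)) (T (cls v))"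
    using T_linear unfolding linear_in_def by simp
  then have "cls (t (u + v)) = cls (t u + t v)"
    using assms t_props D_add by (simp add: vadd_cls)
  then show ?thesis using cls_eqD[of "t (u + v)" "t u + t v"] t_props D_add assms by simp
qed

lemma t_scale:
  assumes "u \<in> D"
  shows "AE p in L. t (scf c u) p = sc c (t u p)"
proof -
  have "cls u \<in> vecs IS" using assms by (auto simp: vecs_IS)
  then have "T (vscale IS c (cls u)) = vscale IS c (T (cls u))"
    using T_linear unfolding linear_in_def by simp
  then have "cls (t (scf c u)) = cls (scf c (t u))"
    using assms t_props D_scale by (simp add: vscale_cls)
  then show ?thesis using cls_eqD[of "t (scf c u)" "scf c (t u)"] t_props D_scale assms by simp
qed

lemma t_diff:
  assumes "u \<in> D" "v \<in> D"
  shows "AE p in L. t (u - v) p = t u p - t v p"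
proof -
  have eq: "u - v = u + scf (-1) v" by (auto simp: fun_eq_iff)
  show ?thesis
    unfolding eq using t_add[OF assms(1) D_scale[OF assms(2), of "-1"]] t_scale[OF assms(2), of "-1"]
    by eventually_elim simp
qed

lemma t_level:
  assumes "u \<in> nlev \<alpha>"
  shows "\<exists>w\<in>nlev \<alpha>. AE p in L. t u p = w p"
proof -
  have "T ` level M H D \<alpha> \<subseteq> level M H D \<alpha>" using T_level[of \<alpha>] by (rule conjunct1)
  then obtain w where w: "w \<in> nlev \<alpha>" "T (cls u) = cls w" using assms unfolding level_eq by blast
  then show ?thesis using t_props[OF nlevD(1)[OF assms]] cls_eqD by metis
qed

lemma t_level_AE:
  assumes "u \<in> nlev \<alpha>"
  shows "AE p in L. (p \<in> X \<alpha> \<longrightarrow> t u p \<in> H \<alpha> p) \<and> (p \<notin> X \<alpha> \<longrightarrow> t u p = 0)"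
proof -
  obtain w where w: "w \<in> nlev \<alpha>" "AE p in L. t u p = w p" using t_level[OF assms] by blast
  from w(2) show ?thesis by eventually_elim (use nlevD(2,3)[OF w(1)] in auto)
qed

lemma t_cut:
  assumes E: "E \<in> sets L" and u: "u \<in> nlev \<alpha>"
  shows "AE p in L. t (cut_to E u) p = cut_to E (t u) p"
proof -
  have uD: "u \<in> D" "cut_to E u \<in> D" using nlevD(1)[OF u] nlevD(1)[OF cut_nlev[OF E u]] by auto
  have "cls u \<in> vecs IS" using uD by (simp add: vecs_IS)
  then have "T (mulop E (cls u)) = mulop E (T (cls u))" by (rule comm[OF E])
  then have "cls (t (cut_to E u)) = cls (cut_to E (t u))"
    unfolding mulop_cls[OF uD(1)] t_props(2)[OF uD(1)] t_props(2)[OF uD(2)] mulop_cls[OF t_props(1)[OF uD(1)]] .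
  then show ?thesis by (rule cls_eqD[OF t_props(1)[OF uD(2)]])
qed

lemma t_orth:
  assumes u: "u \<in> D" and orth: "\<And>v. v \<in> nlev \<alpha> \<Longrightarrow> bL u v = 0" and v: "v \<in> nlev \<alpha>"
  shows "bL (t u) v = 0"
proof -
  have "cls u \<in> orth_in IS (level M H D \<alpha>)"
    unfolding orth_in_def level_eq using u orth nlevD(1) by (auto simp: vecs_IS vinner_cls)
  moreover have "T ` orth_in IS (level M H D \<alpha>) \<subseteq> orth_in IS (level M H D \<alpha>)"
    using T_level[of \<alpha>, THEN conjunct2] by (rule conjunct1)
  ultimately have "T (cls u) \<in> orth_in IS (level M H D \<alpha>)" by blast
  then have "vinner IS (T (cls u)) (cls v) = 0" unfolding orth_in_def level_eq using v by blast
  then show ?thesis using t_props[OF u] nlevD(1)[OF v] by (simp add: vinner_cls)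
qed

lemma t_bounded_ex: "\<exists>B\<ge>0. \<forall>u\<in>nlev \<alpha>. nrm bL (t u) \<le> B * nrm bL u"
proof -
  obtain B where B: "\<forall>A\<in>level M H D \<alpha>. vnorm IS (T A) \<le> B * vnorm IS A"
    using T_level[of \<alpha>, THEN conjunct2, THEN conjunct2] by (rule exE)
  have "nrm bL (t u) \<le> \<bar>B\<bar> * nrm bL u" if u: "u \<in> nlev \<alpha>" for u
  proof -
    have uD: "u \<in> D" using nlevD(1)[OF u] .
    have "nrm bL (t u) \<le> B * nrm bL u"
      using bspec[OF B[unfolded level_eq] imageI[OF u]] uD t_props[OF uD] by (simp add: vnorm_cls)
    also have "\<dots> \<le> \<bar>B\<bar> * nrm bL u" using DL.nrm_nonneg[OF uD] by (intro mult_right_mono) auto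
    finally show ?thesis .
  qed
  then show ?thesis by (intro exI[of _ "\<bar>B\<bar>"]) auto
qed

definition level_bound where "level_bound \<alpha> = (SOME B. 0 \<le> B \<and> (\<forall>u\<in>nlev \<alpha>. nrm bL (t u) \<le> B * nrm bL u))"

lemma level_bound_nonneg: "0 \<le> level_bound \<alpha>" and level_bound_nrm: "u \<in> nlev \<alpha> \<Longrightarrow> nrm bL (t u) \<le> level_bound \<alpha> * nrm bL u"
proof -
  have "\<exists>B. 0 \<le> B \<and> (\<forall>u\<in>nlev \<alpha>. nrm bL (t u) \<le> B * nrm bL u)" using t_bounded_ex by blast
  then have "0 \<le> level_bound \<alpha> \<and> (\<forall>u\<in>nlev \<alpha>. nrm bL (t u) \<le> level_bound \<alpha> * nrm bL u)" unfolding level_bound_def by (rule someI_ex)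
  then show "0 \<le> level_bound \<alpha>" "u \<in> nlev \<alpha> \<Longrightarrow> nrm bL (t u) \<le> level_bound \<alpha> * nrm bL u" by auto
qed

text \<open>Testing the norm bound on the set where the pointwise bound fails shows that this set is null.\<close>

lemma t_pointwise:
  assumes u: "u \<in> nlev \<alpha>"
  shows "AE p in L. nrm (ip p) (t u p) \<le> level_bound \<alpha> * nrm (ip p) (u p)"
proof -
  define B where "B = level_bound \<alpha>"
  \<comment> \<open>Cut-offs are available for strict representatives, hence \<open>t u\<close> is
    replaced by \<open>w\<close>.\<close>
  obtain w where w: "w \<in> nlev \<alpha>" and tw: "AE p in L. t u p = w p" using t_level[OF u] by blast
  have uD: "u \<in> D" and wD: "w \<in> D" using nlevD(1) u w by auto
  define f g where "f p = Re (ip p (w p) (w p))" and "g p = Re (ip p (u p) (u p))" for p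
  have int: "integrable L f" "integrable L g"
    unfolding f_def g_def using D_integrable uD wD by auto
  have [measurable]: "f \<in> borel_measurable L" "g \<in> borel_measurable L" using int by auto
  define E where "E = {p\<in>space L. B\<^sup>2 * g p < f p}"
  have E: "E \<in> sets L" by (simp add: E_def)
  have cD: "cut_to E u \<in> D" "cut_to E w \<in> D" using cut_nlev[OF E] u w nlevD(1) by blast+
  have sq: "(nrm bL (cut_to E v))\<^sup>2 = (LINT p|L. (if p \<in> E then Re (ip p (v p) (v p)) else 0))"
    "integrable L (\<lambda>p. if p \<in> E then Re (ip p (v p) (v p)) else 0)" if v: "v \<in> D" "cut_to E v \<in> D" for v
  proof -
    have eq: "Re (ip p (cut_to E v p) (cut_to E v p)) = (if p \<in> E then Re (ip p (v p) (v p)) else 0)"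
      if "p \<in> space L" for p
      using fib_zero_left[of p 0] D_fibre[OF D_zero] that by (auto simp: cut_to_def space_L)
    have I: "integrable L (\<lambda>p. Re (ip p (cut_to E v p) (cut_to E v p)))" using D_integrable v by auto
    show "integrable L (\<lambda>p. if p \<in> E then Re (ip p (v p) (v p)) else 0)"
      using I eq by (simp cong: Bochner_Integration.integrable_cong)
    have "(nrm bL (cut_to E v))\<^sup>2 = (LINT p|L. Re (ip p (cut_to E v p) (cut_to E v p)))"
      using D_integrable v by (simp add: DL.nrm_sq)
    then show "(nrm bL (cut_to E v))\<^sup>2 = (LINT p|L. (if p \<in> E then Re (ip p (v p) (v p)) else 0))"
      using eq by (simp cong: Bochner_Integration.integral_cong)
  qed
  have "AE p in L. t (cut_to E u) p = cut_to E w p"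
    using t_cut[OF E u] tw by eventually_elim (simp add: cut_to_def)
  then have "cls (t (cut_to E u)) = cls (cut_to E w)" by (rule cls_cong)
  then have "nrm bL (t (cut_to E u)) = nrm bL (cut_to E w)"
    using vnorm_cls[OF t_props(1)[OF cD(1)]] vnorm_cls[OF cD(2)] by simp
  then have "nrm bL (cut_to E w) \<le> B * nrm bL (cut_to E u)"
    using level_bound_nrm[OF cut_nlev[OF E u]] by (simp add: B_def)
  then have "(nrm bL (cut_to E w))\<^sup>2 \<le> (B * nrm bL (cut_to E u))\<^sup>2"
    using DL.nrm_nonneg[OF cD(2)] by (rule power_mono)
  then have "(nrm bL (cut_to E w))\<^sup>2 \<le> B\<^sup>2 * (nrm bL (cut_to E u))\<^sup>2"
    by (simp only: power_mult_distrib)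
  then have le: "(LINT p|L. (if p \<in> E then f p else 0)) \<le> B\<^sup>2 * (LINT p|L. (if p \<in> E then g p else 0))"
    unfolding sq(1)[OF uD cD(1)] sq(1)[OF wD cD(2)] f_def g_def .
  \<comment> \<open>\<open>h\<close> is positive on \<open>E\<close> and 0 elsewhere, while the norm
    bound makes its integral at most 0.\<close>
  define h where "h p = (if p \<in> E then f p else 0) - B\<^sup>2 * (if p \<in> E then g p else 0)" for p
  have intE: "integrable L (\<lambda>p. if p \<in> E then f p else 0)" "integrable L (\<lambda>p. if p \<in> E then g p else 0)"
    using sq(2)[OF wD cD(2)] sq(2)[OF uD cD(1)] unfolding f_def g_def by auto
  have hint: "integrable L h" unfolding h_def using intE by simp
  have hpos: "0 \<le> h p" for p by (auto simp: h_def E_def)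
  have "(LINT p|L. h p) \<le> 0" unfolding h_def using intE le by simp
  moreover have "0 \<le> (LINT p|L. h p)" using hpos by (rule Bochner_Integration.integral_nonneg)
  ultimately have "(LINT p|L. h p) = 0" by (rule antisym)
  then have "AE p in L. h p = 0"
    using integral_nonneg_eq_0_iff_AE[OF hint AE_I2[OF hpos]] by blast
  moreover have "AE p in L. p \<in> space L" by simp
  ultimately show ?thesis using tw
  proof eventually_elim
    case (elim p)
    then have p: "p \<in> loc_carrier M" by (simp add: space_L)
    interpret semi_ip sc "Dp p" "ip p" using fibre_semi_ip[OF p] .
    have up: "u p \<in> Dp p" "w p \<in> Dp p" using D_fibre uD wD p by auto
    have "f p \<le> B\<^sup>2 * g p" using elim by (auto simp: h_def E_def split: if_splits)
    then have "(nrm (ip p) (w p))\<^sup>2 \<le> (B * nrm (ip p) (u p))\<^sup>2"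
      using up by (simp add: f_def g_def power_mult_distrib nrm_sq)
    moreover have "0 \<le> B * nrm (ip p) (u p)"
      unfolding B_def by (rule mult_nonneg_nonneg[OF level_bound_nonneg nrm_nonneg[OF up(1)]])
    ultimately have "nrm (ip p) (w p) \<le> B * nrm (ip p) (u p)" by (rule power2_le_imp_le)
    then show ?case using elim(3) unfolding B_def by simp
  qed
qed

section \<open>Countable families that are dense in almost every fibre\<close>

definition dense_family where
  "dense_family \<alpha> = (SOME C. countable C \<and> C \<subseteq> nlev \<alpha> \<and> gauss_closed scf C \<and>
     (\<forall>u\<in>nlev \<alpha>. \<forall>e>0. \<exists>v\<in>C. nrm bL (u - v) < e))"

lemma dense_family_props:
  "countable (dense_family \<alpha>)" "dense_family \<alpha> \<subseteq> nlev \<alpha>" "gauss_closed scf (dense_family \<alpha>)"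
  "\<lbrakk>u \<in> nlev \<alpha>; 0 < e\<rbrakk> \<Longrightarrow> \<exists>v\<in>dense_family \<alpha>. nrm bL (u - v) < e"
proof -
  obtain C0 where "countable C0 \<and> C0 \<subseteq> nlev \<alpha> \<and> (\<forall>u\<in>nlev \<alpha>. \<forall>e>0. \<exists>v\<in>C0. nrm bL (u - v) < e)"
    using level_dense_countable[of \<alpha>] by (rule exE)
  then have C0: "countable C0" "C0 \<subseteq> nlev \<alpha>" "\<And>u e. u \<in> nlev \<alpha> \<Longrightarrow> 0 < e \<Longrightarrow> \<exists>v\<in>C0. nrm bL (u - v) < e"
    by simp_all
  have "DL.subspace (nlev \<alpha>)" by (rule DL.subspaceI[OF nlev_zero nlev_add nlev_scale])
  then obtain C where C: "countable C" "C0 \<subseteq> C" "C \<subseteq> nlev \<alpha>" "gauss_closed scf C"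
    using countable_gauss_hull[OF scf_vector_space C0(1) _ C0(2)] by auto
  have "\<exists>v\<in>C. nrm bL (u - v) < e" if "u \<in> nlev \<alpha>" "0 < e" for u e
    using C0(3)[OF that] C(2) by (elim bexE) (rule bexI, assumption, erule (1) subsetD)
  then have "\<exists>C. countable C \<and> C \<subseteq> nlev \<alpha> \<and> gauss_closed scf C \<and>
     (\<forall>u\<in>nlev \<alpha>. \<forall>e>0. \<exists>v\<in>C. nrm bL (u - v) < e)"
    using C by (intro exI[of _ C] conjI) simp_all
  then have "countable (dense_family \<alpha>) \<and> dense_family \<alpha> \<subseteq> nlev \<alpha> \<and> gauss_closed scf (dense_family \<alpha>) \<and>
     (\<forall>u\<in>nlev \<alpha>. \<forall>e>0. \<exists>v\<in>dense_family \<alpha>. nrm bL (u - v) < e)"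
    unfolding dense_family_def by (rule someI_ex)
  then show "countable (dense_family \<alpha>)" "dense_family \<alpha> \<subseteq> nlev \<alpha>" "gauss_closed scf (dense_family \<alpha>)"
    "\<lbrakk>u \<in> nlev \<alpha>; 0 < e\<rbrakk> \<Longrightarrow> \<exists>v\<in>dense_family \<alpha>. nrm bL (u - v) < e" by auto
qed

lemma dense_family_nlev: "x \<in> dense_family \<alpha> \<Longrightarrow> x \<in> nlev \<alpha>"
  using dense_family_props(2) by blast

lemma dense_family_D: "x \<in> dense_family \<alpha> \<Longrightarrow> x \<in> D"
  using dense_family_nlev nlevD(1) by blast

lemma AE_dense_family:
  assumes "\<And>x. x \<in> dense_family \<alpha> \<Longrightarrow> AE p in L. P x p"
  shows "AE p in L. \<forall>x\<in>dense_family \<alpha>. P x p"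
  unfolding AE_ball_countable[OF dense_family_props(1)] by (intro ballI assms)

text \<open>Norm convergence in the level means that the squared fibre distances tend to 0 in the
  mean, so a subsequence converges at almost every point.\<close>

lemma approx_AE:
  assumes u: "u \<in> nlev \<alpha>"
  shows "AE p in L. \<forall>e>0. \<exists>x\<in>dense_family \<alpha>. nrm (ip p) (u p - x p) < e"
proof -
  have "\<exists>x\<in>dense_family \<alpha>. nrm bL (u - x) < 1 / real (Suc n)" for n
    using dense_family_props(4)[OF u] by simp
  then obtain x where x: "\<And>n. x n \<in> dense_family \<alpha>" "\<And>n. nrm bL (u - x n) < 1 / real (Suc n)" by metis
  have dD: "u - x n \<in> D" for n using nlevD(1)[OF u] dense_family_D[OF x(1)] DL.V_closed(3) by blast
  define g where "g n p = Re (ip p ((u - x n) p) ((u - x n) p))" for n p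
  have gint: "integrable L (g n)" for n unfolding g_def using D_integrable[OF dD dD] by auto
  have gpos: "0 \<le> g n p" if "p \<in> space L" for n p
    unfolding g_def using that D_fibre[OF dD] by (intro fib_nonneg) (auto simp: space_L)
  have gnorm: "(LINT p|L. norm (g n p)) = (nrm bL (u - x n))\<^sup>2" for n
  proof -
    have "(LINT p|L. norm (g n p)) = (LINT p|L. g n p)"
      using gpos by (intro Bochner_Integration.integral_cong) auto
    also have "\<dots> = (nrm bL (u - x n))\<^sup>2"
      unfolding DL.nrm_sq[OF dD] g_def using D_integrable[OF dD dD] by simp
    finally show ?thesis .
  qed
  have "(\<lambda>n. nrm bL (u - x n)) \<longlonglongrightarrow> 0"
  proof (rule tendsto_sandwich)
    show "\<forall>\<^sub>F n in sequentially. 0 \<le> nrm bL (u - x n)" using DL.nrm_nonneg[OF dD] by simp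
    show "\<forall>\<^sub>F n in sequentially. nrm bL (u - x n) \<le> 1 / real (Suc n)"
      using x(2) by (intro always_eventually) (auto intro: less_imp_le)
    show "(\<lambda>n. 1 / real (Suc n)) \<longlonglongrightarrow> 0" using lim_inverse_n'[THEN LIMSEQ_Suc] .
  qed auto
  then have "(\<lambda>n. LINT p|L. norm (g n p)) \<longlonglongrightarrow> 0"
    unfolding gnorm using tendsto_power[of _ 0 _ 2] by fastforce
  then obtain r where r: "AE p in L. (\<lambda>n. g (r n) p) \<longlonglongrightarrow> 0"
    using tendsto_L1_AE_subseq[of L g] gint by blast
  then show ?thesis
  proof eventually_elim
    case (elim p)
    have lim: "(\<lambda>n. nrm (ip p) (u p - x (r n) p)) \<longlonglongrightarrow> 0"
      using tendsto_real_sqrt[OF elim] by (simp add: g_def nrm_def)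
    show ?case
    proof (intro allI impI)
      fix e :: real assume "0 < e"
      then obtain n where "nrm (ip p) (u p - x (r n) p) < e"
        using order_tendstoD(2)[OF lim] by (auto simp: eventually_sequentially)
      then show "\<exists>x\<in>dense_family \<alpha>. nrm (ip p) (u p - x p) < e" using x(1) by blast
    qed
  qed
qed

definition dense_at where
  "dense_at \<alpha> p \<longleftrightarrow> (\<forall>h\<in>H \<alpha> p. \<forall>e>0. \<exists>x\<in>dense_family \<alpha>. nrm (ip p) (h - x p) < e)"

lemma dense_family_at_gauss_closed: "gauss_closed sc ((\<lambda>x. x p) ` dense_family \<alpha>)"
proof -
  have C: "0 \<in> dense_family \<alpha>" "\<And>x y. x \<in> dense_family \<alpha> \<Longrightarrow> y \<in> dense_family \<alpha> \<Longrightarrow> x + y \<in> dense_family \<alpha>"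
    "\<And>k x. k \<in> gauss_rat \<Longrightarrow> x \<in> dense_family \<alpha> \<Longrightarrow> scf k x \<in> dense_family \<alpha>"
    using dense_family_props(3)[of \<alpha>] unfolding gauss_closed_def by auto
  have "0 \<in> (\<lambda>x. x p) ` dense_family \<alpha>" using C(1) by (intro image_eqI[of _ _ 0]) auto
  moreover have "x p + y p \<in> (\<lambda>x. x p) ` dense_family \<alpha>" if "x \<in> dense_family \<alpha>" "y \<in> dense_family \<alpha>" for x y
    using C(2)[OF that] by (intro image_eqI[of _ _ "x + y"]) auto
  moreover have "sc k (x p) \<in> (\<lambda>x. x p) ` dense_family \<alpha>" if "k \<in> gauss_rat" "x \<in> dense_family \<alpha>" for k x
    using C(3)[OF that] by (intro image_eqI[of _ _ "scf k x"]) auto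
  ultimately show ?thesis unfolding gauss_closed_def by blast
qed

text \<open>Project a vector \<open>h\<close> that cannot be approximated onto the closure of the
  values of the family: the residual is orthogonal to these values, and it is nonzero because the
  projection can be approximated.\<close>

lemma not_dense_orthogonal:
  assumes p: "p \<in> X \<alpha>" and nd: "\<not> dense_at \<alpha> p"
  shows "\<exists>v\<in>H \<alpha> p. v \<noteq> 0 \<and> (\<forall>x\<in>dense_family \<alpha>. ip p v (x p) = 0)"
proof -
  interpret semi_ip sc "Dp p" "ip p" using fibre_semi_ip[OF in_carrier[OF p]] .
  obtain h e where h: "h \<in> H \<alpha> p" "0 < e" "\<And>x. x \<in> dense_family \<alpha> \<Longrightarrow> \<not> nrm (ip p) (h - x p) < e"
    using nd unfolding dense_at_def by blast
  have sub: "(\<lambda>x. x p) ` dense_family \<alpha> \<subseteq> H \<alpha> p" using nlevD(2)[OF dense_family_nlev] p by blast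
  have gc: "gauss_closed sc ((\<lambda>x. x p) ` dense_family \<alpha>)" by (rule dense_family_at_gauss_closed)
  have hDp: "h \<in> Dp p" using h(1) H_subset_Dp[OF p] by blast
  obtain w where w: "w \<in> H \<alpha> p" "\<And>e. 0 < e \<Longrightarrow> \<exists>a\<in>(\<lambda>x. x p) ` dense_family \<alpha>. nrm (ip p) (w - a) < e"
      "\<And>x. x \<in> dense_family \<alpha> \<Longrightarrow> ip p (h - w) (x p) = 0"
    using projection[OF sub H_subset_Dp[OF p] H_seq_complete[OF p] gc hDp] by blast
  have "h - w \<noteq> 0" using w(2)[OF h(2)] h(3) by auto
  moreover have "h - w \<in> H \<alpha> p" using amb.subspace_diff[OF H_subspace[OF p] h(1) w(1)] .
  ultimately show ?thesis using w(3) by blast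
qed

text \<open>At the points where density fails, choose nonzero vectors orthogonal to the family. By
  maximality they form an element of the level, which is then orthogonal to itself; no measurability
  of the choice or of the exceptional set is needed in advance.\<close>

lemma dense_AE: "AE p in L. p \<in> X \<alpha> \<longrightarrow> dense_at \<alpha> p"
proof -
  define v where "v p = (if p \<in> X \<alpha> \<and> \<not> dense_at \<alpha> p
    then SOME v. v \<in> H \<alpha> p \<and> v \<noteq> 0 \<and> (\<forall>x\<in>dense_family \<alpha>. ip p v (x p) = 0) else 0)" for p
  have v: "v p \<in> H \<alpha> p \<and> v p \<noteq> 0 \<and> (\<forall>x\<in>dense_family \<alpha>. ip p (v p) (x p) = 0)"
    if "p \<in> X \<alpha>" "\<not> dense_at \<alpha> p" for p
    using someI_ex[of "\<lambda>v. v \<in> H \<alpha> p \<and> v \<noteq> 0 \<and> (\<forall>x\<in>dense_family \<alpha>. ip p v (x p) = 0)"]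
      not_dense_orthogonal[OF that] that unfolding v_def by auto
  have v0: "v p = 0" if "\<not> (p \<in> X \<alpha> \<and> \<not> dense_at \<alpha> p)" for p using that by (auto simp: v_def)
  have vH: "v p \<in> H \<alpha> p" if "p \<in> X \<alpha>" for p
    using v[of p] v0[of p] amb.subspace_0[OF H_subspace[OF that]] that by (cases "dense_at \<alpha> p") auto
  \<comment> \<open>At a point where density fails, \<open>v p\<close> is orthogonal to the values
    of the family, and by \<open>approx_AE\<close> these approximate \<open>u p\<close>; elsewhere
    \<open>v p\<close> is 0.\<close>
  have zero: "AE p in L. ip p (u p) (v p) = 0" if u: "u \<in> nlev \<alpha>" for u
  proof -
    have "AE p in L. p \<in> space L" by simp
    then show ?thesis using approx_AE[OF u]
    proof eventually_elim
      case (elim p)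
      then have pc: "p \<in> loc_carrier M" by (simp add: space_L)
      interpret semi_ip sc "Dp p" "ip p" using fibre_semi_ip[OF pc] .
      have uDp: "u p \<in> Dp p" using D_fibre[OF nlevD(1)[OF u] pc] .
      show ?case
      proof (cases "p \<in> X \<alpha> \<and> \<not> dense_at \<alpha> p")
        case True
        then have vp: "v p \<in> Dp p" using vH H_subset_Dp by blast
        have "cmod (ip p (u p) (v p)) = 0"
        proof (rule zero_of_small[OF _ nrm_nonneg[OF vp]])
          fix e :: real assume "0 < e"
          then obtain x where x: "x \<in> dense_family \<alpha>" "nrm (ip p) (u p - x p) < e" using elim by blast
          have xDp: "x p \<in> Dp p" using D_fibre[OF dense_family_D[OF x(1)] pc] .
          have "ip p (x p) (v p) = 0" using v[of p] True x(1) herm[OF vp xDp] by simp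
          then have "cmod (ip p (u p) (v p)) = cmod (ip p (u p - x p) (v p))"
            using diff_left[OF uDp xDp vp] by simp
          also have "\<dots> \<le> nrm (ip p) (u p - x p) * nrm (ip p) (v p)"
            using cauchy_schwarz[of "u p - x p" "v p"] uDp xDp vp by simp
          finally show "\<exists>d<e. cmod (ip p (u p) (v p)) \<le> nrm (ip p) (v p) * d"
            using x(2) by (auto simp: mult.commute)
        qed simp
        then show ?thesis by simp
      qed (use v0 zero_right[OF uDp] in simp)
    qed
  qed
  \<comment> \<open>The pairing equals 0 almost everywhere, so completeness of \<open>L\<close>
    supplies its integrability, including measurability.\<close>
  have "integrable L (\<lambda>p. ip p (u p) (v p))" if "u \<in> nlev \<alpha>" for u
    by (rule complete_measure.integrable_AE[OF L_complete, of "\<lambda>p. 0"])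
      (use zero[OF that] in \<open>auto elim: eventually_mono\<close>)
  then obtain w where w: "w \<in> nlev \<alpha>" "AE p in L. w p = v p"
    using level_maximal[of \<alpha> v] vH v0 by blast
  show ?thesis using zero[OF w(1)] w(2)
  proof eventually_elim
    case (elim p)
    show ?case
    proof (intro impI, rule ccontr)
      assume p: "p \<in> X \<alpha>" and "\<not> dense_at \<alpha> p"
      then have "v p \<noteq> 0" "v p \<in> Dp p" using v H_subset_Dp by blast+
      moreover have "nrm (ip p) (v p) = 0" using elim by (simp add: nrm_def)
      ultimately show False using fibre_definite[OF in_carrier[OF p]] by blast
    qed
  qed
qed

section \<open>Bounded operators on the fibres of one level\<close>

definition is_fibre_op where
  "is_fibre_op \<alpha> p F \<longleftrightarrow> (\<forall>x\<in>H \<alpha> p. F x \<in> H \<alpha> p \<and> nrm (ip p) (F x) \<le> level_bound \<alpha> * nrm (ip p) x) \<and>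
    (\<forall>x\<in>H \<alpha> p. \<forall>y\<in>H \<alpha> p. F (x + y) = F x + F y) \<and> (\<forall>c. \<forall>x\<in>H \<alpha> p. F (sc c x) = sc c (F x)) \<and>
    (\<forall>x\<in>dense_family \<alpha>. F (x p) = t x p)"

definition fibre_op where "fibre_op \<alpha> p = (SOME F. is_fibre_op \<alpha> p F)"

text \<open>Off one null set, the countably many relations between the maps \<open>t x\<close> for
  \<open>x\<close> in the family hold together, and the pairs \<open>(x p, t x p)\<close> satisfy
  the hypotheses of \<open>bounded_extension\<close>. A relation is used there because different
  members may agree at \<open>p\<close>; its single-valuedness follows from the norm bound.\<close>

lemma is_fibre_op_AE: "AE p in L. p \<in> X \<alpha> \<longrightarrow> is_fibre_op \<alpha> p (fibre_op \<alpha> p) \<and> dense_at \<alpha> p"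
proof -
  have "AE p in L. \<forall>y\<in>dense_family \<alpha>. t (x + y) p = t x p + t y p" if "x \<in> dense_family \<alpha>" for x
    by (rule AE_dense_family) (rule t_add[OF dense_family_D[OF that] dense_family_D])
  then have add: "AE p in L. \<forall>x\<in>dense_family \<alpha>. \<forall>y\<in>dense_family \<alpha>. t (x + y) p = t x p + t y p"
    by (rule AE_dense_family)
  have "AE p in L. \<forall>k\<in>gauss_rat. t (scf k x) p = sc k (t x p)" if "x \<in> dense_family \<alpha>" for x
    unfolding AE_ball_countable[OF countable_gauss_rat] by (intro ballI t_scale dense_family_D[OF that])
  then have scale: "AE p in L. \<forall>x\<in>dense_family \<alpha>. \<forall>k\<in>gauss_rat. t (scf k x) p = sc k (t x p)"
    by (rule AE_dense_family)
  have lev: "AE p in L. \<forall>x\<in>dense_family \<alpha>. (p \<in> X \<alpha> \<longrightarrow> t x p \<in> H \<alpha> p) \<and> (p \<notin> X \<alpha> \<longrightarrow> t x p = 0)"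
    by (rule AE_dense_family) (rule t_level_AE[OF dense_family_nlev])
  have bnd: "AE p in L. \<forall>x\<in>dense_family \<alpha>. nrm (ip p) (t x p) \<le> level_bound \<alpha> * nrm (ip p) (x p)"
    by (rule AE_dense_family) (rule t_pointwise[OF dense_family_nlev])
  show ?thesis using dense_AE[of \<alpha>] add scale lev bnd
  proof eventually_elim
    case (elim p)
    show ?case
    proof
      assume p: "p \<in> X \<alpha>"
      interpret semi_ip sc "Dp p" "ip p" using fibre_semi_ip[OF in_carrier[OF p]] .
      have "\<exists>F. (\<forall>x\<in>H \<alpha> p. F x \<in> H \<alpha> p \<and> nrm (ip p) (F x) \<le> level_bound \<alpha> * nrm (ip p) x) \<and>
        (\<forall>x\<in>H \<alpha> p. \<forall>y\<in>H \<alpha> p. F (x + y) = F x + F y) \<and> (\<forall>c. \<forall>x\<in>H \<alpha> p. F (sc c x) = sc c (F x)) \<and>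
        (\<forall>(x, y)\<in>(\<lambda>x. (x p, t x p)) ` dense_family \<alpha>. F x = y)"
      proof (rule bounded_extension[OF H_subspace[OF p] H_subset_Dp[OF p] H_seq_complete[OF p]])
        show "x = 0" if "x \<in> H \<alpha> p" "nrm (ip p) x = 0" for x
          using fibre_definite[OF in_carrier[OF p] _ that(2)] that(1) H_subset_Dp[OF p] by blast
        show "x \<in> H \<alpha> p \<and> y \<in> H \<alpha> p" if "(x, y) \<in> (\<lambda>x. (x p, t x p)) ` dense_family \<alpha>" for x y
          using that elim p nlevD(2)[OF dense_family_nlev] by auto
        show "(x + x', y + y') \<in> (\<lambda>x. (x p, t x p)) ` dense_family \<alpha>"
          if xy: "(x, y) \<in> (\<lambda>x. (x p, t x p)) ` dense_family \<alpha>" "(x', y') \<in> (\<lambda>x. (x p, t x p)) ` dense_family \<alpha>" for x y x' y'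
        proof -
          obtain a a' where a: "a \<in> dense_family \<alpha>" "x = a p" "y = t a p" "a' \<in> dense_family \<alpha>" "x' = a' p" "y' = t a' p"
            using xy by blast
          have "a + a' \<in> dense_family \<alpha>" using dense_family_props(3) a unfolding gauss_closed_def by blast
          then show ?thesis using a elim(2) by (intro image_eqI[of _ _ "a + a'"]) auto
        qed
        show "(sc k x, sc k y) \<in> (\<lambda>x. (x p, t x p)) ` dense_family \<alpha>"
          if k: "k \<in> gauss_rat" and xy: "(x, y) \<in> (\<lambda>x. (x p, t x p)) ` dense_family \<alpha>" for k x y
        proof -
          obtain a where a: "a \<in> dense_family \<alpha>" "x = a p" "y = t a p" using xy by blast
          have "scf k a \<in> dense_family \<alpha>" using dense_family_props(3) a k unfolding gauss_closed_def by blast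
          then show ?thesis using a k elim(3) by (intro image_eqI[of _ _ "scf k a"]) auto
        qed
        show "nrm (ip p) y \<le> level_bound \<alpha> * nrm (ip p) x" if "(x, y) \<in> (\<lambda>x. (x p, t x p)) ` dense_family \<alpha>" for x y
          using that elim(5) by auto
        show "0 \<le> level_bound \<alpha>" by (rule level_bound_nonneg)
        show "\<exists>(x', y')\<in>(\<lambda>x. (x p, t x p)) ` dense_family \<alpha>. nrm (ip p) (x - x') < e"
          if "x \<in> H \<alpha> p" "0 < e" for x e
          using elim(1) p that unfolding dense_at_def by auto
      qed
      then have "\<exists>F. is_fibre_op \<alpha> p F" unfolding is_fibre_op_def by auto
      then have "is_fibre_op \<alpha> p (fibre_op \<alpha> p)" unfolding fibre_op_def by (rule someI_ex)
      then show "is_fibre_op \<alpha> p (fibre_op \<alpha> p) \<and> dense_at \<alpha> p" using elim(1) p by blast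
    qed
  qed
qed

lemma is_fibre_op_mem: "\<lbrakk>is_fibre_op \<alpha> p F; x \<in> H \<alpha> p\<rbrakk> \<Longrightarrow> F x \<in> H \<alpha> p"
  and is_fibre_op_bound: "\<lbrakk>is_fibre_op \<alpha> p F; x \<in> H \<alpha> p\<rbrakk> \<Longrightarrow> nrm (ip p) (F x) \<le> level_bound \<alpha> * nrm (ip p) x"
  and is_fibre_op_add: "\<lbrakk>is_fibre_op \<alpha> p F; x \<in> H \<alpha> p; y \<in> H \<alpha> p\<rbrakk> \<Longrightarrow> F (x + y) = F x + F y"
  and is_fibre_op_scale: "\<lbrakk>is_fibre_op \<alpha> p F; x \<in> H \<alpha> p\<rbrakk> \<Longrightarrow> F (sc c x) = sc c (F x)"
  and is_fibre_op_dense_family: "\<lbrakk>is_fibre_op \<alpha> p F; a \<in> dense_family \<alpha>\<rbrakk> \<Longrightarrow> F (a p) = t a p"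
  unfolding is_fibre_op_def by blast+

lemma is_fibre_op_diff:
  assumes "is_fibre_op \<alpha> p F" "p \<in> X \<alpha>" "x \<in> H \<alpha> p" "y \<in> H \<alpha> p"
  shows "F (x - y) = F x - F y"
  using is_fibre_op_add[OF assms(1,3) amb.subspace_scale[OF H_subspace[OF assms(2)] assms(4)], of "-1"]
    is_fibre_op_scale[OF assms(1,4), of "-1"] by simp

lemma is_fibre_op_zero: "is_fibre_op \<alpha> p F \<Longrightarrow> p \<in> X \<alpha> \<Longrightarrow> F 0 = 0"
  using is_fibre_op_scale[of \<alpha> p F 0 0] amb.subspace_0[OF H_subspace] by simp

text \<open>By construction the claim holds on the countable family. It extends to \<open>u\<close>
  because the pointwise bound for \<open>t (u - x)\<close> and the bound of the fibre operator are
  both governed by the distance of \<open>u p\<close> to \<open>x p\<close>.\<close>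

lemma fibre_op_apply_AE:
  assumes u: "u \<in> nlev \<alpha>"
  shows "AE p in L. p \<in> X \<alpha> \<longrightarrow> t u p = fibre_op \<alpha> p (u p)"
proof -
  have "AE p in L. nrm (ip p) (t u p - t x p) \<le> level_bound \<alpha> * nrm (ip p) (u p - x p)" if x: "x \<in> dense_family \<alpha>" for x
    using t_diff[OF nlevD(1)[OF u] dense_family_D[OF x]] t_pointwise[OF nlev_diff[OF u dense_family_nlev[OF x]]]
    by eventually_elim simp
  then have "AE p in L. \<forall>x\<in>dense_family \<alpha>. nrm (ip p) (t u p - t x p) \<le> level_bound \<alpha> * nrm (ip p) (u p - x p)"
    by (rule AE_dense_family)
  then show ?thesis using approx_AE[OF u] is_fibre_op_AE[of \<alpha>] t_level_AE[OF u]
  proof eventually_elim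
    case (elim p)
    show ?case
    proof
      assume p: "p \<in> X \<alpha>"
      interpret semi_ip sc "Dp p" "ip p" using fibre_semi_ip[OF in_carrier[OF p]] .
      have F: "is_fibre_op \<alpha> p (fibre_op \<alpha> p)" and tu: "t u p \<in> H \<alpha> p" using elim p by auto
      note up = nlevD(2)[OF u p]
      have sub: "x \<in> Dp p" if "x \<in> H \<alpha> p" for x using that H_subset_Dp[OF p] by blast
      have "nrm (ip p) (t u p - fibre_op \<alpha> p (u p)) = 0"
      proof (rule zero_of_small)
        show "0 \<le> nrm (ip p) (t u p - fibre_op \<alpha> p (u p))"
          using tu is_fibre_op_mem[OF F up] sub by (intro nrm_nonneg) auto
        show "0 \<le> 2 * level_bound \<alpha>" using level_bound_nonneg[of \<alpha>] by simp
        fix e :: real assume "0 < e"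
        then obtain x where x: "x \<in> dense_family \<alpha>" "nrm (ip p) (u p - x p) < e" using elim by blast
        have xp: "x p \<in> H \<alpha> p" using nlevD(2)[OF dense_family_nlev[OF x(1)] p] .
        have uxp: "u p - x p \<in> H \<alpha> p" using amb.subspace_diff[OF H_subspace[OF p] up xp] .
        have "t x p - fibre_op \<alpha> p (u p) = - fibre_op \<alpha> p (u p - x p)"
          using is_fibre_op_diff[OF F p up xp] is_fibre_op_dense_family[OF F x(1)] by simp
        then have "nrm (ip p) (t x p - fibre_op \<alpha> p (u p)) \<le> level_bound \<alpha> * nrm (ip p) (u p - x p)"
          using is_fibre_op_bound[OF F uxp] nrm_minus sub[OF is_fibre_op_mem[OF F uxp]] by simp
        moreover have "nrm (ip p) (t u p - t x p) \<le> level_bound \<alpha> * nrm (ip p) (u p - x p)"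
          using elim(1) x(1) by blast
        moreover have "t x p \<in> H \<alpha> p" using is_fibre_op_dense_family[OF F x(1)] is_fibre_op_mem[OF F xp] by simp
        \<comment> \<open>The factor 2 combines the error of \<open>t u p - t x p\<close> with that
          of the fibre operator applied to \<open>u p - x p\<close>.\<close>
        ultimately have "nrm (ip p) (t u p - fibre_op \<alpha> p (u p)) \<le> 2 * level_bound \<alpha> * nrm (ip p) (u p - x p)"
          using nrm_triangle_diff[of "t u p" "t x p" "fibre_op \<alpha> p (u p)"] tu is_fibre_op_mem[OF F up] sub by fastforce
        then show "\<exists>d<e. nrm (ip p) (t u p - fibre_op \<alpha> p (u p)) \<le> 2 * level_bound \<alpha> * d" using x(2) by blast
      qed
      then have "t u p - fibre_op \<alpha> p (u p) = 0"
        using fibre_definite[OF in_carrier[OF p], of "t u p - fibre_op \<alpha> p (u p)"] tu is_fibre_op_mem[OF F up] sub by simp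
      then show "t u p = fibre_op \<alpha> p (u p)" by simp
    qed
  qed
qed

section \<open>Compatibility of the fibre operators of different levels\<close>

lemma fibre_op_consistent_AE:
  assumes le: "\<alpha> \<le> \<beta>"
  shows "AE p in L. p \<in> X \<alpha> \<longrightarrow> (\<forall>h\<in>H \<alpha> p. fibre_op \<beta> p h = fibre_op \<alpha> p h)"
proof -
  \<comment> \<open>Members of the smaller family also belong to the larger level, so both fibre
    operators send \<open>x p\<close> to \<open>t x p\<close>; density and boundedness do the
    rest.\<close>
  have "AE p in L. \<forall>x\<in>dense_family \<alpha>. p \<in> X \<beta> \<longrightarrow> t x p = fibre_op \<beta> p (x p)"
    by (rule AE_dense_family) (rule fibre_op_apply_AE[OF subsetD[OF nlev_mono[OF le] dense_family_nlev]])
  then show ?thesis using is_fibre_op_AE[of \<alpha>] is_fibre_op_AE[of \<beta>]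
  proof eventually_elim
    case (elim p)
    show ?case
    proof (intro impI ballI)
      fix h assume p: "p \<in> X \<alpha>" and h: "h \<in> H \<alpha> p"
      have p': "p \<in> X \<beta>" using p M_mono(1)[OF le] by blast
      interpret semi_ip sc "Dp p" "ip p" using fibre_semi_ip[OF in_carrier[OF p]] .
      have F: "is_fibre_op \<alpha> p (fibre_op \<alpha> p)" "dense_at \<alpha> p" and G: "is_fibre_op \<beta> p (fibre_op \<beta> p)" using elim p p' by auto
      have sub: "x \<in> Dp p" if "x \<in> H \<beta> p" for x using that H_subset_Dp[OF p'] by blast
      have up: "x \<in> H \<beta> p" if "x \<in> H \<alpha> p" for x using that H_mono[OF p le] by blast
      have "nrm (ip p) (fibre_op \<beta> p h - fibre_op \<alpha> p h) = 0"
      proof (rule zero_of_small)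
        show "0 \<le> nrm (ip p) (fibre_op \<beta> p h - fibre_op \<alpha> p h)"
          using is_fibre_op_mem[OF G up[OF h]] is_fibre_op_mem[OF F(1) h] up sub by (intro nrm_nonneg) auto
        show "0 \<le> level_bound \<beta> + level_bound \<alpha>" using level_bound_nonneg by (simp add: add_nonneg_nonneg)
        fix e :: real assume "0 < e"
        then obtain x where x: "x \<in> dense_family \<alpha>" "nrm (ip p) (h - x p) < e"
          using F(2) h unfolding dense_at_def by blast
        have xp: "x p \<in> H \<alpha> p" using nlevD(2)[OF dense_family_nlev[OF x(1)] p] .
        have hx: "h - x p \<in> H \<alpha> p" using amb.subspace_diff[OF H_subspace[OF p] h xp] .
        have "fibre_op \<beta> p (x p) = fibre_op \<alpha> p (x p)" using elim(1) x(1) p' is_fibre_op_dense_family[OF F(1) x(1)] by simp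
        then have "fibre_op \<beta> p h - fibre_op \<alpha> p h = fibre_op \<beta> p (h - x p) - fibre_op \<alpha> p (h - x p)"
          using is_fibre_op_diff[OF F(1) p h xp] is_fibre_op_diff[OF G p' up[OF h] up[OF xp]] by simp
        also have "nrm (ip p) \<dots> \<le> nrm (ip p) (fibre_op \<beta> p (h - x p)) + nrm (ip p) (fibre_op \<alpha> p (h - x p))"
          using nrm_triangle[of "fibre_op \<beta> p (h - x p)" "- fibre_op \<alpha> p (h - x p)"] nrm_minus[of "fibre_op \<alpha> p (h - x p)"]
            is_fibre_op_mem[OF G up[OF hx]] is_fibre_op_mem[OF F(1) hx] sub up by simp
        also have "\<dots> \<le> (level_bound \<beta> + level_bound \<alpha>) * nrm (ip p) (h - x p)"
          using is_fibre_op_bound[OF G up[OF hx]] is_fibre_op_bound[OF F(1) hx] by (simp add: distrib_right)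
        finally show "\<exists>d<e. nrm (ip p) (fibre_op \<beta> p h - fibre_op \<alpha> p h) \<le> (level_bound \<beta> + level_bound \<alpha>) * d" using x(2) by blast
      qed
      then have "fibre_op \<beta> p h - fibre_op \<alpha> p h = 0"
        using fibre_definite[OF in_carrier[OF p], of "fibre_op \<beta> p h - fibre_op \<alpha> p h"]
          is_fibre_op_mem[OF G up[OF h]] is_fibre_op_mem[OF F(1) h] up sub by simp
      then show "fibre_op \<beta> p h = fibre_op \<alpha> p h" by simp
    qed
  qed
qed

text \<open>\<open>z\<close> is the residual of \<open>x\<close> under fibrewise projection onto the
  smaller level. It is orthogonal to that level as a map, hence so is its image under
  \<open>T\<close>, and cutting the test maps turns this into orthogonality in the fibres.\<close>

lemma orthogonal_split:
  assumes le: "\<alpha> \<le> \<beta>" and x: "x \<in> nlev \<beta>"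
  shows "\<exists>z\<in>nlev \<beta>. AE p in L. p \<in> X \<alpha> \<longrightarrow> x p - z p \<in> H \<alpha> p \<and>
    (\<forall>k\<in>H \<alpha> p. ip p (z p) k = 0) \<and> (\<forall>k\<in>H \<alpha> p. ip p (t z p) k = 0)"
proof -
  have xD: "x \<in> D" using nlevD(1)[OF x] .
  have "\<exists>w\<in>H \<alpha> p. \<forall>k\<in>H \<alpha> p. ip p (x p - w) k = 0" if p: "p \<in> X \<alpha>" for p
  proof -
    interpret semi_ip sc "Dp p" "ip p" using fibre_semi_ip[OF in_carrier[OF p]] .
    have "gauss_closed sc (H \<alpha> p)"
      unfolding gauss_closed_def using H_subspace[OF p] unfolding amb.subspace_def by blast
    then show ?thesis
      using projection[OF subset_refl H_subset_Dp[OF p] H_seq_complete[OF p]] D_fibre[OF xD in_carrier[OF p]]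
      by blast
  qed
  then obtain y0 where y0: "\<And>p. p \<in> X \<alpha> \<Longrightarrow> y0 p \<in> H \<alpha> p"
      "\<And>p k. p \<in> X \<alpha> \<Longrightarrow> k \<in> H \<alpha> p \<Longrightarrow> ip p (x p - y0 p) k = 0"
    by metis
  define y where "y = cut_to (X \<alpha>) y0"
  \<comment> \<open>The projections \<open>y0 p\<close> were chosen point by point. For
    \<open>u\<close> in the smaller level, pairing with them equals pairing with \<open>x\<close>,
    so maximality applies.\<close>
  have "integrable L (\<lambda>p. ip p (u p) (y p))" if u: "u \<in> nlev \<alpha>" for u
  proof -
    have "ip p (u p) (x p) = ip p (u p) (y p)" if "p \<in> space L" for p
    proof -
      have pc: "p \<in> loc_carrier M" using that by (simp add: space_L)
      interpret semi_ip sc "Dp p" "ip p" using fibre_semi_ip[OF pc] .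
      have xp: "x p \<in> Dp p" using D_fibre[OF xD pc] .
      show ?thesis
      proof (cases "p \<in> X \<alpha>")
        case True
        have up: "u p \<in> H \<alpha> p" using nlevD(2)[OF u True] .
        have mem: "u p \<in> Dp p" "y0 p \<in> Dp p" using up y0(1)[OF True] H_subset_Dp[OF True] by auto
        have "ip p (u p) (x p - y0 p) = 0"
          using y0(2)[OF True up] herm[of "x p - y0 p" "u p"] mem xp by simp
        then show ?thesis using diff_right[of "x p" "y0 p" "u p"] mem xp True by (simp add: y_def cut_to_def)
      next
        case False
        then show ?thesis using nlevD(3)[OF u] zero_left xp by (simp add: y_def cut_to_def)
      qed
    qed
    then show ?thesis using D_integrable[OF nlevD(1)[OF u] xD]
      by (simp cong: Bochner_Integration.integrable_cong)
  qed
  moreover have "y p \<in> H \<alpha> p" if "p \<in> X \<alpha>" for p using y0(1)[OF that] that by (simp add: y_def cut_to_def)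
  moreover have "y p = 0" if "p \<notin> X \<alpha>" for p using that by (simp add: y_def cut_to_def)
  ultimately obtain y' where y': "y' \<in> nlev \<alpha>" "AE p in L. y' p = y p"
    using level_maximal[of \<alpha> y] by blast
  define z where "z = x - y'"
  have zn: "z \<in> nlev \<beta>" unfolding z_def using nlev_diff[OF x] nlev_mono[OF le] y'(1) by blast
  have zD: "z \<in> D" using nlevD(1)[OF zn] .
  have z: "AE p in L. p \<in> X \<alpha> \<longrightarrow> (\<forall>k\<in>H \<alpha> p. ip p (z p) k = 0)"
    using y'(2) by eventually_elim (use y0(2) in \<open>auto simp: z_def y_def cut_to_def\<close>)
  have z_orth: "bL z v = 0" if v: "v \<in> nlev \<alpha>" for v
  proof (rule integral_eq_zero_AE)
    have "AE p in L. p \<in> space L" by simp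
    then show "AE p in L. ip p (z p) (v p) = 0"
      using z by eventually_elim
        (use nlevD(2,3)[OF v] fib_zero_right D_fibre[OF zD] in \<open>metis space_L\<close>)
  qed
  \<comment> \<open>Orthogonality of \<open>t z\<close> to every \<open>cut_to E v\<close> says that
    the integral of the fibre pairing over each measurable set \<open>E\<close> vanishes.\<close>
  have tz: "AE p in L. ip p (t z p) (v p) = 0" if v: "v \<in> nlev \<alpha>" for v
  proof (rule AE_zero_of_integral_zero)
    have tzD: "t z \<in> D" using t_props(1)[OF zD] .
    show "integrable L (\<lambda>p. ip p (t z p) (v p))" using D_integrable[OF tzD nlevD(1)[OF v]] .
    fix E assume E: "E \<in> sets L"
    have "(LINT p|L. (if p \<in> E then ip p (t z p) (v p) else 0)) = bL (t z) (cut_to E v)"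
      using D_fibre[OF tzD] by (intro Bochner_Integration.integral_cong)
        (auto simp: cut_to_def space_L fib_zero_right)
    then show "(LINT p|L. (if p \<in> E then ip p (t z p) (v p) else 0)) = 0"
      using t_orth[OF zD z_orth cut_nlev[OF E v]] by simp
  qed
  have "AE p in L. \<forall>v\<in>dense_family \<alpha>. ip p (t z p) (v p) = 0" by (rule AE_dense_family) (rule tz[OF dense_family_nlev])
  then have "AE p in L. p \<in> X \<alpha> \<longrightarrow> (\<forall>k\<in>H \<alpha> p. ip p (t z p) k = 0)"
    using dense_AE[of \<alpha>]
  proof eventually_elim
    case (elim p)
    show ?case
    proof (intro impI ballI)
      fix k assume p: "p \<in> X \<alpha>" and k: "k \<in> H \<alpha> p"
      interpret semi_ip sc "Dp p" "ip p" using fibre_semi_ip[OF in_carrier[OF p]] .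
      have tzp: "t z p \<in> Dp p" using D_fibre[OF t_props(1)[OF zD] in_carrier[OF p]] .
      have kp: "k \<in> Dp p" using k H_subset_Dp[OF p] by blast
      have "cmod (ip p (t z p) k) = 0"
      proof (rule zero_of_small[OF _ nrm_nonneg[OF tzp]])
        fix e :: real assume "0 < e"
        then obtain v where v: "v \<in> dense_family \<alpha>" "nrm (ip p) (k - v p) < e"
          using elim(2) p k unfolding dense_at_def by blast
        have vp: "v p \<in> Dp p" using D_fibre[OF dense_family_D[OF v(1)] in_carrier[OF p]] .
        have "ip p (t z p) k = ip p (t z p) (k - v p)"
          using diff_right[OF kp vp tzp] elim(1) v(1) by simp
        then have "cmod (ip p (t z p) k) \<le> nrm (ip p) (t z p) * nrm (ip p) (k - v p)"
          using cauchy_schwarz[OF tzp, of "k - v p"] kp vp by simp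
        then show "\<exists>d<e. cmod (ip p (t z p) k) \<le> nrm (ip p) (t z p) * d" using v(2) by blast
      qed simp
      then show "ip p (t z p) k = 0" by simp
    qed
  qed
  then have "AE p in L. p \<in> X \<alpha> \<longrightarrow> x p - z p \<in> H \<alpha> p \<and>
    (\<forall>k\<in>H \<alpha> p. ip p (z p) k = 0) \<and> (\<forall>k\<in>H \<alpha> p. ip p (t z p) k = 0)"
    using z by eventually_elim (use nlevD(2)[OF y'(1)] in \<open>auto simp: z_def\<close>)
  then show ?thesis using zn by blast
qed

text \<open>A vector orthogonal to the smaller fibre is approximated not by \<open>x p\<close> but
  by the corrected \<open>z x p\<close>, whose image is already known to be orthogonal; boundedness
  carries this over to the limit.\<close>

lemma fibre_op_orthogonal_AE:
  assumes le: "\<alpha> \<le> \<beta>"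
  shows "AE p in L. p \<in> X \<alpha> \<longrightarrow>
    (\<forall>h\<in>H \<beta> p. (\<forall>k\<in>H \<alpha> p. ip p h k = 0) \<longrightarrow> (\<forall>k\<in>H \<alpha> p. ip p (fibre_op \<beta> p h) k = 0))"
proof -
  have "\<forall>x\<in>dense_family \<beta>. \<exists>z. z \<in> nlev \<beta> \<and> (AE p in L. p \<in> X \<alpha> \<longrightarrow> x p - z p \<in> H \<alpha> p \<and>
    (\<forall>k\<in>H \<alpha> p. ip p (z p) k = 0) \<and> (\<forall>k\<in>H \<alpha> p. ip p (t (z) p) k = 0))"
    using orthogonal_split[OF le dense_family_nlev] unfolding Bex_def by (intro ballI)
  from bchoice[OF this] obtain z where "\<forall>x\<in>dense_family \<beta>. z x \<in> nlev \<beta> \<and> (AE p in L. p \<in> X \<alpha> \<longrightarrow> x p - z x p \<in> H \<alpha> p \<and>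
    (\<forall>k\<in>H \<alpha> p. ip p (z x p) k = 0) \<and> (\<forall>k\<in>H \<alpha> p. ip p (t (z x) p) k = 0))" ..
  then have z: "\<And>x. x \<in> dense_family \<beta> \<Longrightarrow> z x \<in> nlev \<beta>"
      "\<And>x. x \<in> dense_family \<beta> \<Longrightarrow> AE p in L. p \<in> X \<alpha> \<longrightarrow> x p - z x p \<in> H \<alpha> p \<and>
    (\<forall>k\<in>H \<alpha> p. ip p (z x p) k = 0) \<and> (\<forall>k\<in>H \<alpha> p. ip p (t (z x) p) k = 0)"
    by (blast dest: bspec)+
  have "AE p in L. \<forall>x\<in>dense_family \<beta>. p \<in> X \<alpha> \<longrightarrow> x p - z x p \<in> H \<alpha> p \<and>
    (\<forall>k\<in>H \<alpha> p. ip p (z x p) k = 0) \<and> (\<forall>k\<in>H \<alpha> p. ip p (t (z x) p) k = 0)"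
    by (rule AE_dense_family) (rule z(2))
  moreover have "AE p in L. \<forall>x\<in>dense_family \<beta>. p \<in> X \<beta> \<longrightarrow> t (z x) p = fibre_op \<beta> p (z x p)"
    by (rule AE_dense_family) (rule fibre_op_apply_AE[OF z(1)])
  ultimately show ?thesis using is_fibre_op_AE[of \<beta>]
  proof eventually_elim
    case (elim p)
    show ?case
    proof (intro impI ballI)
      fix h k assume p: "p \<in> X \<alpha>" and h: "h \<in> H \<beta> p" and orth: "\<forall>k\<in>H \<alpha> p. ip p h k = 0"
        and k: "k \<in> H \<alpha> p"
      have p': "p \<in> X \<beta>" using p M_mono(1)[OF le] by blast
      interpret semi_ip sc "Dp p" "ip p" using fibre_semi_ip[OF in_carrier[OF p]] .
      have F: "is_fibre_op \<beta> p (fibre_op \<beta> p)" "dense_at \<beta> p" using elim p' by auto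
      have sub: "x \<in> Dp p" if "x \<in> H \<beta> p" for x using that H_subset_Dp[OF p'] by blast
      have up: "x \<in> H \<beta> p" if "x \<in> H \<alpha> p" for x using that H_mono[OF p le] by blast
      note kp = sub[OF up[OF k]]
      have "cmod (ip p (fibre_op \<beta> p h) k) = 0"
      proof (rule zero_of_small)
        show "0 \<le> level_bound \<beta> * nrm (ip p) k" using level_bound_nonneg nrm_nonneg[OF kp] by simp
        fix e :: real assume "0 < e"
        then obtain x where x: "x \<in> dense_family \<beta>" "nrm (ip p) (h - x p) < e"
          using F(2) h unfolding dense_at_def by blast
        have zx: "x p - z x p \<in> H \<alpha> p" "\<forall>k\<in>H \<alpha> p. ip p (z x p) k = 0" "\<forall>k\<in>H \<alpha> p. ip p (t (z x) p) k = 0"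
          using elim(1) x(1) p by blast+
        have zp: "z x p \<in> H \<beta> p" using nlevD(2)[OF z(1)[OF x(1)] p'] .
        have hz: "h - z x p \<in> H \<beta> p" using amb.subspace_diff[OF H_subspace[OF p'] h zp] .
        \<comment> \<open>Both \<open>h\<close> and \<open>z x p\<close> are orthogonal to the
          smaller fibre, which contains \<open>x p - z x p\<close>. By Pythagoras,
          \<open>z x p\<close> is at least as close to \<open>h\<close> as
          \<open>x p\<close>.\<close>
        have "ip p (h - z x p) (x p - z x p) = 0"
          using diff_left[OF sub[OF h] sub[OF zp] sub[OF up[OF zx(1)]]] orth zx by simp
        then have "(nrm (ip p) ((h - z x p) - (x p - z x p)))\<^sup>2
            = (nrm (ip p) (h - z x p))\<^sup>2 + (nrm (ip p) (x p - z x p))\<^sup>2"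
          using nrm_diff_sq[OF sub[OF hz] sub[OF up[OF zx(1)]]] by simp
        then have "(nrm (ip p) (h - z x p))\<^sup>2 \<le> (nrm (ip p) (h - x p))\<^sup>2" by simp
        moreover have "0 \<le> nrm (ip p) (h - x p)"
          using sub[OF h] D_fibre[OF dense_family_D[OF x(1)] in_carrier[OF p]] by (intro nrm_nonneg) auto
        ultimately have small: "nrm (ip p) (h - z x p) < e"
          using power2_le_imp_le x(2) by fastforce
        have mem: "fibre_op \<beta> p h \<in> Dp p" "fibre_op \<beta> p (z x p) \<in> Dp p" "fibre_op \<beta> p (h - z x p) \<in> Dp p"
          using is_fibre_op_mem[OF F(1)] h zp hz sub by auto
        have "ip p (fibre_op \<beta> p (z x p)) k = 0" using zx(3) k elim(2) x(1) p' by simp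
        then have "ip p (fibre_op \<beta> p h) k = ip p (fibre_op \<beta> p (h - z x p)) k"
          using is_fibre_op_diff[OF F(1) p' h zp] diff_left[OF mem(1,2) kp] by simp
        then have "cmod (ip p (fibre_op \<beta> p h) k) \<le> nrm (ip p) (fibre_op \<beta> p (h - z x p)) * nrm (ip p) k"
          using cauchy_schwarz[OF mem(3) kp] by simp
        also have "\<dots> \<le> (level_bound \<beta> * nrm (ip p) (h - z x p)) * nrm (ip p) k"
          using is_fibre_op_bound[OF F(1) hz] nrm_nonneg[OF kp] by (rule mult_right_mono)
        finally show "\<exists>d<e. cmod (ip p (fibre_op \<beta> p h) k) \<le> level_bound \<beta> * nrm (ip p) k * d"
          using small by (auto simp: mult_ac)
      qed simp
      then show "ip p (fibre_op \<beta> p h) k = 0" by simp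
    qed
  qed
qed

section \<open>Gluing the fibre operators of all levels\<close>

definition compatible_at where
  "compatible_at p \<longleftrightarrow> (\<forall>\<alpha> \<beta>. p \<in> X \<alpha> \<longrightarrow> is_fibre_op \<alpha> p (fibre_op \<alpha> p) \<and> (\<alpha> \<le> \<beta> \<longrightarrow>
    (\<forall>h\<in>H \<alpha> p. fibre_op \<beta> p h = fibre_op \<alpha> p h) \<and>
    (\<forall>h\<in>H \<beta> p. (\<forall>k\<in>H \<alpha> p. ip p h k = 0) \<longrightarrow> (\<forall>k\<in>H \<alpha> p. ip p (fibre_op \<beta> p h) k = 0))))"

definition S where
  "S p = (\<lambda>x\<in>Dp p. if compatible_at p then fibre_op (SOME \<alpha>. p \<in> X \<alpha> \<and> x \<in> H \<alpha> p) p x else 0)"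

text \<open>The level chosen in \<open>S\<close> does not matter, because two levels containing
  \<open>x\<close> are compared through a common upper one.\<close>

lemma S_eq_fibre_op:
  assumes compatible_at: "compatible_at p" and p: "p \<in> X \<alpha>" and x: "x \<in> H \<alpha> p"
  shows "S p x = fibre_op \<alpha> p x"
proof -
  define \<beta> where "\<beta> = (SOME \<alpha>. p \<in> X \<alpha> \<and> x \<in> H \<alpha> p)"
  have \<beta>: "p \<in> X \<beta> \<and> x \<in> H \<beta> p"
    unfolding \<beta>_def using p x by (intro someI_ex[of "\<lambda>\<alpha>. p \<in> X \<alpha> \<and> x \<in> H \<alpha> p"]) blast
  obtain \<gamma> where "\<alpha> \<le> \<gamma>" "\<beta> \<le> \<gamma>" using directed by blast
  then have "fibre_op \<gamma> p x = fibre_op \<alpha> p x" "fibre_op \<gamma> p x = fibre_op \<beta> p x" using compatible_at p x \<beta> unfolding compatible_at_def by blast+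
  moreover have "x \<in> Dp p" using x H_subset_Dp[OF p] by blast
  ultimately show ?thesis using compatible_at by (simp add: S_def \<beta>_def)
qed

lemma S_loc_bounded:
  assumes p: "p \<in> loc_carrier M"
  shows "S p \<in> loc_bounded_ops (FS p) (idx M p) (\<lambda>\<alpha>. H \<alpha> p)"
proof -
  interpret semi_ip sc "Dp p" "ip p" using fibre_semi_ip[OF p] .
  have sub: "x \<in> Dp p" if "\<alpha> \<in> idx M p" "x \<in> H \<alpha> p" for x \<alpha>
    using that H_subset_Dp[of p \<alpha>] by (auto simp: idx_def)
  show ?thesis
  proof (cases "compatible_at p")
    case True
    have fibre_op: "is_fibre_op \<alpha> p (fibre_op \<alpha> p)" if "\<alpha> \<in> idx M p" for \<alpha>
      using True that unfolding compatible_at_def idx_def by blast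
    have Seq: "S p x = fibre_op \<alpha> p x" if "\<alpha> \<in> idx M p" "x \<in> H \<alpha> p" for x \<alpha>
      using S_eq_fibre_op[OF True] that by (simp add: idx_def)
    have Hsub: "amb.subspace (H \<alpha> p)" if "\<alpha> \<in> idx M p" for \<alpha>
      using that H_subspace[of p \<alpha>] by (simp add: idx_def)
    have DpE: "\<exists>\<alpha>\<in>idx M p. x \<in> H \<alpha> p" if "x \<in> Dp p" for x using that by (simp add: Dp_def)
    show ?thesis
      unfolding loc_bounded_ops_def linear_in_def
    proof (intro CollectI conjI ballI allI)
      show "S p \<in> vecs (FS p) \<rightarrow>\<^sub>E vecs (FS p)"
        unfolding vecs_FS
      proof (rule PiE_I)
        fix x assume "x \<in> Dp p"
        then obtain \<alpha> where "\<alpha> \<in> idx M p" "x \<in> H \<alpha> p" using DpE by blast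
        then show "S p x \<in> Dp p" using Seq is_fibre_op_mem[OF fibre_op] sub by simp
      qed (simp add: S_def)
      fix x assume "x \<in> vecs (FS p)"
      then have x: "x \<in> Dp p" by simp
      show "S p (vscale (FS p) c x) = vscale (FS p) c (S p x)" for c
      proof -
        obtain \<alpha> where "\<alpha> \<in> idx M p" "x \<in> H \<alpha> p" using DpE[OF x] by blast
        then show ?thesis using Seq is_fibre_op_scale[OF fibre_op] amb.subspace_scale[OF Hsub] by simp
      qed
      fix y assume "y \<in> vecs (FS p)"
      then have y: "y \<in> Dp p" by simp
      obtain \<alpha> where "\<alpha> \<in> idx M p" "x \<in> H \<alpha> p" "y \<in> H \<alpha> p" using Dp_common[OF x y] by blast
      then show "S p (vadd (FS p) x y) = vadd (FS p) (S p x) (S p y)"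
        using Seq is_fibre_op_add[OF fibre_op] amb.subspace_add[OF Hsub] by simp
    next
      fix \<alpha> assume a: "\<alpha> \<in> idx M p"
      show "S p ` H \<alpha> p \<subseteq> H \<alpha> p" using Seq[OF a] is_fibre_op_mem[OF fibre_op[OF a]] by auto
      show "\<exists>B. \<forall>x\<in>H \<alpha> p. vnorm (FS p) (S p x) \<le> B * vnorm (FS p) x"
        unfolding vnorm_FS using Seq[OF a] is_fibre_op_bound[OF fibre_op[OF a]] by auto
      show "S p ` orth_in (FS p) (H \<alpha> p) \<subseteq> orth_in (FS p) (H \<alpha> p)"
      proof
        fix y assume "y \<in> S p ` orth_in (FS p) (H \<alpha> p)"
        then obtain h where h: "h \<in> Dp p" "\<forall>k\<in>H \<alpha> p. ip p h k = 0" "y = S p h"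
          unfolding orth_in_def by auto
        obtain \<beta> where \<beta>: "\<beta> \<in> idx M p" "h \<in> H \<beta> p" using DpE[OF h(1)] by blast
        \<comment> \<open>The level \<open>\<beta>\<close> containing \<open>h\<close> need not be
          comparable with \<open>\<alpha>\<close>; compatibility is applied to
          \<open>\<alpha>\<close> and a level above both.\<close>
        obtain \<gamma> where \<gamma>: "\<gamma> \<in> idx M p" "\<alpha> \<le> \<gamma>" "\<beta> \<le> \<gamma>" using idx_directed[OF a] by blast
        have hg: "h \<in> H \<gamma> p" using \<beta> \<gamma> H_mono[of p \<beta> \<gamma>] by (auto simp: idx_def)
        have "\<forall>k\<in>H \<alpha> p. ip p (fibre_op \<gamma> p h) k = 0"
          using True a \<gamma>(2) hg h(2) unfolding compatible_at_def idx_def by blast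
        moreover have "y = fibre_op \<gamma> p h" using h(3) Seq[OF \<gamma>(1) hg] by simp
        moreover have "y \<in> Dp p" using h(3) Seq[OF \<gamma>(1) hg] is_fibre_op_mem[OF fibre_op[OF \<gamma>(1)] hg] sub[OF \<gamma>(1)] by simp
        ultimately show "y \<in> orth_in (FS p) (H \<alpha> p)" unfolding orth_in_def by simp
      qed
    qed
  next
    case False
    then have S0: "S p = (\<lambda>x\<in>Dp p. 0)" by (simp add: S_def)
    have 0: "0 \<in> H \<alpha> p" if "\<alpha> \<in> idx M p" for \<alpha>
      using that H_subspace[of p \<alpha>] amb.subspace_0 by (simp add: idx_def)
    have bnd: "\<exists>B. \<forall>x\<in>H \<alpha> p. vnorm (FS p) (S p x) \<le> B * vnorm (FS p) x" if "\<alpha> \<in> idx M p" for \<alpha>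
      unfolding vnorm_FS using sub[OF that] by (intro exI[of _ 0]) (simp add: S0 nrm_zero)
    show ?thesis
      unfolding loc_bounded_ops_def linear_in_def using sub 0 zero_left bnd
      by (auto simp: S0 orth_in_def)
  qed
qed

lemma decomposable:
  assumes cc: "countable (UNIV :: 'a set) \<or>
       (\<forall>E\<in>sets L. emeasure L E = emeasure (count_space (loc_carrier M)) E)"
  shows "T \<in> decomposable_ops M sc ip H D"
proof -
  have "AE p in L. p \<in> X \<alpha> \<longrightarrow> is_fibre_op \<alpha> p (fibre_op \<alpha> p) \<and> (\<alpha> \<le> \<beta> \<longrightarrow>
    (\<forall>h\<in>H \<alpha> p. fibre_op \<beta> p h = fibre_op \<alpha> p h) \<and>
    (\<forall>h\<in>H \<beta> p. (\<forall>k\<in>H \<alpha> p. ip p h k = 0) \<longrightarrow> (\<forall>k\<in>H \<alpha> p. ip p (fibre_op \<beta> p h) k = 0)))" for \<alpha> \<beta>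
  proof (cases "\<alpha> \<le> \<beta>")
    case True
    show ?thesis using is_fibre_op_AE[of \<alpha>] fibre_op_consistent_AE[OF True] fibre_op_orthogonal_AE[OF True]
      by eventually_elim blast
  next
    case False
    show ?thesis using is_fibre_op_AE[of \<alpha>] by eventually_elim (use False in blast)
  qed
  then have compatible_at: "AE p in L. compatible_at p"
    unfolding compatible_at_def by (intro AE_all_indices[OF cc])
  have "AE p in L. w p = S p (u p)" if u: "u \<in> D" and w: "w \<in> T (cls u)" for u w
  proof -
    obtain \<alpha> v where v: "v \<in> nlev \<alpha>" "AE p in L. v p = u p" using D_representative[OF u] by blast
    have "AE p in L. w p = t u p" using w unfolding t_props(2)[OF u] mem_cls by blast
    moreover have "AE p in L. t v p = t u p" using t_cong[OF nlevD(1)[OF v(1)] u v(2)] .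
    moreover have "AE p in L. p \<in> space L" by simp
    ultimately show ?thesis using v(2) fibre_op_apply_AE[OF v(1)] t_level_AE[OF v(1)] compatible_at
    proof eventually_elim
      case (elim p)
      show ?case
      proof (cases "p \<in> X \<alpha>")
        case True
        then show ?thesis using elim S_eq_fibre_op[OF elim(7) True nlevD(2)[OF v(1) True]] by simp
      next
        case False
        \<comment> \<open>Here \<open>u p\<close> and its image are both 0, and
          \<open>S p 0 = 0\<close> is read off from any level containing the point.\<close>
        obtain \<beta> where \<beta>: "p \<in> X \<beta>" using elim(3) by (auto simp: space_L loc_carrier_def)
        have "S p 0 = fibre_op \<beta> p 0" using S_eq_fibre_op[OF elim(7) \<beta>] amb.subspace_0[OF H_subspace[OF \<beta>]] by blast
        also have "\<dots> = 0" using is_fibre_op_zero[of \<beta> p] elim(7) \<beta> unfolding compatible_at_def by blast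
        finally show ?thesis using elim False nlevD(3)[OF v(1) False] by simp
      qed
    qed
  qed
  then show ?thesis using T S_loc_bounded unfolding decomposable_ops_def by blast
qed

end

theorem theorem4p10:
  fixes M :: "'i::order \<Rightarrow> 'x measure"
    and sc :: "complex \<Rightarrow> 'h::ab_group_add \<Rightarrow> 'h"
    and ip :: "'x \<Rightarrow> 'h \<Rightarrow> 'h \<Rightarrow> complex"
    and H :: "'i \<Rightarrow> 'x \<Rightarrow> 'h set"
    and D :: "('x \<Rightarrow> 'h) set"
  assumes directed: "\<forall>\<alpha> \<beta> :: 'i. \<exists>\<gamma>. \<alpha> \<le> \<gamma> \<and> \<beta> \<le> \<gamma>"
    and measure: "locally_measure_space M"
    and ambient: "vector_space sc"
    and fibres: "\<forall>p\<in>loc_carrier M. quantized_domain sc (ip p) (idx M p) (\<lambda>\<alpha>. H \<alpha> p)"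
    and integral: "loc_direct_integral M sc ip H D"
    and countable_or_counting:
      "countable (UNIV :: 'i set) \<or>
       (\<forall>E\<in>sets (loc_measure M).
          emeasure (loc_measure M) E = emeasure (count_space (loc_carrier M)) E)"
  shows "decomposable_ops M sc ip H D =
         commutant_in (integral_space M sc ip D) UNIV (level M H D) (diagonalizable_ops M sc ip H D)"
proof -
  interpret loc_int M sc ip H D
    by (intro loc_int.intro loc_ms.intro loc_int_axioms.intro directed measure ambient fibres integral)
  show ?thesis
  proof
    show "decomposable_ops M sc ip H D \<subseteq> commutant_in IS UNIV (level M H D) (diagonalizable_ops M sc ip H D)"
    proof
      fix T assume T: "T \<in> decomposable_ops M sc ip H D"
      then have "T \<in> loc_bounded_ops IS UNIV (level M H D)" unfolding decomposable_ops_def by blast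
      then show "T \<in> commutant_in IS UNIV (level M H D) (diagonalizable_ops M sc ip H D)"
        unfolding commutant_in_def using decomposable_commutes[OF T] by blast
    qed
    show "commutant_in IS UNIV (level M H D) (diagonalizable_ops M sc ip H D) \<subseteq> decomposable_ops M sc ip H D"
    proof
      fix T assume T: "T \<in> commutant_in IS UNIV (level M H D) (diagonalizable_ops M sc ip H D)"
      interpret commuting_op M sc ip H D T
      proof
        show "T \<in> loc_bounded_ops IS UNIV (level M H D)" using T unfolding commutant_in_def by blast
        show "T (mulop E A) = mulop E (T A)" if "E \<in> sets L" "A \<in> vecs IS" for E A
          using T mulop_diagonalizable[OF that(1)] that(2) unfolding commutant_in_def by blast
      qed
      show "T \<in> decomposable_ops M sc ip H D" by (rule decomposable[OF countable_or_counting])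
    qed
  qed
qed

end
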